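(* Let $\mathfrak{P}_{\mathrm{sg}}=\mathfrak{P}_{\mathrm{sg}}(M,\sigma,\bar K)$ with $M,\sigma>0$, $\bar K\ge2$ fixed, and let $\rho\ge0$. There is a constant $c_6>0$ independent of the algorithm such that under any bandit algorithm, $$\liminf_{T\to\infty}\frac{\sup_{\nu\in\mathfrak{P}_{\mathrm{sg}}}\left(R_T(\nu)+(S_T(\nu))^\rho\right)}{\sqrt T\vee\left(T^{\frac{3\rho}{2+2\rho}}\wedge T\right)}>c_6 .$$ Furthermore, if $\rho\in[0,2]$, then the UCB-f algorithm with exploration function $f(t)=t^{\left(\frac{2\rho-1}{2+2\rho}\right)^+}\log t$ achieves $$\sup_{\nu\in\mathfrak{P}_{\mathrm{sg}}}\left(R_T(\nu)+(S_T(\nu))^\rho\right)=\tilde\Theta\!\left(\sqrt T\vee T^{\frac{3\rho}{2+2\rho}}\right).$$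
   Context: Stochastic multi-armed bandit. There are $K$ arms; for each arm $i\in[K]=\{1,\dots,K\}$, $(X^i_s)_{s\ge1}$ is an i.i.d. reward sequence with law $\nu_i$, independent across arms; $\nu=(\nu_1,\dots,\nu_K)$ is the (unknown) bandit instance. For a horizon $T$, an algorithm selects at each time $t\in[T]$ an arm $A_t\sim\pi_t(\cdot\mid\mathcal H_{t-1})$, where $\mathcal H_{t-1}=(A_1,r_1,\dots,A_{t-1},r_{t-1})$ is the observed history, $\pi_t(\cdot\mid \mathcal H_{t-1})$ is a distribution on $[K]$, $N_{i,t}=\sum_{s=1}^t\mathbf 1\{A_s=i\}$, and $r_t=X^{A_t}_{N_{A_t,t}}$. An algorithm thus specifies decision rules $(\pi_t)_{t\in[T]}$ for every horizon $T$ and every number of arms $K$ (the rules may depend on $T$, $K$). Let $\mu_i$ be the mean of $\nu_i$, $\Delta_i=\max_j\mu_j-\mu_i$. Regret: $R_T(\nu)=\sum_{i=1}^K\Delta_i\,\mathbb E[N_{i,T}]$. Allocation variability: $S_T(\nu)=\max_{i\in[K]}\sqrt{\operatorname{Var}(N_{i,T})}$. $\mathfrak{P}_{\mathrm{sg}}(M,\sigma,\bar K)$ is the class of instances $\nu=(\nu_1,\dots,\nu_K)$ with $2\le K\le\bar K$ such that each $\nu_i$ has mean $\mu_i\in[-M,M]$ and is $\sigma$-sub-Gaussian. Standing assumptions on algorithms: (i) if $\nu_i=\nu_j$ for some $i\ne j$ then $\mathbb E[N_{i,T}]=\mathbb E[N_{j,T}]$; (ii) for $T\ge K$, $\mathbb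 E[N_{i,T}]\ge1$ for each arm $i$. Algorithm UCB-f with exploration function $f$: at times $t=1,\dots,K$ pull each arm once. At each time $t=K+1,\dots,T$ pull $A_t\in\arg\max_{i\in[K]}\{\widehat\mu_{i,t-1}+f(t)/\sqrt{N_{i,t-1}}\}$, where $\widehat\mu_{i,t-1}=\frac1{N_{i,t-1}}\sum_{s=1}^{N_{i,t-1}}X^i_s$. Notation: $x^+=\max\{x,0\}$, $\vee=\max$, $\wedge=\min$; $\tilde\Theta$ suppresses factors polylogarithmic in $T$, as $T\to\infty$. *)

theory Defs
  imports "HOL-Probability.Probability" "HOL-Library.Landau_Symbols"
begin

section \<open>Bandit instances\<close>

text \<open>A bandit instance with \<open>K\<close> arms is the list of its \<open>K\<close> reward laws. The arms are
  \<open>{..<length \<nu>}\<close>, i.e. arm indices start at 0.\<close>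

type_synonym inst = "real measure list"

definition bandit_instance :: "inst \<Rightarrow> bool" where
  "bandit_instance \<nu> \<longleftrightarrow>
     \<nu> \<noteq> [] \<and> (\<forall>P\<in>set \<nu>. real_distribution P \<and> integrable P (\<lambda>x. x))"

definition mean :: "real measure \<Rightarrow> real" where
  "mean P = (\<integral>x. x \<partial>P)"

definition gap :: "inst \<Rightarrow> nat \<Rightarrow> real" where
  "gap \<nu> i = Max ((\<lambda>j. mean (\<nu> ! j)) ` {..<length \<nu>}) - mean (\<nu> ! i)"

definition sub_gaussian :: "real \<Rightarrow> real measure \<Rightarrow> bool" where
  "sub_gaussian \<sigma> P \<longleftrightarrow>
     (\<forall>l::real. integrable P (\<lambda>x. exp (l * (x - mean P))) \<and>
        (\<integral>x. exp (l * (x - mean P)) \<partial>P) \<le> exp (l\<^sup>2 * \<sigma>\<^sup>2 / 2))"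

definition sg_class :: "real \<Rightarrow> real \<Rightarrow> nat \<Rightarrow> inst set" where
  "sg_class M \<sigma> Kbar =
     {\<nu>. bandit_instance \<nu> \<and> 2 \<le> length \<nu> \<and> length \<nu> \<le> Kbar \<and>
         (\<forall>P\<in>set \<nu>. mean P \<in> {-M..M} \<and> sub_gaussian \<sigma> P)}"

text \<open>The law of the table of potential rewards: entry \<open>(i, s)\<close> is the reward of the
  \<open>s\<close>-th pull of arm \<open>i\<close>, with \<open>s \<ge> 1\<close>; all entries are independent.\<close>

definition reward_table :: "inst \<Rightarrow> (nat \<times> nat \<Rightarrow> real) measure" where
  "reward_table \<nu> = (\<Pi>\<^sub>M (i, s) \<in> {..<length \<nu>} \<times> {1..}. \<nu> ! i)"


section \<open>Algorithms and the interaction protocol\<close>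

text \<open>A history lists the pairs (arm, reward) in chronological order. A policy maps the history
  of the first \<open>t - 1\<close> rounds to the distribution of the arm pulled in round \<open>t\<close>; the round
  is one plus the length of the history. An algorithm \<open>alg\<close> provides a policy
  \<open>alg T K\<close> for each horizon \<open>T\<close> and number of arms \<open>K\<close>.\<close>

type_synonym history = "(nat \<times> real) list"
type_synonym policy = "history \<Rightarrow> nat pmf"
type_synonym algorithm = "nat \<Rightarrow> nat \<Rightarrow> policy"

definition pulls :: "nat \<Rightarrow> history \<Rightarrow> nat" where
  "pulls i h = count_list (map fst h) i"

text \<open>Second condition: since the arms are discrete, a policy is a probability kernel iff the
  probability of each arm is, for each fixed sequence of past arms, a Borel function of the past
  rewards.\<close>

definition decision_rules :: "algorithm \<Rightarrow> bool" where
  "decision_rules alg \<longleftrightarrow>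
     (\<forall>T. \<forall>K\<ge>1.
        (\<forall>h. length h < T \<and> fst ` set h \<subseteq> {..<K} \<longrightarrow> set_pmf (alg T K h) \<subseteq> {..<K}) \<and>
        (\<forall>as b. length as < T \<and> set as \<subseteq> {..<K} \<longrightarrow>
           (\<lambda>r. pmf (alg T K (zip as (map r [0..<length as]))) b)
             \<in> borel_measurable (\<Pi>\<^sub>M _ \<in> {..<length as}. borel)))"

text \<open>The distribution of the history after \<open>t\<close> rounds, conditionally on the reward table
  \<open>x\<close>: each arm is drawn from the policy with fresh randomness, and a pull of arm \<open>a\<close>
  reveals the first unrevealed entry of row \<open>a\<close>.\<close>

primrec history_given :: "policy \<Rightarrow> (nat \<times> nat \<Rightarrow> real) \<Rightarrow> nat \<Rightarrow> history pmf" where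
  "history_given \<pi> x 0 = return_pmf []"
| "history_given \<pi> x (Suc t) =
     bind_pmf (history_given \<pi> x t)
       (\<lambda>h. map_pmf (\<lambda>a. h @ [(a, x (a, Suc (pulls a h)))]) (\<pi> h))"

text \<open>The unconditional law of the arms \<open>[A\<^sub>1, \<dots>, A\<^sub>T]\<close> pulled up to the horizon.\<close>

definition arms_law :: "algorithm \<Rightarrow> nat \<Rightarrow> inst \<Rightarrow> nat list measure" where
  "arms_law alg T \<nu> =
     Giry_Monad.bind (reward_table \<nu>)
       (\<lambda>x. measure_pmf (map_pmf (map fst) (history_given (alg T (length \<nu>)) x T)))"

definition exp_pulls :: "algorithm \<Rightarrow> nat \<Rightarrow> inst \<Rightarrow> nat \<Rightarrow> real" where
  "exp_pulls alg T \<nu> i = (\<integral>as. real (count_list as i) \<partial>arms_law alg T \<nu>)"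

definition var_pulls :: "algorithm \<Rightarrow> nat \<Rightarrow> inst \<Rightarrow> nat \<Rightarrow> real" where
  "var_pulls alg T \<nu> i =
     (\<integral>as. (real (count_list as i) - exp_pulls alg T \<nu> i)\<^sup>2 \<partial>arms_law alg T \<nu>)"

text \<open>Symmetry is only required for horizons \<open>T \<ge> K\<close>, so that initialising with one pull of
  each arm in a fixed order is not excluded.\<close>

definition admissible :: "algorithm \<Rightarrow> bool" where
  "admissible alg \<longleftrightarrow>
     decision_rules alg \<and>
     (\<forall>\<nu> T. bandit_instance \<nu> \<and> length \<nu> \<le> T \<longrightarrow>
        (\<forall>i<length \<nu>. \<forall>j<length \<nu>. \<nu> ! i = \<nu> ! j \<longrightarrow>
           exp_pulls alg T \<nu> i = exp_pulls alg T \<nu> j) \<and>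
        (\<forall>i<length \<nu>. exp_pulls alg T \<nu> i \<ge> 1))"


section \<open>Regret and allocation variability\<close>

definition regret :: "algorithm \<Rightarrow> nat \<Rightarrow> inst \<Rightarrow> real" where
  "regret alg T \<nu> = (\<Sum>i<length \<nu>. gap \<nu> i * exp_pulls alg T \<nu> i)"

definition alloc_variability :: "algorithm \<Rightarrow> nat \<Rightarrow> inst \<Rightarrow> real" where
  "alloc_variability alg T \<nu> = Max ((\<lambda>i. sqrt (var_pulls alg T \<nu> i)) ` {..<length \<nu>})"

text \<open>Real powers of nonnegative numbers with \<open>0\<^sup>0 = 1\<close>, whereas \<open>0 powr 0 = 0\<close>.\<close>

definition rpow :: "real \<Rightarrow> real \<Rightarrow> real" where
  "rpow x \<rho> = (if \<rho> = 0 then 1 else x powr \<rho>)"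

definition worst_case :: "inst set \<Rightarrow> real \<Rightarrow> algorithm \<Rightarrow> nat \<Rightarrow> ereal" where
  "worst_case \<PP> \<rho> alg T =
     (SUP \<nu>\<in>\<PP>. ereal (regret alg T \<nu> + rpow (alloc_variability alg T \<nu>) \<rho>))"


section \<open>The UCB-f algorithm\<close>

definition emp_mean :: "nat \<Rightarrow> history \<Rightarrow> real" where
  "emp_mean i h = sum_list (map snd (filter (\<lambda>(a, r). a = i) h)) / real (pulls i h)"

definition ucb_index :: "(nat \<Rightarrow> real) \<Rightarrow> history \<Rightarrow> nat \<Rightarrow> real" where
  "ucb_index f h i = emp_mean i h + f (Suc (length h)) / sqrt (real (pulls i h))"

text \<open>The order of the first \<open>K\<close> pulls and the (possibly randomised) selection among several
  maximisers are left open. Histories of length at least \<open>K\<close> in which some arm was never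
  pulled do not arise, and are not constrained.\<close>

definition is_ucb :: "(nat \<Rightarrow> real) \<Rightarrow> algorithm \<Rightarrow> bool" where
  "is_ucb f alg \<longleftrightarrow>
     (\<forall>T. \<forall>K\<ge>1. \<forall>h. length h < T \<and> fst ` set h \<subseteq> {..<K} \<longrightarrow>
        (length h < K \<longrightarrow> set_pmf (alg T K h) \<subseteq> {i. i < K \<and> pulls i h = 0}) \<and>
        (length h \<ge> K \<and> (\<forall>i<K. pulls i h \<ge> 1) \<longrightarrow>
           set_pmf (alg T K h) \<subseteq> {i. is_arg_max (ucb_index f h) (\<lambda>i. i < K) i}))"


section \<open>Asymptotics up to polylogarithmic factors\<close>

text \<open>The functions that are eventually finite and \<open>\<Theta>(g)\<close> up to polylogarithmic factors.\<close>

definition soft_theta :: "(nat \<Rightarrow> real) \<Rightarrow> (nat \<Rightarrow> ereal) set" where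
  "soft_theta g =
     {w. \<exists>u (k::nat). (\<forall>\<^sub>F T in sequentially. w T = ereal (u T)) \<and>
           u \<in> O(\<lambda>T. g T * ln (real T) ^ k) \<and>
           u \<in> \<Omega>(\<lambda>T. g T / ln (real T) ^ k)}"

end

theory Submission
  imports Defs "HOL-Real_Asymp.Real_Asymp"
begin

text \<open>
  Lower bound. Start from two identical arms, where symmetry forces half of the pulls on each, and raise the mean of the
  second one in \<open>m\<close> steps of order \<open>1 / \<surd>T\<close>. One step changes the law of the rewards by a bounded chi-square distance, so
  by Cauchy--Schwarz it changes the expected pull count of the first arm by at most a constant times its standard deviation.
  Hence either this count is still of order \<open>T\<close> after \<open>m\<close> steps, which costs regret of order \<open>m \<surd>T\<close>, or the standard
  deviation was at least of order \<open>T / m\<close> on the way; the stated rate balances \<open>m \<surd>T\<close> against \<open>(T / m)\<^sup>\<rho>\<close>.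

  Upper bound. With high probability all empirical means are within \<open>g / \<surd>n\<close> of the true means after \<open>n\<close> pulls, where
  \<open>g\<close> is of order \<open>\<surd>(ln T)\<close>. On this event UCB-f is a perturbation, of relative size \<open>g / f\<close>, of a deterministic rule.
  Compare two such runs, and let the best arm be pulled at least as often in the first one as in the second one. Comparing
  indices at the last pulls shows that every other arm is pulled at most \<open>1 + O(g / f)\<close> times as often in the second run
  as in the first. As the counts sum to \<open>T\<close> in both runs, all of them agree up to \<open>O(T g / f)\<close>, which bounds the variability.
\<close>

section \<open>The law of the pulled arms\<close>

text \<open>The exponent \<open>e = (2 * \<rho> - 1) / (2 + 2 * \<rho>)\<close> solves
  \<open>e + 1 / 2 = (1 - e) * \<rho>\<close>. In the lower bound it is the exponent of the number
  of steps \<open>m\<close>; in the upper bound it is that of the bonus, since a bonus of order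
  \<open>T powr e\<close> costs regret \<open>T powr (e + 1 / 2)\<close> and leaves the counts
  uncertain by \<open>T powr (1 - e)\<close>, up to logarithms. It reaches 1/2 at
  \<open>\<rho> = 2\<close>; beyond that \<open>m\<close> steps would need an unbounded gap, and the
  bonus would outgrow the square root of time. Below \<open>\<rho> = 1 / 2\<close> it is negative: a
  single step then yields the square root term. The obstacle in the upper bound is that the arms are
  last pulled at different times, with different bonuses, and all of these must be replaced by
  \<open>f T\<close>. For the last pull of an arm \<open>j\<close> compared with the best one,
  monotonicity of \<open>f\<close> or nonnegativity of the gap controls the error. For the last pull
  of the best arm itself one has to prove that it is recent. No limit of the counts is computed: the
  unknown gaps drop out when two runs are compared.\<close>

text \<open>The padding makes all members of the family probability measures, as \<open>product_prob_space\<close> demands.\<close>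

lemma PiM_reward_table_cong:
  "reward_table \<nu> = (\<Pi>\<^sub>M (i, s) \<in> {..<length \<nu>} \<times> {1..}. if i < length \<nu> then \<nu> ! i else return borel 0)"
  unfolding reward_table_def by (intro PiM_cong) auto

lemma bandit_instance_real_distribution:
  "bandit_instance \<nu> \<Longrightarrow> i < length \<nu> \<Longrightarrow> real_distribution (\<nu> ! i)"
  by (auto simp: bandit_instance_def)

lemma product_prob_space_arms:
  assumes "bandit_instance \<nu>"
  shows "product_prob_space (\<lambda>(i, s::nat). if i < length \<nu> then \<nu> ! i else return borel 0)"
  using bandit_instance_real_distribution[OF assms]
  by (intro product_prob_spaceI) (auto simp: real_distribution_def intro!: prob_space_return)

lemma prob_space_reward_table:
  assumes "bandit_instance \<nu>"
  shows "prob_space (reward_table \<nu>)"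
proof -
  interpret product_prob_space "\<lambda>(i, s::nat). if i < length \<nu> then \<nu> ! i else return borel 0"
      "{..<length \<nu>} \<times> {1..}"
    by (rule product_prob_space_arms[OF assms])
  show ?thesis
    unfolding PiM_reward_table_cong by (rule P.prob_space_axioms)
qed

lemma measurable_reward_table_component:
  assumes "bandit_instance \<nu>" "i < length \<nu>" "s \<ge> 1"
  shows "(\<lambda>x. x (i, s)) \<in> borel_measurable (reward_table \<nu>)"
proof -
  have "(\<lambda>x. x (i, s)) \<in> reward_table \<nu> \<rightarrow>\<^sub>M (case (i, s) of (i, s) \<Rightarrow> \<nu> ! i)"
    unfolding reward_table_def using assms by (intro measurable_component_singleton) auto
  moreover have "sets (\<nu> ! i) = sets borel"
    using bandit_instance_real_distribution[OF assms(1,2)]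
    by (simp add: real_distribution_def real_distribution_axioms_def)
  ultimately show ?thesis
    by (simp cong: measurable_cong_sets)
qed

section \<open>Given the table, a history is determined by its arm sequence\<close>

definition table_history :: "(nat \<times> nat \<Rightarrow> real) \<Rightarrow> nat list \<Rightarrow> history" where
  "table_history x as =
     map (\<lambda>k. (as ! k, x (as ! k, Suc (count_list (take k as) (as ! k))))) [0..<length as]"

lemma table_history_Nil [simp]: "table_history x [] = []"
  by (simp add: table_history_def)

lemma table_history_snoc [simp]:
  "table_history x (as @ [a]) = table_history x as @ [(a, x (a, Suc (count_list as a)))]"
  by (auto simp: table_history_def nth_append)

lemma length_table_history [simp]: "length (table_history x as) = length as"
  by (simp add: table_history_def)

lemma map_fst_table_history [simp]: "map fst (table_history x as) = as"
  by (auto simp: table_history_def o_def intro: map_nth)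

lemma fst_set_table_history [simp]: "fst ` set (table_history x as) = set as"
  by (metis map_fst_table_history set_map)

lemma pulls_table_history [simp]: "pulls i (table_history x as) = count_list as i"
  by (simp add: pulls_def)

text \<open>This is the form in which \<open>decision_rules\<close> speaks about measurability: a
  fixed arm sequence zipped with a tuple of rewards.\<close>

lemma table_history_eq_zip:
  "table_history x as =
     zip as (map (\<lambda>k. x (as ! k, Suc (count_list (take k as) (as ! k)))) [0..<length as])"
  by (intro nth_equalityI) (auto simp: table_history_def)

primrec arms_given :: "policy \<Rightarrow> (nat \<times> nat \<Rightarrow> real) \<Rightarrow> nat \<Rightarrow> nat list pmf" where
  "arms_given \<pi> x 0 = return_pmf []"
| "arms_given \<pi> x (Suc t) =
     bind_pmf (arms_given \<pi> x t) (\<lambda>as. map_pmf (\<lambda>a. as @ [a]) (\<pi> (table_history x as)))"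

text \<open>Once the table is fixed, rewards carry no randomness of their own, so the process can be
  run on arm sequences. Under \<open>decision_rules\<close> only the finitely many sequences in
  \<open>arm_seqs\<close> occur, and integrals over the algorithm's randomness become finite
  sums.\<close>

lemma history_given_eq_arms_given:
  "history_given \<pi> x t = map_pmf (table_history x) (arms_given \<pi> x t)"
  by (induction t)
     (simp_all add: map_bind_pmf bind_map_pmf pmf.map_comp o_def)

lemma map_fst_history_given: "map_pmf (map fst) (history_given \<pi> x t) = arms_given \<pi> x t"
  by (simp add: history_given_eq_arms_given pmf.map_comp o_def)

lemma set_pmf_arms_given_length: "as \<in> set_pmf (arms_given \<pi> x t) \<Longrightarrow> length as = t"
  by (induction t arbitrary: as) auto

lemma set_pmf_arms_given_take:
  assumes "as \<in> set_pmf (arms_given \<pi> x T)" "t < T"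
  shows "as ! t \<in> set_pmf (\<pi> (table_history x (take t as)))"
  using assms
proof (induction T arbitrary: as)
  case (Suc T)
  then obtain bs a where as: "as = bs @ [a]" "bs \<in> set_pmf (arms_given \<pi> x T)"
    "a \<in> set_pmf (\<pi> (table_history x bs))"
    by auto
  have "length bs = T"
    using as(2) by (rule set_pmf_arms_given_length)
  then show ?case
    using as Suc by (cases "t = T") (auto simp: nth_append)
qed simp

text \<open>Chain rule. Appending an arm is injective, so only the prefix \<open>as\<close>
  contributes to the mixture.\<close>

lemma pmf_arms_given_Suc:
  "pmf (arms_given \<pi> x (Suc t)) (as @ [a]) = pmf (arms_given \<pi> x t) as * pmf (\<pi> (table_history x as)) a"
proof -
  have *: "pmf (map_pmf (\<lambda>a. bs @ [a]) p) (as @ [a]) = (if bs = as then pmf p a else 0)" for bs and p :: "nat pmf"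
  proof (cases "bs = as")
    case True
    then show ?thesis
      using pmf_map_inj'[of "\<lambda>a. as @ [a]" p a] by (simp add: inj_def)
  next
    case False
    then show ?thesis
      by (auto simp: pmf_eq_0_set_pmf)
  qed
  have "pmf (arms_given \<pi> x (Suc t)) (as @ [a]) =
      (\<integral>bs. (if bs = as then pmf (\<pi> (table_history x bs)) a else 0) \<partial>arms_given \<pi> x t)"
    by (simp add: pmf_bind *)
  also have "\<dots> = (\<Sum>bs\<in>{as}. (if bs = as then pmf (\<pi> (table_history x bs)) a else 0) * pmf (arms_given \<pi> x t) bs)"
    by (intro integral_measure_pmf_real) (auto split: if_splits)
  finally show ?thesis
    by simp
qed

definition arm_seqs :: "nat \<Rightarrow> nat \<Rightarrow> nat list set" where
  "arm_seqs K T = {as. set as \<subseteq> {..<K} \<and> length as = T}"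

lemma finite_arm_seqs [simp]: "finite (arm_seqs K T)"
  unfolding arm_seqs_def by (intro finite_lists_length_eq) auto

lemma set_pmf_arms_given:
  assumes "decision_rules alg" "K \<ge> 1" "t \<le> T"
  shows "set_pmf (arms_given (alg T K) x t) \<subseteq> arm_seqs K t"
  using assms(3)
proof (induction t)
  case (Suc t)
  have step: "set_pmf (alg T K (table_history x as)) \<subseteq> {..<K}" if "as \<in> arm_seqs K t" for as
    using assms(1)[unfolded decision_rules_def, rule_format, OF assms(2), THEN conjunct1, rule_format, of "table_history x as" T]
      that Suc.prems by (simp add: arm_seqs_def)
  show ?case
  proof
    fix bs assume "bs \<in> set_pmf (arms_given (alg T K) x (Suc t))"
    then obtain as a where "bs = as @ [a]" "as \<in> set_pmf (arms_given (alg T K) x t)"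
      "a \<in> set_pmf (alg T K (table_history x as))"
      by auto
    moreover from this(2) have "as \<in> arm_seqs K t"
      using Suc by (meson Suc_leD subsetD)
    ultimately show "bs \<in> arm_seqs K (Suc t)"
      using step[of as] by (auto simp: arm_seqs_def)
  qed
qed (simp add: arm_seqs_def)

text \<open>Induction along the chain rule. For a fixed arm sequence the policy reads finitely many
  fixed coordinates of the table, so each factor is a Borel function composed with a
  projection.\<close>

lemma measurable_pmf_arms_given:
  assumes "decision_rules alg" "bandit_instance \<nu>" "K = length \<nu>" "t \<le> T"
  shows "(\<lambda>x. pmf (arms_given (alg T K) x t) as) \<in> borel_measurable (reward_table \<nu>)"
  using assms(4)
proof (induction t arbitrary: as)
  case 0
  then show ?case by simp
next
  case (Suc t)
  have K: "K \<ge> 1"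
    using assms(2,3) by (cases \<nu>) (auto simp: bandit_instance_def)
  have supp: "pmf (arms_given (alg T K) x (Suc t)) as = 0" if "as \<notin> arm_seqs K (Suc t)" for x as
    using set_pmf_arms_given[OF assms(1) K Suc.prems] that by (auto simp: pmf_eq_0_set_pmf)
  show ?case
  proof (cases "as \<in> arm_seqs K (Suc t)")
    case False
    then show ?thesis
      using supp by simp
  next
    case True
    then obtain bs a where as: "as = bs @ [a]" "bs \<in> arm_seqs K t" "a < K"
      by (cases as rule: rev_cases) (simp_all add: arm_seqs_def)
    have len: "length bs = t" "set bs \<subseteq> {..<K}"
      using as(2) by (auto simp: arm_seqs_def)
    \<comment> \<open>The entries revealed along the fixed sequence \<open>bs\<close>, as a point of
      the product space used in \<open>decision_rules\<close>.\<close>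
    define R where "R = (\<lambda>x::nat \<times> nat \<Rightarrow> real. \<lambda>k\<in>{..<length bs}. x (bs ! k, Suc (count_list (take k bs) (bs ! k))))"
    have R: "R \<in> reward_table \<nu> \<rightarrow>\<^sub>M (\<Pi>\<^sub>M _ \<in> {..<length bs}. borel)"
      unfolding R_def
    proof (intro measurable_restrict)
      fix k assume "k \<in> {..<length bs}"
      then have "bs ! k < length \<nu>"
        using len assms(3) by (metis lessThan_iff nth_mem subset_iff)
      then show "(\<lambda>x. x (bs ! k, Suc (count_list (take k bs) (bs ! k)))) \<in> borel_measurable (reward_table \<nu>)"
        by (intro measurable_reward_table_component[OF assms(2)]) auto
    qed
    have hist: "table_history x bs = zip bs (map (R x) [0..<length bs])" for x
      unfolding table_history_eq_zip R_def by (intro arg_cong2[of _ _ _ _ zip] map_cong) auto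
    have "length bs < T \<and> set bs \<subseteq> {..<K}"
      using len Suc.prems by auto
    then have "(\<lambda>r. pmf (alg T K (zip bs (map r [0..<length bs]))) a) \<in> borel_measurable (\<Pi>\<^sub>M _ \<in> {..<length bs}. borel)"
      using assms(1)[unfolded decision_rules_def, rule_format, OF K, THEN conjunct2, rule_format, of bs T] by simp
    from measurable_compose[OF R this]
    have "(\<lambda>x. pmf (alg T K (table_history x bs)) a) \<in> borel_measurable (reward_table \<nu>)"
      unfolding hist .
    then show ?thesis
      unfolding as(1) pmf_arms_given_Suc using Suc by (intro borel_measurable_times) auto
  qed
qed

section \<open>Averaging over the reward table\<close>

definition cond_exp_arms :: "algorithm \<Rightarrow> nat \<Rightarrow> nat \<Rightarrow> (nat list \<Rightarrow> real) \<Rightarrow> (nat \<times> nat \<Rightarrow> real) \<Rightarrow> real" where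
  "cond_exp_arms alg T K \<phi> x = (\<Sum>as\<in>arm_seqs K T. pmf (arms_given (alg T K) x T) as * \<phi> as)"

context
  fixes alg :: algorithm and \<nu> :: inst and T :: nat
  assumes alg: "decision_rules alg" and \<nu>: "bandit_instance \<nu>"
begin

lemma length_ge_1: "length \<nu> \<ge> 1"
  using \<nu> by (cases \<nu>) (auto simp: bandit_instance_def)

lemma measurable_pmf_arms:
  "(\<lambda>x. pmf (arms_given (alg T (length \<nu>)) x T) as) \<in> borel_measurable (reward_table \<nu>)"
  by (rule measurable_pmf_arms_given[OF alg \<nu>]) auto

lemma measurable_cond_exp_arms:
  "cond_exp_arms alg T (length \<nu>) \<phi> \<in> borel_measurable (reward_table \<nu>)"
  unfolding cond_exp_arms_def
  by (intro borel_measurable_sum borel_measurable_times measurable_pmf_arms) auto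

lemma set_pmf_arms: "set_pmf (arms_given (alg T (length \<nu>)) x T) \<subseteq> arm_seqs (length \<nu>) T"
  by (rule set_pmf_arms_given[OF alg length_ge_1]) auto

lemma cond_exp_arms_eq_integral:
  "cond_exp_arms alg T (length \<nu>) \<phi> x = (\<integral>as. \<phi> as \<partial>arms_given (alg T (length \<nu>)) x T)"
  unfolding cond_exp_arms_def using set_pmf_arms
  by (subst integral_measure_pmf_real[where A = "arm_seqs (length \<nu>) T"]) (auto simp: mult.commute)

text \<open>The supports lie in one finite set independent of \<open>x\<close>, so every event
  reduces to a finite sum of point masses.\<close>

lemma measurable_arms_kernel:
  "(\<lambda>x. measure_pmf (arms_given (alg T (length \<nu>)) x T)) \<in> reward_table \<nu> \<rightarrow>\<^sub>M subprob_algebra (count_space UNIV)"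
proof (rule measurable_subprob_algebra)
  fix A :: "nat list set"
  have *: "emeasure (arms_given (alg T (length \<nu>)) x T) A =
      (\<Sum>as\<in>A \<inter> arm_seqs (length \<nu>) T. ennreal (pmf (arms_given (alg T (length \<nu>)) x T) as))" for x
  proof -
    have "emeasure (arms_given (alg T (length \<nu>)) x T) A =
        emeasure (arms_given (alg T (length \<nu>)) x T) (A \<inter> arm_seqs (length \<nu>) T)"
      using set_pmf_arms[of x] by (intro emeasure_eq_AE) (auto simp: AE_measure_pmf_iff)
    then show ?thesis
      by (simp add: emeasure_measure_pmf_finite)
  qed
  show "(\<lambda>x. emeasure (measure_pmf (arms_given (alg T (length \<nu>)) x T)) A) \<in> borel_measurable (reward_table \<nu>)"
    unfolding * by (intro borel_measurable_sum measurable_compose[OF measurable_pmf_arms measurable_ennreal])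
qed (auto simp: prob_space_imp_subprob_space prob_space_measure_pmf)

lemma arms_law_eq:
  "arms_law alg T \<nu> = reward_table \<nu> \<bind> (\<lambda>x. measure_pmf (arms_given (alg T (length \<nu>)) x T))"
  by (simp add: arms_law_def map_fst_history_given)

lemma space_reward_table_nonempty: "space (reward_table \<nu>) \<noteq> {}"
  using prob_space.not_empty[OF prob_space_reward_table[OF \<nu>]] .

lemma sets_arms_law: "sets (arms_law alg T \<nu>) = UNIV"
  unfolding arms_law_eq by (subst sets_bind[where N = "count_space UNIV"]) (auto simp: space_reward_table_nonempty)

lemma prob_space_arms_law: "prob_space (arms_law alg T \<nu>)"
proof -
  interpret prob_space "reward_table \<nu>"
    by (rule prob_space_reward_table[OF \<nu>])
  show ?thesis
    unfolding arms_law_eq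
    by (rule prob_space_bind[OF _ measurable_arms_kernel]) (auto simp: prob_space_measure_pmf)
qed

lemma integrable_cond_exp_arms [simp, intro]:
  "integrable (reward_table \<nu>) (cond_exp_arms alg T (length \<nu>) \<phi>)"
proof -
  interpret prob_space "reward_table \<nu>"
    by (rule prob_space_reward_table[OF \<nu>])
  show ?thesis
    unfolding cond_exp_arms_def
    by (intro Bochner_Integration.integrable_sum integrable_mult_left
          integrable_const_bound[where B = 1])
       (auto simp: pmf_le_1 measurable_pmf_arms)
qed

lemma AE_arms_law: "AE as in arms_law alg T \<nu>. as \<in> arm_seqs (length \<nu>) T"
  unfolding arms_law_eq using set_pmf_arms
  by (subst AE_bind[OF measurable_arms_kernel]) (auto simp: AE_measure_pmf_iff subset_iff)

lemma measure_arms_law: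
  "measure (arms_law alg T \<nu>) A = (\<integral>x. measure (arms_given (alg T (length \<nu>)) x T) A \<partial>reward_table \<nu>)"
proof -
  interpret prob_space "reward_table \<nu>"
    by (rule prob_space_reward_table[OF \<nu>])
  have "measure (arms_law alg T \<nu>) A = measure (reward_table \<nu> \<bind> (\<lambda>x. measure_pmf (arms_given (alg T (length \<nu>)) x T))) A"
    by (simp add: arms_law_eq)
  also have "\<dots> = (\<integral>x. measure (arms_given (alg T (length \<nu>)) x T) A \<partial>reward_table \<nu>)"
    by (rule measure_bind[OF measurable_arms_kernel]) auto
  finally show ?thesis .
qed

text \<open>Tower rule. On the finite set \<open>arm_seqs\<close> every function is a finite
  combination of indicators, which settles integrability together with the identity.\<close>

lemma integral_arms_law:
  "(\<integral>as. \<phi> as \<partial>arms_law alg T \<nu>) = (\<integral>x. cond_exp_arms alg T (length \<nu>) \<phi> x \<partial>reward_table \<nu>)"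
proof -
  interpret R: prob_space "reward_table \<nu>"
    by (rule prob_space_reward_table[OF \<nu>])
  interpret L: prob_space "arms_law alg T \<nu>"
    by (rule prob_space_arms_law)
  have meas: "f \<in> borel_measurable (arms_law alg T \<nu>)" for f :: "nat list \<Rightarrow> real"
    using sets_arms_law by (simp add: measurable_def)
  have "(\<integral>as. \<phi> as \<partial>arms_law alg T \<nu>) =
      (\<integral>as. (\<Sum>bs\<in>arm_seqs (length \<nu>) T. indicator {bs} as * \<phi> bs) \<partial>arms_law alg T \<nu>)"
    using AE_arms_law
    using AE_arms_law
    by (intro integral_cong_AE meas, elim eventually_mono) (auto simp: indicator_def if_distrib[of "\<lambda>x. x * _"] sum.delta cong: if_cong)
  also have "\<dots> = (\<Sum>bs\<in>arm_seqs (length \<nu>) T. (\<integral>as. indicator {bs} as * \<phi> bs \<partial>arms_law alg T \<nu>))"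
    by (intro Bochner_Integration.integral_sum integrable_mult_left L.integrable_const_bound[where B = 1] meas) auto
  also have "\<dots> = (\<Sum>bs\<in>arm_seqs (length \<nu>) T. measure (arms_law alg T \<nu>) {bs} * \<phi> bs)"
    using sets_arms_law L.emeasure_finite by (intro sum.cong) (auto simp: sets_eq_imp_space_eq[of _ "count_space UNIV"])
  also have "\<dots> = (\<Sum>bs\<in>arm_seqs (length \<nu>) T. \<integral>x. pmf (arms_given (alg T (length \<nu>)) x T) bs * \<phi> bs \<partial>reward_table \<nu>)"
    by (simp add: measure_arms_law pmf.rep_eq)
  also have "\<dots> = (\<integral>x. cond_exp_arms alg T (length \<nu>) \<phi> x \<partial>reward_table \<nu>)"
    unfolding cond_exp_arms_def
    by (intro Bochner_Integration.integral_sum[symmetric] integrable_mult_left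
          R.integrable_const_bound[where B = 1])
       (auto simp: pmf_le_1 measurable_pmf_arms)
  finally show ?thesis .
qed

lemma integrable_arms_law [simp, intro]:
  fixes \<phi> :: "nat list \<Rightarrow> real"
  shows "integrable (arms_law alg T \<nu>) \<phi>"
proof -
  interpret L: prob_space "arms_law alg T \<nu>"
    by (rule prob_space_arms_law)
  show ?thesis
  proof (rule L.integrable_const_bound[where B = "\<Sum>as\<in>arm_seqs (length \<nu>) T. \<bar>\<phi> as\<bar>"])
    show "AE as in arms_law alg T \<nu>. norm (\<phi> as) \<le> (\<Sum>as\<in>arm_seqs (length \<nu>) T. \<bar>\<phi> as\<bar>)"
      using AE_arms_law by eventually_elim (auto intro!: member_le_sum)
  qed (use sets_arms_law in \<open>simp add: measurable_def\<close>)
qed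

end

section \<open>Change of measure\<close>

text \<open>Both sides agree on rectangles, where the integral factorises. Finiteness of
  \<open>J\<close> is essential: infinite products of slightly different laws are typically mutually
  singular, which is why the table is cut down to finitely many entries below.\<close>

lemma PiM_density:
  fixes M :: "'i \<Rightarrow> 'a measure" and f :: "'i \<Rightarrow> 'a \<Rightarrow> real"
  assumes "finite J" and M: "\<And>j. prob_space (M j)" and N: "\<And>j. prob_space (density (M j) (\<lambda>x. ennreal (f j x)))"
    and f: "\<And>j. f j \<in> borel_measurable (M j)" "\<And>j x. f j x \<ge> 0"
  shows "PiM J (\<lambda>j. density (M j) (\<lambda>x. ennreal (f j x))) =
    density (PiM J M) (\<lambda>x. ennreal (\<Prod>j\<in>J. f j (x j)))"
proof -
  interpret M: product_prob_space M J
    by (rule product_prob_spaceI[OF M])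
  interpret N: product_prob_space "\<lambda>j. density (M j) (\<lambda>x. ennreal (f j x))" J
    by (rule product_prob_spaceI[OF N])
  have meas: "(\<lambda>x. \<Prod>j\<in>J. f j (x j)) \<in> borel_measurable (PiM J M)"
    using f(1) assms(1) by (intro borel_measurable_prod measurable_compose[OF measurable_component_singleton]) auto
  show ?thesis
  proof (rule N.PiM_eqI[symmetric])
    show "sets (density (PiM J M) (\<lambda>x. ennreal (\<Prod>j\<in>J. f j (x j)))) =
        sets (PiM J (\<lambda>j. density (M j) (\<lambda>x. ennreal (f j x))))"
      by (auto intro!: sets_PiM_cong)
    fix A assume "\<And>i. i \<in> J \<Longrightarrow> A i \<in> sets (density (M i) (\<lambda>x. ennreal (f i x)))"
    then have A: "A i \<in> sets (M i)" if "i \<in> J" for i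
      using that by auto
    have "emeasure (density (PiM J M) (\<lambda>x. ennreal (\<Prod>j\<in>J. f j (x j)))) (Pi\<^sub>E J A) =
        (\<integral>\<^sup>+x. ennreal (\<Prod>j\<in>J. f j (x j)) * indicator (Pi\<^sub>E J A) x \<partial>PiM J M)"
      using meas A assms(1) by (intro emeasure_density) (auto intro!: sets_PiM_I_finite)
    also have "\<dots> = (\<integral>\<^sup>+x. (\<Prod>j\<in>J. ennreal (f j (x j)) * indicator (A j) (x j)) \<partial>PiM J M)"
    proof (intro nn_integral_cong)
      fix x assume "x \<in> space (PiM J M)"
      then have x: "x \<in> extensional J"
        by (auto simp: space_PiM PiE_def)
      have "(\<Prod>j\<in>J. indicator (A j) (x j)) = (indicator (Pi\<^sub>E J A) x :: ennreal)"
        using x assms(1) by (auto simp: indicator_def PiE_def Pi_def)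
      then show "ennreal (\<Prod>j\<in>J. f j (x j)) * indicator (Pi\<^sub>E J A) x =
          (\<Prod>j\<in>J. ennreal (f j (x j)) * indicator (A j) (x j))"
        using f(2) by (simp add: prod.distrib prod_ennreal)
    qed
    also have "\<dots> = (\<Prod>j\<in>J. (\<integral>\<^sup>+x. ennreal (f j x) * indicator (A j) x \<partial>M j))"
      using f(1) A assms(1) by (intro M.product_nn_integral_prod) auto
    also have "\<dots> = (\<Prod>j\<in>J. emeasure (density (M j) (\<lambda>x. ennreal (f j x))) (A j))"
      using f(1) A by (intro prod.cong refl emeasure_density[symmetric]) auto
    finally show "emeasure (density (PiM J M) (\<lambda>x. ennreal (\<Prod>j\<in>J. f j (x j)))) (Pi\<^sub>E J A) =
        (\<Prod>j\<in>J. emeasure (density (M j) (\<lambda>x. ennreal (f j x))) (A j))" .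
  qed fact
qed

text \<open>With the likelihood ratio \<open>L\<close>, the difference of the means is the integral
  of \<open>(L - 1) * (G - c)\<close>; any centre \<open>c\<close> is allowed because
  \<open>L - 1\<close> integrates to 0. The bound 5/4 on the second moment of \<open>L\<close> says
  that \<open>L - 1\<close> has norm at most 1/2, the factor in \<open>V / 2\<close>. The bounds
  \<open>C\<close> and \<open>B\<close> serve integrability.\<close>

lemma integral_PiM_density_diff_le:
  fixes M :: "'i \<Rightarrow> 'a measure" and f :: "'i \<Rightarrow> 'a \<Rightarrow> real" and G :: "('i \<Rightarrow> 'a) \<Rightarrow> real"
  assumes "finite J" and M: "\<And>j. prob_space (M j)" and N: "\<And>j. prob_space (density (M j) (\<lambda>x. ennreal (f j x)))"
    and f: "\<And>j. f j \<in> borel_measurable (M j)" "\<And>j x. f j x \<ge> 0" "\<And>j x. f j x \<le> C j"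
    and chi: "(\<Prod>j\<in>J. \<integral>x. (f j x)\<^sup>2 \<partial>M j) \<le> 5 / 4"
    and G: "G \<in> borel_measurable (PiM J M)" "\<And>x. \<bar>G x\<bar> \<le> B"
    and V: "V > 0" "(\<integral>x. (G x - c)\<^sup>2 \<partial>PiM J M) \<le> V\<^sup>2"
  shows "\<bar>(\<integral>x. G x \<partial>PiM J (\<lambda>j. density (M j) (\<lambda>x. ennreal (f j x)))) - (\<integral>x. G x \<partial>PiM J M)\<bar> \<le> V / 2"
proof -
  interpret M: product_prob_space M J
    by (rule product_prob_spaceI[OF M])
  define L where "L x = (\<Prod>j\<in>J. f j (x j))" for x
  have measL [measurable]: "L \<in> borel_measurable (PiM J M)"
    unfolding L_def using f(1) assms(1)
    by (intro borel_measurable_prod measurable_compose[OF measurable_component_singleton]) auto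
  note G(1) [measurable]
  have L_nonneg: "L x \<ge> 0" for x
    unfolding L_def using f(2) by (intro prod_nonneg) auto
  have L_le: "L x \<le> (\<Prod>j\<in>J. C j)" for x
    unfolding L_def using f(2,3) by (intro prod_mono) auto
  have int_f: "integrable (M j) (f j)" for j
    using f by (intro M.M.integrable_const_bound[of _ "C j"]) auto
  have int_f2: "integrable (M j) (\<lambda>x. (f j x)\<^sup>2)" for j
    using f by (intro M.M.integrable_const_bound[of _ "(C j)\<^sup>2"]) (auto intro!: power_mono)
  have f_int: "(\<integral>x. f j x \<partial>M j) = 1" for j
  proof -
    have "emeasure (density (M j) (\<lambda>x. ennreal (f j x))) (space (M j)) = 1"
      using prob_space.emeasure_space_1[OF N[of j]] by simp
    then have "(\<integral>\<^sup>+x. ennreal (f j x) \<partial>M j) = 1"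
      using f(1)[of j] by (simp add: emeasure_density cong: nn_integral_cong)
    then show ?thesis
      using int_f f(2) by (simp add: nn_integral_eq_integral)
  qed
  have bounded: "integrable (PiM J M) h" if "h \<in> borel_measurable (PiM J M)" "\<And>x. \<bar>h x\<bar> \<le> D" for h :: "('i \<Rightarrow> 'a) \<Rightarrow> real" and D
    using that by (intro M.P.integrable_const_bound[of _ D]) auto
  have iL: "integrable (PiM J M) L"
    using L_nonneg L_le by (intro bounded[of _ "\<Prod>j\<in>J. C j"]) auto
  have iL2: "integrable (PiM J M) (\<lambda>x. (L x)\<^sup>2)"
    using L_nonneg L_le by (intro bounded[of _ "(\<Prod>j\<in>J. C j)\<^sup>2"]) (auto intro!: power_mono)
  have iLG: "integrable (PiM J M) (\<lambda>x. L x * G x)"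
    using L_nonneg L_le G(2) by (intro bounded[of _ "(\<Prod>j\<in>J. C j) * B"]) (auto simp: abs_mult intro!: mult_mono order_trans[OF L_nonneg L_le])
  have iG: "integrable (PiM J M) G"
    using G by (intro bounded)
  have iGc: "integrable (PiM J M) (\<lambda>x. (G x - c)\<^sup>2)"
  proof (rule bounded[of _ "(B + \<bar>c\<bar>)\<^sup>2"])
    show "\<bar>(G x - c)\<^sup>2\<bar> \<le> (B + \<bar>c\<bar>)\<^sup>2" for x
      using G(2)[of x] by (simp add: abs_le_square_iff[symmetric])
  qed measurable
  have EL: "(\<integral>x. L x \<partial>PiM J M) = 1"
    unfolding L_def using assms(1) int_f f_int by (subst M.product_integral_prod) auto
  have EL2: "(\<integral>x. (L x)\<^sup>2 \<partial>PiM J M) \<le> 5 / 4"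
    unfolding L_def prod_power_distrib using assms(1) int_f2 chi
    by (subst M.product_integral_prod) auto
  have "(\<integral>x. (L x - 1)\<^sup>2 \<partial>PiM J M) = (\<integral>x. (L x)\<^sup>2 - 2 * L x + 1 \<partial>PiM J M)"
    by (simp add: power2_eq_square algebra_simps)
  also have "\<dots> = (\<integral>x. (L x)\<^sup>2 \<partial>PiM J M) - 1"
    using iL iL2 EL by (simp add: M.P.prob_space)
  finally have EL1: "(\<integral>x. (L x - 1)\<^sup>2 \<partial>PiM J M) \<le> 1 / 4"
    using EL2 by simp
  have iL1: "integrable (PiM J M) (\<lambda>x. (L x - 1)\<^sup>2)"
    using iL iL2 by (simp add: power2_eq_square algebra_simps)
  have "(\<integral>x. G x \<partial>PiM J (\<lambda>j. density (M j) (\<lambda>x. ennreal (f j x)))) = (\<integral>x. L x * G x \<partial>PiM J M)"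
    using L_nonneg unfolding PiM_density[OF assms(1) M N f(1,2)] L_def[symmetric]
    by (subst integral_density) auto
  moreover have "(\<integral>x. L x * G x \<partial>PiM J M) - (\<integral>x. G x \<partial>PiM J M) = (\<integral>x. (L x - 1) * (G x - c) \<partial>PiM J M)"
    using iL iG iLG EL by (simp add: algebra_simps M.P.prob_space)
  moreover have "\<bar>\<integral>x. (L x - 1) * (G x - c) \<partial>PiM J M\<bar> \<le> V / 2"
  proof -
    have "\<bar>\<integral>x. (L x - 1) * (G x - c) \<partial>PiM J M\<bar> \<le> (\<integral>x. \<bar>(L x - 1) * (G x - c)\<bar> \<partial>PiM J M)"
      by (rule integral_abs_bound)
    \<comment> \<open>The weighted arithmetic-geometric mean inequality stands in for
      Cauchy--Schwarz; with weight \<open>V\<close> each of the two terms integrates to at most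
      \<open>V / 4\<close>.\<close>
    also have "\<dots> \<le> (\<integral>x. V * (L x - 1)\<^sup>2 + (G x - c)\<^sup>2 / (4 * V) \<partial>PiM J M)"
    proof (intro integral_mono)
      show "integrable (PiM J M) (\<lambda>x. \<bar>(L x - 1) * (G x - c)\<bar>)"
        using iL iG iLG by (intro integrable_abs) (auto simp: algebra_simps)
      show "integrable (PiM J M) (\<lambda>x. V * (L x - 1)\<^sup>2 + (G x - c)\<^sup>2 / (4 * V))"
        using iL1 iGc by auto
      show "\<bar>(L x - 1) * (G x - c)\<bar> \<le> V * (L x - 1)\<^sup>2 + (G x - c)\<^sup>2 / (4 * V)" for x
      proof -
        have "0 \<le> (2 * V * \<bar>L x - 1\<bar> - \<bar>G x - c\<bar>)\<^sup>2"
          by simp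
        then have "4 * V * (\<bar>L x - 1\<bar> * \<bar>G x - c\<bar>) \<le> 4 * V * V * (L x - 1)\<^sup>2 + (G x - c)\<^sup>2"
          by (simp add: power2_diff power_mult_distrib power2_eq_square[of V] algebra_simps)
        then show ?thesis
          unfolding abs_mult using V(1) by (simp add: divide_simps mult_ac power2_eq_square)
      qed
    qed
    also have "\<dots> = V * (\<integral>x. (L x - 1)\<^sup>2 \<partial>PiM J M) + (\<integral>x. (G x - c)\<^sup>2 \<partial>PiM J M) / (4 * V)"
      using iL1 iGc by simp
    also have "\<dots> \<le> V * (1 / 4) + V\<^sup>2 / (4 * V)"
      using EL1 V by (intro add_mono mult_left_mono divide_right_mono) auto
    also have "\<dots> = V / 2"
      using V(1) by (simp add: power2_eq_square)
    finally show ?thesis .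
  qed
  ultimately show ?thesis
    by simp
qed

subsection \<open>Two-point rewards\<close>

text \<open>The values stay at \<open>s\<close> and \<open>- s\<close> while \<open>p\<close> moves
  the mean to \<open>s * p\<close>, so all laws with \<open>-1 < p < 1\<close> and
  \<open>s > 0\<close> share their support and have densities with respect to each other.\<close>

definition two_point :: "real \<Rightarrow> real \<Rightarrow> real measure" where
  "two_point s p = distr (measure_pmf (bernoulli_pmf ((1 + p) / 2))) borel (\<lambda>b. if b then s else - s)"

lemma real_distribution_two_point: "real_distribution (two_point s p)"
  unfolding two_point_def real_distribution_def real_distribution_axioms_def
  by (auto intro!: prob_space.prob_space_distr prob_space_measure_pmf)

lemma integrable_two_point:
  fixes f :: "real \<Rightarrow> real"
  assumes "f \<in> borel_measurable borel"
  shows "integrable (two_point s p) f"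
  unfolding two_point_def using assms
  by (subst integrable_distr_eq) (auto intro: integrable_measure_pmf_finite)

lemma integral_two_point:
  fixes f :: "real \<Rightarrow> real"
  assumes "f \<in> borel_measurable borel" "-1 \<le> p" "p \<le> 1"
  shows "(\<integral>x. f x \<partial>two_point s p) = (1 + p) / 2 * f s + (1 - p) / 2 * f (- s)"
  unfolding two_point_def using assms
  by (subst integral_distr) (auto simp: field_simps)

lemma mean_two_point: "-1 \<le> p \<Longrightarrow> p \<le> 1 \<Longrightarrow> mean (two_point s p) = s * p"
  unfolding mean_def by (subst integral_two_point) (auto simp: field_simps)

text \<open>Hoeffding's lemma on an interval of length \<open>2 * s\<close> settles
  \<open>l > 0\<close>; negative \<open>l\<close> follows by reflection, which turns
  \<open>p\<close> into \<open>- p\<close>.\<close>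

lemma sub_gaussian_two_point:
  assumes p: "-1 \<le> p" "p \<le> 1" and s: "0 \<le> s" "s \<le> \<sigma>"
  shows "sub_gaussian \<sigma> (two_point s p)"
  unfolding sub_gaussian_def
proof (intro allI conjI)
  fix l :: real
  show "integrable (two_point s p) (\<lambda>x. exp (l * (x - mean (two_point s p))))"
    by (rule integrable_two_point) measurable
  have pos: "(\<integral>x. exp (l * (x - s * p)) \<partial>two_point s p) \<le> exp (l\<^sup>2 * s\<^sup>2 / 2)"
    if "l > 0" "-1 \<le> p" "p \<le> 1" for l p :: real
  proof -
    interpret interval_bounded_random_variable "measure_pmf (bernoulli_pmf ((1 + p) / 2))" "\<lambda>b. if b then s else - s" "-s" s
      using s(1) by unfold_locales auto
    have E: "measure_pmf.expectation (bernoulli_pmf ((1 + p) / 2)) (\<lambda>b. if b then s else - s) = s * p"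
      using that by (subst integral_bernoulli_pmf) (auto simp: field_simps)
    have "(\<integral>x. exp (l * (x - s * p)) \<partial>two_point s p) =
        measure_pmf.expectation (bernoulli_pmf ((1 + p) / 2)) (\<lambda>b. exp (l * ((if b then s else - s) - s * p)))"
      unfolding two_point_def by (subst integral_distr) auto
    also have "\<dots> \<le> exp (l\<^sup>2 * s\<^sup>2 / 2)"
    proof -
      have "l\<^sup>2 * (s - - s)\<^sup>2 / 8 = l\<^sup>2 * s\<^sup>2 / 2"
        by (simp add: power2_eq_square)
      then show ?thesis
        using Hoeffdings_lemma_nn_integral[OF that(1)] unfolding E
        by (subst (asm) nn_integral_eq_integral) (auto intro!: integrable_measure_pmf_finite)
    qed
    finally show ?thesis .
  qed
  have "(\<integral>x. exp (l * (x - s * p)) \<partial>two_point s p) \<le> exp (l\<^sup>2 * s\<^sup>2 / 2)"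
  proof (cases l "0 :: real" rule: linorder_cases)
    case greater
    then show ?thesis
      using pos p by simp
  next
    case equal
    then show ?thesis
      using prob_space.prob_space[of "two_point s p"] real_distribution_two_point
      by (simp add: real_distribution_def)
  next
    case less
    have "(\<integral>x. exp (l * (x - s * p)) \<partial>two_point s p) = (\<integral>x. exp (- l * (x - s * - p)) \<partial>two_point s (- p))"
      using p by (simp add: integral_two_point field_simps)
    also have "\<dots> \<le> exp ((- l)\<^sup>2 * s\<^sup>2 / 2)"
      using less p by (intro pos) auto
    finally show ?thesis
      by simp
  qed
  also have "exp (l\<^sup>2 * s\<^sup>2 / 2) \<le> exp (l\<^sup>2 * \<sigma>\<^sup>2 / 2)"
    using s by (auto intro!: mult_left_mono power_mono)
  finally show "(\<integral>x. exp (l * (x - mean (two_point s p))) \<partial>two_point s p) \<le> exp (l\<^sup>2 * \<sigma>\<^sup>2 / 2)"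
    using p by (simp add: mean_two_point)
qed

definition two_point_ratio :: "real \<Rightarrow> real \<Rightarrow> real \<Rightarrow> real \<Rightarrow> real" where
  "two_point_ratio s p q x = (if x = s then (1 + q) / (1 + p) else (1 - q) / (1 - p))"

lemma measurable_two_point_ratio [measurable]: "two_point_ratio s p q \<in> borel_measurable borel"
  unfolding two_point_ratio_def by measurable

lemma density_two_point:
  assumes "s > 0" "-1 < p" "p < 1" "-1 \<le> q" "q \<le> 1"
  shows "density (two_point s p) (\<lambda>x. ennreal (two_point_ratio s p q x)) = two_point s q"
proof (rule measure_eqI)
  fix A assume "A \<in> sets (density (two_point s p) (\<lambda>x. ennreal (two_point_ratio s p q x)))"
  then have A [measurable]: "A \<in> sets borel"
    by (simp add: two_point_def)
  have "emeasure (density (two_point s p) (\<lambda>x. ennreal (two_point_ratio s p q x))) A =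
      (\<integral>\<^sup>+x. ennreal (two_point_ratio s p q x) * indicator A x \<partial>two_point s p)"
    by (intro emeasure_density) (auto simp: two_point_def)
  also have "\<dots> = ennreal ((1 + q) / (1 + p)) * indicator A s * ennreal ((1 + p) / 2) +
      ennreal ((1 - q) / (1 - p)) * indicator A (- s) * ennreal ((1 - p) / 2)"
    unfolding two_point_def using assms
    by (subst nn_integral_distr) (auto simp: two_point_ratio_def nn_integral_measure_pmf_support[of UNIV] UNIV_bool field_simps)
  also have "\<dots> = ennreal ((1 + q) / 2) * indicator A s + ennreal ((1 - q) / 2) * indicator A (- s)"
  proof -
    have "(1 + q) / (1 + p) * ((1 + p) / 2) = (1 + q) / 2" "(1 - q) / (1 - p) * ((1 - p) / 2) = (1 - q) / 2"
      using assms by auto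
    then have "ennreal ((1 + q) / (1 + p)) * ennreal ((1 + p) / 2) = ennreal ((1 + q) / 2)"
      "ennreal ((1 - q) / (1 - p)) * ennreal ((1 - p) / 2) = ennreal ((1 - q) / 2)"
      using assms by (simp_all add: ennreal_mult[symmetric])
    then show ?thesis
      by (auto simp: indicator_def)
  qed
  also have "\<dots> = (\<integral>\<^sup>+x. indicator A x \<partial>two_point s q)"
    unfolding two_point_def using assms
    by (subst nn_integral_distr) (auto simp: nn_integral_measure_pmf_support[of UNIV] UNIV_bool field_simps)
  also have "\<dots> = emeasure (two_point s q) A"
    by (simp add: two_point_def)
  finally show "emeasure (density (two_point s p) (\<lambda>x. ennreal (two_point_ratio s p q x))) A =
      emeasure (two_point s q) A" .
qed (simp add: two_point_def)

text \<open>The value is one plus the chi-square divergence of the two laws. This quantity is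
  multiplicative over independent entries.\<close>

lemma integral_two_point_ratio_square:
  assumes "s > 0" "-1 < p" "p < 1" "-1 \<le> q" "q \<le> 1"
  shows "(\<integral>x. (two_point_ratio s p q x)\<^sup>2 \<partial>two_point s p) = 1 + (q - p)\<^sup>2 / (1 - p\<^sup>2)"
proof -
  have "1 - p\<^sup>2 = (1 + p) * (1 - p)" "1 + p > 0" "1 - p > 0"
    using assms by (auto simp: power2_eq_square algebra_simps)
  then show ?thesis
    using assms by (subst integral_two_point)
      (auto simp: two_point_ratio_def divide_simps, auto simp: power2_eq_square algebra_simps)
qed

subsection \<open>Reduction to finitely many table entries\<close>

lemma table_history_cong:
  assumes "set as \<subseteq> {..<K}" "length as \<le> T"
    and "\<And>i u. i < K \<Longrightarrow> 1 \<le> u \<Longrightarrow> u \<le> T \<Longrightarrow> x (i, u) = y (i, u)"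
  shows "table_history x as = table_history y as"
  unfolding table_history_def
proof (intro map_cong refl)
  fix k assume k: "k \<in> set [0..<length as]"
  have "count_list (take k as) (as ! k) \<le> length (take k as)"
    by (rule count_le_length)
  moreover have "as ! k < K"
    using k assms(1) nth_mem[of k as] by (auto simp del: nth_mem)
  ultimately show "(as ! k, x (as ! k, Suc (count_list (take k as) (as ! k)))) =
      (as ! k, y (as ! k, Suc (count_list (take k as) (as ! k))))"
    using k assms(2) by (auto intro!: assms(3))
qed

lemma arms_given_cong:
  assumes "decision_rules alg" "K \<ge> 1" "t \<le> T"
    and eq: "\<And>i u. i < K \<Longrightarrow> 1 \<le> u \<Longrightarrow> u \<le> T \<Longrightarrow> x (i, u) = y (i, u)"
  shows "arms_given (alg T K) x t = arms_given (alg T K) y t"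
  using assms(3)
proof (induction t)
  case (Suc t)
  have IH: "arms_given (alg T K) x t = arms_given (alg T K) y t"
    using Suc by simp
  have "map_pmf (\<lambda>a. as @ [a]) (alg T K (table_history x as)) =
      map_pmf (\<lambda>a. as @ [a]) (alg T K (table_history y as))"
    if "as \<in> set_pmf (arms_given (alg T K) y t)" for as
  proof -
    have "as \<in> arm_seqs K t"
      using set_pmf_arms_given[OF assms(1,2), of t T y] Suc.prems that by auto
    then have "table_history x as = table_history y as"
      using Suc.prems eq by (intro table_history_cong[of _ K T]) (auto simp: arm_seqs_def)
    then show ?thesis
      by simp
  qed
  then show ?case
    unfolding arms_given.simps IH by (intro bind_pmf_cong refl)
qed simp

lemma cond_exp_arms_cong:
  assumes "decision_rules alg" "K \<ge> 1"
    and "\<And>i u. i < K \<Longrightarrow> 1 \<le> u \<Longrightarrow> u \<le> T \<Longrightarrow> x (i, u) = y (i, u)"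
  shows "cond_exp_arms alg T K \<phi> x = cond_exp_arms alg T K \<phi> y"
  unfolding cond_exp_arms_def using arms_given_cong[OF assms(1,2) order_refl, of T x y] assms(3) by simp

definition table_law :: "inst \<Rightarrow> nat \<times> nat \<Rightarrow> real measure" where
  "table_law \<nu> = (\<lambda>(i, s). if i < length \<nu> then \<nu> ! i else return borel 0)"

text \<open>Only the first \<open>T\<close> entries of each row can be read within \<open>T\<close>
  rounds. Measurability descends to the finite product because \<open>G\<close> is unchanged by the
  measurable extension \<open>ext\<close>, which fills all other entries with 0.\<close>

lemma integral_reward_table_restrict:
  fixes G :: "(nat \<times> nat \<Rightarrow> real) \<Rightarrow> real"
  assumes \<nu>: "bandit_instance \<nu>" and G: "G \<in> borel_measurable (reward_table \<nu>)"
    and cong: "\<And>x y. (\<And>i u. i < length \<nu> \<Longrightarrow> 1 \<le> u \<Longrightarrow> u \<le> T \<Longrightarrow> x (i, u) = y (i, u)) \<Longrightarrow> G x = G y"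
  defines "J \<equiv> {..<length \<nu>} \<times> {1..T}"
  shows "G \<in> borel_measurable (PiM J (table_law \<nu>))" (is ?meas)
    and "(\<integral>x. G x \<partial>reward_table \<nu>) = (\<integral>x. G x \<partial>PiM J (table_law \<nu>))"
proof -
  define I :: "(nat \<times> nat) set" where "I = {..<length \<nu>} \<times> {1..}"
  have table: "reward_table \<nu> = PiM I (table_law \<nu>)"
    unfolding I_def table_law_def by (rule PiM_reward_table_cong)
  interpret product_prob_space "table_law \<nu>" I
    unfolding table_law_def by (rule product_prob_space_arms[OF \<nu>])
  have sets: "sets (table_law \<nu> j) = sets borel" for j
    using bandit_instance_real_distribution[OF \<nu>, of "fst j"]
    by (auto simp: table_law_def real_distribution_def real_distribution_axioms_def split: prod.splits)
  define ext where "ext x = (\<lambda>j\<in>I. if j \<in> J then x j else 0)" for x :: "nat \<times> nat \<Rightarrow> real"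
  have ext: "ext \<in> PiM J (table_law \<nu>) \<rightarrow>\<^sub>M PiM I (table_law \<nu>)"
    unfolding ext_def
  proof (intro measurable_restrict)
    fix j assume "j \<in> I"
    show "(\<lambda>x. if j \<in> J then x j else 0) \<in> PiM J (table_law \<nu>) \<rightarrow>\<^sub>M table_law \<nu> j"
      using sets_eq_imp_space_eq[OF sets[of j]]
      by (cases "j \<in> J") (auto intro: measurable_component_singleton)
  qed
  have "G (ext x) = G x" for x
    by (rule cong) (auto simp: ext_def I_def J_def)
  then show meas: ?meas
    using measurable_compose[OF ext G[unfolded table]] by simp
  have "(\<integral>x. G x \<partial>PiM J (table_law \<nu>)) = (\<integral>x. G x \<partial>distr (PiM I (table_law \<nu>)) (PiM J (table_law \<nu>)) (\<lambda>x. restrict x J))"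
    by (subst distr_PiM_restrict_finite) (auto simp: I_def J_def)
  also have "\<dots> = (\<integral>x. G (restrict x J) \<partial>PiM I (table_law \<nu>))"
    using meas by (intro integral_distr) (auto simp: I_def J_def intro!: measurable_restrict_subset)
  also have "\<dots> = (\<integral>x. G x \<partial>PiM I (table_law \<nu>))"
    by (intro Bochner_Integration.integral_cong refl cong) (auto simp: J_def)
  finally show "(\<integral>x. G x \<partial>reward_table \<nu>) = (\<integral>x. G x \<partial>PiM J (table_law \<nu>))"
    by (simp add: table)
qed

subsection \<open>Moments of the pull counts\<close>

lemma exp_pulls_eq:
  assumes "decision_rules alg" "bandit_instance \<nu>"
  shows "exp_pulls alg T \<nu> i =
    (\<integral>x. cond_exp_arms alg T (length \<nu>) (\<lambda>as. real (count_list as i)) x \<partial>reward_table \<nu>)"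
  unfolding exp_pulls_def by (rule integral_arms_law[OF assms])

lemma exp_pulls_nonneg: "exp_pulls alg T \<nu> i \<ge> 0"
  unfolding exp_pulls_def by (rule Bochner_Integration.integral_nonneg) simp

lemma var_pulls_nonneg: "var_pulls alg T \<nu> i \<ge> 0"
  unfolding var_pulls_def by (rule Bochner_Integration.integral_nonneg) simp

lemma sum_exp_pulls:
  assumes "decision_rules alg" "bandit_instance \<nu>"
  shows "(\<Sum>i<length \<nu>. exp_pulls alg T \<nu> i) = T"
proof -
  interpret L: prob_space "arms_law alg T \<nu>"
    by (rule prob_space_arms_law[OF assms])
  have "(\<Sum>i<length \<nu>. exp_pulls alg T \<nu> i) = (\<integral>as. (\<Sum>i<length \<nu>. real (count_list as i)) \<partial>arms_law alg T \<nu>)"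
    unfolding exp_pulls_def
    by (rule Bochner_Integration.integral_sum[symmetric]) (rule integrable_arms_law[OF assms])
  also have "\<dots> = (\<integral>as. real T \<partial>arms_law alg T \<nu>)"
  proof (rule integral_cong_AE)
    show "AE as in arms_law alg T \<nu>. (\<Sum>i<length \<nu>. real (count_list as i)) = real T"
      using AE_arms_law[OF assms]
    proof eventually_elim
      case (elim as)
      then have "(\<Sum>i<length \<nu>. count_list as i) = T"
        using sum_count_set[of as "{..<length \<nu>}"] by (simp add: arm_seqs_def)
      then show ?case
        by (metis of_nat_sum)
    qed
  qed (use borel_measurable_integrable[OF integrable_arms_law[OF assms]] in auto)
  finally show ?thesis
    by (simp add: L.prob_space)
qed

text \<open>The mean is the best centre in mean square, so a variance may be estimated around any
  convenient number.\<close>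

lemma var_pulls_le:
  assumes "decision_rules alg" "bandit_instance \<nu>"
  shows "var_pulls alg T \<nu> i \<le> (\<integral>as. (real (count_list as i) - c)\<^sup>2 \<partial>arms_law alg T \<nu>)"
proof -
  interpret L: prob_space "arms_law alg T \<nu>"
    by (rule prob_space_arms_law[OF assms])
  note [simp] = integrable_arms_law[OF assms]
  let ?X = "\<lambda>as. real (count_list as i)"
  have "(\<integral>as. (?X as - c)\<^sup>2 \<partial>arms_law alg T \<nu>) =
      (\<integral>as. (?X as)\<^sup>2 - 2 * c * ?X as + c\<^sup>2 \<partial>arms_law alg T \<nu>)"
    by (simp add: power2_diff algebra_simps)
  also have "\<dots> = (\<integral>as. (?X as)\<^sup>2 \<partial>arms_law alg T \<nu>) - 2 * c * exp_pulls alg T \<nu> i + c\<^sup>2"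
    by (simp add: L.prob_space exp_pulls_def)
  also have "(\<integral>as. (?X as)\<^sup>2 \<partial>arms_law alg T \<nu>) = var_pulls alg T \<nu> i + (exp_pulls alg T \<nu> i)\<^sup>2"
    unfolding var_pulls_def exp_pulls_def by (subst L.variance_eq) simp_all
  finally have "(\<integral>as. (?X as - c)\<^sup>2 \<partial>arms_law alg T \<nu>) = var_pulls alg T \<nu> i + (exp_pulls alg T \<nu> i - c)\<^sup>2"
    by (simp add: power2_diff algebra_simps)
  then show ?thesis
    by simp
qed

text \<open>Counts lie between 0 and \<open>T\<close>, hence within \<open>T / 2\<close> of the
  centre of this range.\<close>

lemma var_pulls_le_square:
  assumes "decision_rules alg" "bandit_instance \<nu>"
  shows "var_pulls alg T \<nu> i \<le> (real T / 2)\<^sup>2"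
proof -
  interpret L: prob_space "arms_law alg T \<nu>"
    by (rule prob_space_arms_law[OF assms])
  have "var_pulls alg T \<nu> i \<le> (\<integral>as. (real (count_list as i) - real T / 2)\<^sup>2 \<partial>arms_law alg T \<nu>)"
    by (rule var_pulls_le[OF assms])
  also have "\<dots> \<le> (\<integral>as. (real T / 2)\<^sup>2 \<partial>arms_law alg T \<nu>)"
  proof (rule integral_mono_AE)
    show "AE as in arms_law alg T \<nu>. (real (count_list as i) - real T / 2)\<^sup>2 \<le> (real T / 2)\<^sup>2"
      using AE_arms_law[OF assms]
    proof eventually_elim
      case (elim as)
      then have "real (count_list as i) \<le> real T"
        using count_le_length[of as i] by (simp add: arm_seqs_def)
      then show ?case
        by (intro abs_le_square_iff[THEN iffD1]) (simp add: abs_le_iff field_simps)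
    qed
  qed (rule integrable_arms_law[OF assms])+
  finally show ?thesis
    by (simp add: L.prob_space)
qed

text \<open>Jensen's inequality for the internal randomness of the algorithm. It lets the change of
  measure deal with functions of the table alone.\<close>

lemma cond_exp_arms_square_le:
  assumes "decision_rules alg" "bandit_instance \<nu>"
  shows "(cond_exp_arms alg T (length \<nu>) \<phi> x - c)\<^sup>2 \<le> cond_exp_arms alg T (length \<nu>) (\<lambda>as. (\<phi> as - c)\<^sup>2) x"
proof -
  let ?p = "arms_given (alg T (length \<nu>)) x T"
  have fin: "finite (set_pmf ?p)"
    using set_pmf_arms[OF assms] by (rule finite_subset) simp
  note [simp] = integrable_measure_pmf_finite[OF fin]
  have "measure_pmf.variance ?p (\<lambda>as. \<phi> as - c) =
      measure_pmf.expectation ?p (\<lambda>as. (\<phi> as - c)\<^sup>2) - (measure_pmf.expectation ?p (\<lambda>as. \<phi> as - c))\<^sup>2"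
    by (rule measure_pmf.variance_eq) simp_all
  moreover have "0 \<le> measure_pmf.variance ?p (\<lambda>as. \<phi> as - c)"
    by (rule measure_pmf.variance_positive)
  ultimately have "(measure_pmf.expectation ?p (\<lambda>as. \<phi> as - c))\<^sup>2 \<le> measure_pmf.expectation ?p (\<lambda>as. (\<phi> as - c)\<^sup>2)"
    by linarith
  then show ?thesis
    by (simp add: cond_exp_arms_eq_integral[OF assms])
qed

subsection \<open>Perturbing one arm\<close>

definition two_point_inst :: "real \<Rightarrow> real \<Rightarrow> inst" where
  "two_point_inst s p = [two_point s 0, two_point s p]"

lemma length_two_point_inst [simp]: "length (two_point_inst s p) = 2"
  by (simp add: two_point_inst_def)

lemma bandit_instance_two_point: "bandit_instance (two_point_inst s p)"
  by (auto simp: bandit_instance_def two_point_inst_def real_distribution_two_point integrable_two_point)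

text \<open>Arm 1 is perturbed while the count of arm 0 is tracked. Exactly the \<open>T\<close>
  relevant entries of row 1 change their law, whence the power \<open>T\<close> in
  \<open>chi\<close>.\<close>

lemma exp_pulls_perturbation:
  assumes alg: "decision_rules alg" and s: "s > 0" and p: "0 \<le> p" "p < 1" and q: "0 \<le> q" "q \<le> 1"
    and chi: "(1 + (q - p)\<^sup>2 / (1 - p\<^sup>2)) ^ T \<le> 5 / 4"
    and V: "V > 0" "var_pulls alg T (two_point_inst s p) 0 \<le> V\<^sup>2"
  shows "\<bar>exp_pulls alg T (two_point_inst s q) 0 - exp_pulls alg T (two_point_inst s p) 0\<bar> \<le> V / 2"
proof -
  define J :: "(nat \<times> nat) set" where "J = {..<2} \<times> {1..T}"
  define c where "c = exp_pulls alg T (two_point_inst s p) 0"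
  let ?\<phi> = "\<lambda>as. real (count_list as 0)"
  let ?G = "cond_exp_arms alg T 2 ?\<phi>"
  define f where "f = (\<lambda>(i, u::nat). if i = (1::nat) then two_point_ratio s p q else (\<lambda>_. 1))"
  define M where "M = table_law (two_point_inst s p)"
  have law_eq: "table_law (two_point_inst s r) (i, u) =
      (if i = 0 then two_point s 0 else if i = 1 then two_point s r else return borel 0)" for r i u
    by (simp add: table_law_def two_point_inst_def less_2_cases_iff)
  have M'_eq: "table_law (two_point_inst s q) = (\<lambda>j. density (M j) (\<lambda>x. ennreal (f j x)))"
  proof
    fix j :: "nat \<times> nat"
    have "density (two_point s p) (\<lambda>x. ennreal (two_point_ratio s p q x)) = two_point s q"
      using s p q by (intro density_two_point) auto
    then show "table_law (two_point_inst s q) j = density (M j) (\<lambda>x. ennreal (f j x))"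
      by (cases j; cases "fst j = 1"; cases "fst j = 0") (simp_all add: f_def M_def law_eq density_1)
  qed
  have prob: "prob_space (table_law (two_point_inst s r) j)" for r j
    using real_distribution_two_point[of s] unfolding real_distribution_def
    by (cases j) (simp add: law_eq prob_space_return)
  have measG: "?G \<in> borel_measurable (reward_table (two_point_inst s r))" for r
    using measurable_cond_exp_arms[OF alg bandit_instance_two_point[of s r]] by simp
  have J_eq: "J = {..<length (two_point_inst s r)} \<times> {1..T}" for r
    by (simp add: J_def)
  have restr: "(\<lambda>x. h (?G x)) \<in> borel_measurable (PiM J (table_law (two_point_inst s r)))"
      "(\<integral>x. h (?G x) \<partial>reward_table (two_point_inst s r)) = (\<integral>x. h (?G x) \<partial>PiM J (table_law (two_point_inst s r)))"
    if "h \<in> borel_measurable borel" for h :: "real \<Rightarrow> real" and r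
  proof -
    have cong: "h (?G x) = h (?G y)"
      if "\<And>i u. i < length (two_point_inst s r) \<Longrightarrow> 1 \<le> u \<Longrightarrow> u \<le> T \<Longrightarrow> x (i, u) = y (i, u)" for x y
    proof -
      have "?G x = ?G y"
        by (rule cond_exp_arms_cong[OF alg]) (use that in auto)
      then show ?thesis
        by simp
    qed
    have "(\<lambda>x. h (?G x)) \<in> borel_measurable (reward_table (two_point_inst s r))"
      using measurable_compose[OF measG that] .
    note * = bandit_instance_two_point[of s r] this cong
    show "(\<lambda>x. h (?G x)) \<in> borel_measurable (PiM J (table_law (two_point_inst s r)))"
      unfolding J_eq[of r] by (rule integral_reward_table_restrict(1)[OF *])
    show "(\<integral>x. h (?G x) \<partial>reward_table (two_point_inst s r)) = (\<integral>x. h (?G x) \<partial>PiM J (table_law (two_point_inst s r)))"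
      unfolding J_eq[of r] by (rule integral_reward_table_restrict(2)[OF *])
  qed
  have E: "exp_pulls alg T (two_point_inst s r) 0 = (\<integral>x. ?G x \<partial>PiM J (table_law (two_point_inst s r)))" for r
    using restr(2)[of "\<lambda>z. z" r] by (simp add: exp_pulls_eq[OF alg bandit_instance_two_point])
  have "(\<integral>x. (?G x - c)\<^sup>2 \<partial>PiM J M) = (\<integral>x. (?G x - c)\<^sup>2 \<partial>reward_table (two_point_inst s p))"
    unfolding M_def by (rule restr(2)[symmetric]) measurable
  also have "\<dots> \<le> (\<integral>x. cond_exp_arms alg T 2 (\<lambda>as. (?\<phi> as - c)\<^sup>2) x \<partial>reward_table (two_point_inst s p))"
  proof (rule integral_mono')
    show "integrable (reward_table (two_point_inst s p)) (cond_exp_arms alg T 2 (\<lambda>as. (?\<phi> as - c)\<^sup>2))"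
      using integrable_cond_exp_arms[OF alg bandit_instance_two_point[of s p]] by simp
    show "(?G x - c)\<^sup>2 \<le> cond_exp_arms alg T 2 (\<lambda>as. (?\<phi> as - c)\<^sup>2) x" for x
      using cond_exp_arms_square_le[OF alg bandit_instance_two_point[of s p]] by simp
    then show "0 \<le> cond_exp_arms alg T 2 (\<lambda>as. (?\<phi> as - c)\<^sup>2) x" for x
      using order_trans[OF zero_le_power2] by blast
  qed
  also have "\<dots> = var_pulls alg T (two_point_inst s p) 0"
    unfolding var_pulls_def c_def
    using integral_arms_law[OF alg bandit_instance_two_point[of s p]] by simp
  finally have var: "(\<integral>x. (?G x - c)\<^sup>2 \<partial>PiM J M) \<le> V\<^sup>2"
    using V(2) by simp
  have "\<bar>(\<integral>x. ?G x \<partial>PiM J (\<lambda>j. density (M j) (\<lambda>x. ennreal (f j x)))) - (\<integral>x. ?G x \<partial>PiM J M)\<bar> \<le> V / 2"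
  proof (rule integral_PiM_density_diff_le[where G = ?G and M = M and f = f and J = J and V = V and c = c and C = "\<lambda>_. max 1 (max ((1 + q) / (1 + p)) ((1 - q) / (1 - p)))"
        and B = "\<Sum>as\<in>arm_seqs 2 T. ?\<phi> as"])
    show "finite J"
      by (simp add: J_def)
    show "prob_space (M j)" for j
      unfolding M_def by (rule prob)
    show "prob_space (density (M j) (\<lambda>x. ennreal (f j x)))" for j
      using prob[of q j] unfolding M'_eq .
    show "f j \<in> borel_measurable (M j)" for j
    proof -
      have "sets (M j) = sets borel"
        by (cases j) (simp add: M_def law_eq two_point_def)
      moreover have "f j \<in> borel_measurable borel"
        by (cases j) (auto simp: f_def)
      ultimately show ?thesis
        by (simp cong: measurable_cong_sets)
    qed
    show "f j x \<ge> 0" for j x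
      using p q by (cases j) (auto simp: f_def two_point_ratio_def)
    show "f j x \<le> max 1 (max ((1 + q) / (1 + p)) ((1 - q) / (1 - p)))" for j x
      by (cases j) (auto simp: f_def two_point_ratio_def)
    have "(\<Prod>j\<in>J. \<integral>x. (f j x)\<^sup>2 \<partial>M j) = (\<Prod>(i, u)\<in>J. if i = 1 then 1 + (q - p)\<^sup>2 / (1 - p\<^sup>2) else 1)"
    proof (intro prod.cong refl)
      fix j assume "j \<in> J"
      show "(\<integral>x. (f j x)\<^sup>2 \<partial>M j) = (case j of (i, u) \<Rightarrow> if i = 1 then 1 + (q - p)\<^sup>2 / (1 - p\<^sup>2) else 1)"
      proof (cases "fst j = 1")
        case True
        then show ?thesis
          using integral_two_point_ratio_square[of s p q] s p q
          by (cases j) (simp add: f_def M_def law_eq)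
      next
        case False
        then show ?thesis
          using prob_space.prob_space[OF prob, of p j] by (cases j) (simp add: f_def M_def)
      qed
    qed
    also have "\<dots> = (\<Prod>i\<in>{..<2::nat}. \<Prod>u\<in>{1..T}. if i = 1 then 1 + (q - p)\<^sup>2 / (1 - p\<^sup>2) else 1)"
      unfolding J_def by (rule prod.cartesian_product[symmetric])
    also have "\<dots> = (1 + (q - p)\<^sup>2 / (1 - p\<^sup>2)) ^ T"
      by (simp add: numeral_2_eq_2)
    finally show "(\<Prod>j\<in>J. \<integral>x. (f j x)\<^sup>2 \<partial>M j) \<le> 5 / 4"
      using chi by simp
    show "?G \<in> borel_measurable (PiM J M)"
      using restr(1)[of "\<lambda>z. z" p] by (simp add: M_def)
    show "\<bar>?G x\<bar> \<le> (\<Sum>as\<in>arm_seqs 2 T. ?\<phi> as)" for x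
      unfolding cond_exp_arms_def
      by (rule order_trans[OF sum_abs]) (auto intro!: sum_mono mult_left_le_one_le simp: abs_mult pmf_le_1)
    show "V > 0" "(\<integral>x. (?G x - c)\<^sup>2 \<partial>PiM J M) \<le> V\<^sup>2"
      by fact+
  qed
  then show ?thesis
    unfolding E M'_eq M_def[symmetric] .
qed

section \<open>The lower bound\<close>

lemma gap_nonneg: "i < length \<nu> \<Longrightarrow> gap \<nu> i \<ge> 0"
  unfolding gap_def by simp

lemma regret_nonneg: "regret alg T \<nu> \<ge> 0"
  unfolding regret_def by (intro sum_nonneg mult_nonneg_nonneg gap_nonneg exp_pulls_nonneg) auto

lemma rpow_nonneg: "rpow x r \<ge> 0"
  by (simp add: rpow_def)

lemma alloc_variability_ge:
  "i < length \<nu> \<Longrightarrow> sqrt (var_pulls alg T \<nu> i) \<le> alloc_variability alg T \<nu>"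
  unfolding alloc_variability_def by (intro Max_ge) auto

lemma two_point_inst_in_sg_class:
  assumes "0 < s" "s \<le> M" "s \<le> \<sigma>" "0 \<le> p" "p \<le> 1" "Kbar \<ge> 2"
  shows "two_point_inst s p \<in> sg_class M \<sigma> Kbar"
proof -
  have "s * p \<le> M"
    using assms mult_left_le[of p s] by linarith
  moreover have "- M \<le> s * p"
    using assms mult_nonneg_nonneg[of s p] by linarith
  ultimately show ?thesis
    using assms bandit_instance_two_point[of s p]
    by (auto simp: sg_class_def two_point_inst_def mean_two_point intro!: sub_gaussian_two_point)
qed

lemma regret_two_point_inst:
  assumes "0 < s" "0 \<le> p" "p \<le> 1"
  shows "regret alg T (two_point_inst s p) = s * p * exp_pulls alg T (two_point_inst s p) 0"
proof -
  have means: "mean (two_point_inst s p ! 0) = 0" "mean (two_point_inst s p ! Suc 0) = s * p"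
    using assms by (simp_all add: two_point_inst_def mean_two_point)
  have "{..<length (two_point_inst s p)} = {0, Suc 0}"
    by auto
  then show ?thesis
    using assms by (simp add: regret_def gap_def means)
qed

lemma worst_case_ge:
  assumes "\<nu> \<in> \<PP>" "c \<le> regret alg T \<nu> \<or> (\<exists>i<length \<nu>. \<exists>V\<ge>0. V\<^sup>2 \<le> var_pulls alg T \<nu> i \<and> c \<le> rpow V \<rho>)" "\<rho> \<ge> 0"
  shows "ereal c \<le> worst_case \<PP> \<rho> alg T"
proof -
  have "c \<le> regret alg T \<nu> + rpow (alloc_variability alg T \<nu>) \<rho>"
    using assms(2)
  proof (elim disjE exE conjE)
    assume "c \<le> regret alg T \<nu>"
    then show ?thesis
      using rpow_nonneg[of "alloc_variability alg T \<nu>" \<rho>] by simp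
  next
    fix i V assume *: "i < length \<nu>" "0 \<le> V" "V\<^sup>2 \<le> var_pulls alg T \<nu> i" "c \<le> rpow V \<rho>"
    have "V \<le> sqrt (var_pulls alg T \<nu> i)"
      using *(3) by (rule real_le_rsqrt)
    then have "V \<le> alloc_variability alg T \<nu>"
      using alloc_variability_ge[OF *(1)] order_trans by blast
    then have "rpow V \<rho> \<le> rpow (alloc_variability alg T \<nu>) \<rho>"
      using *(2) assms(3) by (simp add: rpow_def powr_mono2)
    then show ?thesis
      using *(4) regret_nonneg[of alg T \<nu>] by simp
  qed
  then have "ereal c \<le> ereal (regret alg T \<nu> + rpow (alloc_variability alg T \<nu>) \<rho>)"
    by simp
  also have "\<dots> \<le> worst_case \<PP> \<rho> alg T"
    unfolding worst_case_def using assms(1) by (rule SUP_upper)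
  finally show ?thesis .
qed

text \<open>The perturbations have size \<open>\<delta> = 1 / (4 \<surd>T)\<close>, so that one of them changes the law of all rewards by a constant
  amount; \<open>m\<close> of them lead from two identical arms to a gap of order \<open>m \<delta>\<close>.\<close>

lemma perturbation_chi_square_le:
  assumes "T \<ge> 1" "0 \<le> p" "p \<le> 1 / 2" "q = p + 1 / (4 * sqrt (real T))"
  shows "(1 + (q - p)\<^sup>2 / (1 - p\<^sup>2)) ^ T \<le> 5 / 4"
proof -
  have "p\<^sup>2 \<le> (1 / 2)\<^sup>2"
    using assms by (intro power_mono) auto
  then have p2: "1 - p\<^sup>2 \<ge> 3 / 4"
    by (simp add: power2_eq_square)
  have q: "(q - p)\<^sup>2 = 1 / (16 * real T)"
    using assms by (simp add: power_divide power_mult_distrib)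
  have "(q - p)\<^sup>2 / (1 - p\<^sup>2) \<le> (1 / (16 * real T)) / (3 / 4)"
    unfolding q using p2 assms by (intro divide_left_mono mult_pos_pos) auto
  then have le: "1 + (q - p)\<^sup>2 / (1 - p\<^sup>2) \<le> 1 + 1 / (12 * real T)"
    by simp
  have "(1 + (q - p)\<^sup>2 / (1 - p\<^sup>2)) ^ T \<le> (1 + 1 / (12 * real T)) ^ T"
    using le p2 by (intro power_mono) auto
  also have "\<dots> \<le> exp (1 / (12 * real T)) ^ T"
    by (intro power_mono exp_ge_add_one_self) auto
  also have "\<dots> = exp (1 / 12)"
    using assms by (simp add: exp_of_nat_mult[symmetric])
  also have "\<dots> \<le> 1 + 1 / 12 + (1 / 12)\<^sup>2"
    by (rule exp_bound) auto
  also have "\<dots> \<le> 5 / 4"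
    by (simp add: power2_eq_square)
  finally show ?thesis .
qed

text \<open>While the standard deviation is at most \<open>T / (2 * m)\<close>, one step moves the
  count by at most \<open>T / (4 * m)\<close>, so \<open>m\<close> steps use up only
  \<open>T / 4\<close> of the initial \<open>T / 2\<close>. The remaining \<open>T / 4\<close>
  pulls, at gap \<open>s * m / (4 * sqrt T)\<close>, give the regret. The bound on \<open>m\<close>
  keeps the parameter below 1/2, where the chi-square estimate applies.\<close>

lemma regret_or_variability:
  assumes alg: "admissible alg" and s: "s > 0" and T: "T \<ge> 2" and m: "m \<ge> 1" "real m \<le> 2 * sqrt (real T)"
  shows "\<exists>p. 0 \<le> p \<and> p \<le> 1 / 2 \<and>
    (s * real m * sqrt (real T) / 16 \<le> regret alg T (two_point_inst s p) \<or>
     (real T / (2 * real m))\<^sup>2 < var_pulls alg T (two_point_inst s p) 0)"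
proof (rule ccontr)
  assume contra: "\<not> ?thesis"
  have dec: "decision_rules alg"
    using alg by (simp add: admissible_def)
  define \<delta> where "\<delta> = 1 / (4 * sqrt (real T))"
  define n where "n p = exp_pulls alg T (two_point_inst s p) 0" for p
  have \<delta>: "\<delta> > 0" "real m * \<delta> \<le> 1 / 2"
    using T m by (auto simp: \<delta>_def field_simps)
  have j\<delta>: "0 \<le> real j * \<delta>" "real j * \<delta> \<le> 1 / 2" if "j \<le> m" for j
  proof -
    have "real j * \<delta> \<le> real m * \<delta>"
      using that \<delta>(1) by (intro mult_right_mono) auto
    then show "real j * \<delta> \<le> 1 / 2"
      using \<delta>(2) by linarith
  qed (use \<delta>(1) in auto)
  have step: "\<bar>n (real (Suc j) * \<delta>) - n (real j * \<delta>)\<bar> \<le> real T / (2 * real m) / 2" if "j < m" for j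
    unfolding n_def
  proof (rule exp_pulls_perturbation[OF dec s])
    have Suc: "real (Suc j) * \<delta> = real j * \<delta> + 1 / (4 * sqrt (real T))"
      by (simp add: \<delta>_def add_divide_distrib)
    show "(1 + (real (Suc j) * \<delta> - real j * \<delta>)\<^sup>2 / (1 - (real j * \<delta>)\<^sup>2)) ^ T \<le> 5 / 4"
      using j\<delta>[of j] that T by (intro perturbation_chi_square_le[OF _ _ _ Suc]) auto
    show "var_pulls alg T (two_point_inst s (real j * \<delta>)) 0 \<le> (real T / (2 * real m))\<^sup>2"
      using contra j\<delta>[of j] that by (force simp: not_less)
    show "0 \<le> real j * \<delta>" "real j * \<delta> < 1" "0 \<le> real (Suc j) * \<delta>" "real (Suc j) * \<delta> \<le> 1"
      using j\<delta>[of j] j\<delta>[of "Suc j"] that by linarith+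
    show "0 < real T / (2 * real m)"
      using T m by simp
  qed
  have n0: "n 0 = real T / 2"
  proof -
    have "exp_pulls alg T (two_point_inst s 0) 0 = exp_pulls alg T (two_point_inst s 0) 1"
      using alg T bandit_instance_two_point[of s 0] by (simp add: admissible_def two_point_inst_def)
    moreover have "exp_pulls alg T (two_point_inst s 0) 0 + exp_pulls alg T (two_point_inst s 0) 1 = real T"
      using sum_exp_pulls[OF dec bandit_instance_two_point[of s 0], of T] by (simp add: numeral_2_eq_2)
    ultimately show ?thesis
      by (simp add: n_def)
  qed
  define D where "D = real T / (2 * real m) / 2"
  have "n (real j * \<delta>) \<ge> real T / 2 - real j * D" if "j \<le> m" for j
    using that
  proof (induction j)
    case (Suc j)
    have "\<bar>n (real (Suc j) * \<delta>) - n (real j * \<delta>)\<bar> \<le> D"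
      using step[of j] Suc.prems by (simp add: D_def)
    moreover have "real (Suc j) * D = real j * D + D"
      by (simp add: distrib_right)
    ultimately show ?case
      using Suc by linarith
  qed (simp add: n0)
  from this[of m] have n_ge: "n (real m * \<delta>) \<ge> real T / 4"
    using m by (simp add: D_def)
  have "s * real m * sqrt (real T) / 16 = s * (real m * \<delta>) * (real T / 4)"
    using T by (simp add: \<delta>_def field_simps)
  also have "\<dots> \<le> s * (real m * \<delta>) * n (real m * \<delta>)"
    using n_ge s \<delta>(1) by (intro mult_left_mono) auto
  also have "\<dots> = regret alg T (two_point_inst s (real m * \<delta>))"
    using s \<delta> by (subst regret_two_point_inst) (auto simp: n_def)
  finally show False
    using contra j\<delta>[of m] by blast
qed

lemma worst_case_sg_class_ge:
  assumes alg: "admissible alg" and s: "0 < s" "s \<le> M" "s \<le> \<sigma>" and "Kbar \<ge> 2" "\<rho> \<ge> 0"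
    and T: "T \<ge> 2" and m: "m \<ge> 1" "real m \<le> 2 * sqrt (real T)"
  shows "ereal (min (s * real m * sqrt (real T) / 16) (rpow (real T / (2 * real m)) \<rho>)) \<le> worst_case (sg_class M \<sigma> Kbar) \<rho> alg T"
proof -
  from regret_or_variability[OF alg s(1) T m] obtain p where p: "0 \<le> p" "p \<le> 1 / 2"
    "s * real m * sqrt (real T) / 16 \<le> regret alg T (two_point_inst s p) \<or>
     (real T / (2 * real m))\<^sup>2 < var_pulls alg T (two_point_inst s p) 0"
    by blast
  show ?thesis
  proof (rule worst_case_ge[of "two_point_inst s p"])
    show "two_point_inst s p \<in> sg_class M \<sigma> Kbar"
      using p assms by (intro two_point_inst_in_sg_class) auto
    show "min (s * real m * sqrt (real T) / 16) (rpow (real T / (2 * real m)) \<rho>) \<le> regret alg T (two_point_inst s p) \<or>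
        (\<exists>i<length (two_point_inst s p). \<exists>V\<ge>0. V\<^sup>2 \<le> var_pulls alg T (two_point_inst s p) i \<and>
          min (s * real m * sqrt (real T) / 16) (rpow (real T / (2 * real m)) \<rho>) \<le> rpow V \<rho>)"
      using p(3)
    proof
      assume "(real T / (2 * real m))\<^sup>2 < var_pulls alg T (two_point_inst s p) 0"
      then show ?thesis
        by (intro disjI2 exI[of _ 0] conjI exI[of _ "real T / (2 * real m)"]) auto
    qed auto
  qed fact
qed

text \<open>The case \<open>m = 1\<close>: the variability alternative would exceed the largest
  variance possible for a count between 0 and \<open>T\<close>, so the regret alternative holds
  whatever \<open>\<rho>\<close> is.\<close>

lemma worst_case_sg_class_ge_sqrt:
  assumes alg: "admissible alg" and s: "0 < s" "s \<le> M" "s \<le> \<sigma>" and "Kbar \<ge> 2" "\<rho> \<ge> 0"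
    and T: "T \<ge> 2"
  shows "ereal (s * sqrt (real T) / 16) \<le> worst_case (sg_class M \<sigma> Kbar) \<rho> alg T"
proof -
  have dec: "decision_rules alg"
    using alg by (simp add: admissible_def)
  have "1 \<le> 2 * sqrt (real T)"
    using T real_sqrt_ge_one[of "real T"] by linarith
  with regret_or_variability[OF alg s(1) T, of 1] obtain p where p: "0 \<le> p" "p \<le> 1 / 2"
    "s * sqrt (real T) / 16 \<le> regret alg T (two_point_inst s p) \<or>
     (real T / 2)\<^sup>2 < var_pulls alg T (two_point_inst s p) 0"
    by auto
  with var_pulls_le_square[OF dec bandit_instance_two_point[of s p], of T 0]
  have "s * sqrt (real T) / 16 \<le> regret alg T (two_point_inst s p)"
    by linarith
  then show ?thesis
    using p assms by (intro worst_case_ge[of "two_point_inst s p"] two_point_inst_in_sg_class) auto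
qed

section \<open>Choice of the number of steps\<close>

definition lower_rate :: "real \<Rightarrow> nat \<Rightarrow> real" where
  "lower_rate \<rho> T = max (sqrt (real T)) (min (real T powr (3 * \<rho> / (2 + 2 * \<rho>))) (real T))"

lemma lower_rate_pos: "T \<ge> 1 \<Longrightarrow> lower_rate \<rho> T > 0"
  by (simp add: lower_rate_def less_max_iff_disj)

text \<open>Here \<open>m\<close> is about \<open>T powr e\<close>, where \<open>e\<close> equates
  the exponent \<open>e + 1 / 2\<close> of the regret with the exponent
  \<open>(1 - e) * \<rho>\<close> of the variability. The cap 1/2, active for
  \<open>\<rho> > 2\<close>, respects \<open>m \<le> 2 * sqrt T\<close> and produces the minimum
  with \<open>T\<close> in the rate. Rounding up at most doubles \<open>m\<close>, hence the factor
  \<open>4 powr (- \<rho>)\<close>.\<close>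

lemma min_rpow_ge:
  assumes "\<rho> \<ge> 1 / 2" "T \<ge> 2"
  defines "e \<equiv> min ((2 * \<rho> - 1) / (2 + 2 * \<rho>)) (1 / 2)"
  defines "m \<equiv> nat \<lceil>real T powr e\<rceil>"
  shows "m \<ge> 1" "real m \<le> 2 * sqrt (real T)"
    "lower_rate \<rho> T \<le> real m * sqrt (real T)"
    "4 powr (- \<rho>) * lower_rate \<rho> T \<le> rpow (real T / (2 * real m)) \<rho>"
proof -
  define a where "a = min (3 * \<rho> / (2 + 2 * \<rho>)) 1"
  have e: "0 \<le> e" "e \<le> 1 / 2" "e + 1 / 2 = a" "a \<ge> 1 / 2"
    using assms(1) by (auto simp: e_def a_def min_def field_simps)
  have "(1 - e) * \<rho> \<ge> (1 - (2 * \<rho> - 1) / (2 + 2 * \<rho>)) * \<rho>"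
    using assms(1) by (intro mult_right_mono) (auto simp: e_def)
  also have "(1 - (2 * \<rho> - 1) / (2 + 2 * \<rho>)) * \<rho> = 3 * \<rho> / (2 + 2 * \<rho>)"
    using assms(1) by (simp add: field_simps)
  finally have a_le: "a \<le> (1 - e) * \<rho>"
    by (simp add: a_def)
  have T1: "real T \<ge> 1"
    using assms(2) by simp
  have ge1: "real T powr e \<ge> 1"
    using T1 e by (intro ge_one_powr_ge_zero) auto
  have m_ge: "real T powr e \<le> real m"
    unfolding m_def by (rule real_nat_ceiling_ge)
  have m_le: "real m \<le> 2 * real T powr e"
  proof -
    have "real m \<le> real T powr e + 1"
      unfolding m_def using of_int_ceiling_le_add_one[of "real T powr e"] ge1 by linarith
    then show ?thesis
      using ge1 by linarith
  qed
  show "m \<ge> 1"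
    using m_ge ge1 by linarith
  have sqrtT: "sqrt (real T) = real T powr (1 / 2)"
    using T1 by (simp add: powr_half_sqrt)
  have "real T powr e \<le> real T powr (1 / 2)"
    using T1 e by (intro powr_mono) auto
  then show "real m \<le> 2 * sqrt (real T)"
    using m_le sqrtT by linarith
  have rate: "lower_rate \<rho> T = real T powr a"
  proof -
    have "min (real T powr (3 * \<rho> / (2 + 2 * \<rho>))) (real T) = real T powr a"
    proof (cases "3 * \<rho> / (2 + 2 * \<rho>) \<le> 1")
      case True
      then have "real T powr (3 * \<rho> / (2 + 2 * \<rho>)) \<le> real T powr 1"
        using T1 by (intro powr_mono) auto
      then show ?thesis
        using True T1 by (simp add: a_def)
    next
      case False
      then have "real T powr 1 \<le> real T powr (3 * \<rho> / (2 + 2 * \<rho>))"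
        using T1 by (intro powr_mono) auto
      then show ?thesis
        using False T1 by (simp add: a_def)
    qed
    moreover have "real T powr (1 / 2) \<le> real T powr a"
      using T1 e by (intro powr_mono) auto
    ultimately show ?thesis
      by (simp add: lower_rate_def sqrtT)
  qed
  have "real T powr a = real T powr e * real T powr (1 / 2)"
    using e(3) by (simp add: powr_add[symmetric])
  also have "\<dots> \<le> real m * sqrt (real T)"
    using m_ge by (simp add: sqrtT mult_right_mono)
  finally show "lower_rate \<rho> T \<le> real m * sqrt (real T)"
    by (simp add: rate)
  have "real T powr (1 - e) / 4 \<le> real T / (2 * real m)"
  proof -
    have "real T powr (1 - e) / 4 = real T / (2 * (2 * real T powr e))"
      using T1 by (simp add: powr_diff)
    also have "\<dots> \<le> real T / (2 * real m)"
      using m_le \<open>m \<ge> 1\<close> T1 by (intro divide_left_mono) auto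
    finally show ?thesis .
  qed
  then have "(real T powr (1 - e) / 4) powr \<rho> \<le> (real T / (2 * real m)) powr \<rho>"
    using assms(1) by (intro powr_mono2) auto
  moreover have "(real T powr (1 - e) / 4) powr \<rho> = 4 powr (- \<rho>) * real T powr ((1 - e) * \<rho>)"
  proof -
    have "(real T powr (1 - e) / 4) powr \<rho> = (real T powr (1 - e)) powr \<rho> / 4 powr \<rho>"
      by (simp add: powr_divide)
    then show ?thesis
      by (simp add: powr_powr powr_minus_divide)
  qed
  moreover have "real T powr a \<le> real T powr ((1 - e) * \<rho>)"
    using a_le T1 by (rule powr_mono)
  then have "4 powr (- \<rho>) * real T powr a \<le> 4 powr (- \<rho>) * real T powr ((1 - e) * \<rho>)"
    by (intro mult_left_mono) auto
  ultimately have "4 powr (- \<rho>) * real T powr a \<le> (real T / (2 * real m)) powr \<rho>"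
    by linarith
  then show "4 powr (- \<rho>) * lower_rate \<rho> T \<le> rpow (real T / (2 * real m)) \<rho>"
    using assms(1) by (simp add: rate rpow_def)
qed

definition lower_const :: "real \<Rightarrow> real \<Rightarrow> real \<Rightarrow> real" where
  "lower_const M \<sigma> \<rho> = min (min M \<sigma> / 16) (4 powr (- \<rho>))"

lemma worst_case_ge_lower_rate:
  assumes "admissible alg" "M > 0" "\<sigma> > 0" "Kbar \<ge> 2" "\<rho> \<ge> 0" "T \<ge> 2"
  shows "ereal (lower_const M \<sigma> \<rho> * lower_rate \<rho> T) \<le> worst_case (sg_class M \<sigma> Kbar) \<rho> alg T"
proof -
  define s where "s = min M \<sigma>"
  have s: "0 < s" "s \<le> M" "s \<le> \<sigma>"
    using assms by (auto simp: s_def)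
  have c: "lower_const M \<sigma> \<rho> \<le> s / 16" "lower_const M \<sigma> \<rho> \<le> 4 powr (- \<rho>)"
    by (auto simp: lower_const_def s_def)
  have pos: "lower_rate \<rho> T > 0"
    using assms(6) by (intro lower_rate_pos) auto
  show ?thesis
  proof (cases "\<rho> \<ge> 1 / 2")
    case True
    define m where "m = nat \<lceil>real T powr (min ((2 * \<rho> - 1) / (2 + 2 * \<rho>)) (1 / 2))\<rceil>"
    note m = min_rpow_ge[OF True assms(6), folded m_def]
    have "lower_const M \<sigma> \<rho> * lower_rate \<rho> T \<le> s / 16 * (real m * sqrt (real T))"
      using c s m(3) pos by (intro mult_mono) auto
    moreover have "lower_const M \<sigma> \<rho> * lower_rate \<rho> T \<le> 4 powr (- \<rho>) * lower_rate \<rho> T"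
      using c pos by (intro mult_right_mono) auto
    ultimately have "lower_const M \<sigma> \<rho> * lower_rate \<rho> T \<le>
        min (s * real m * sqrt (real T) / 16) (rpow (real T / (2 * real m)) \<rho>)"
      using m(4) by (simp add: mult.assoc)
    then show ?thesis
      using worst_case_sg_class_ge[OF assms(1) s assms(4,5,6) m(1,2)] order_trans ereal_less_eq(3) by blast
  next
    case False
    then have "3 * \<rho> / (2 + 2 * \<rho>) \<le> 1 / 2"
      using assms(5) by (simp add: field_simps)
    then have "real T powr (3 * \<rho> / (2 + 2 * \<rho>)) \<le> real T powr (1 / 2)"
      using assms(6) by (intro powr_mono) auto
    then have "lower_rate \<rho> T = sqrt (real T)"
      by (simp add: lower_rate_def powr_half_sqrt)
    then have "lower_const M \<sigma> \<rho> * lower_rate \<rho> T \<le> s * sqrt (real T) / 16"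
      using mult_right_mono[OF c(1), of "sqrt (real T)"] by simp
    then show ?thesis
      using worst_case_sg_class_ge_sqrt[OF assms(1) s assms(4,5,6)] order_trans ereal_less_eq(3) by blast
  qed
qed

lemma liminf_worst_case_ge:
  assumes "admissible alg" "M > 0" "\<sigma> > 0" "Kbar \<ge> 2" "\<rho> \<ge> 0"
  shows "ereal (lower_const M \<sigma> \<rho>) \<le>
    liminf (\<lambda>T. worst_case (sg_class M \<sigma> Kbar) \<rho> alg T / ereal (lower_rate \<rho> T))"
proof (rule Liminf_bounded)
  show "\<forall>\<^sub>F T in sequentially. ereal (lower_const M \<sigma> \<rho>) \<le>
      worst_case (sg_class M \<sigma> Kbar) \<rho> alg T / ereal (lower_rate \<rho> T)"
    using eventually_ge_at_top[of 2]
  proof eventually_elim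
    case (elim T)
    then have "lower_rate \<rho> T > 0"
      by (intro lower_rate_pos) auto
    then show ?case
      using worst_case_ge_lower_rate[OF assms elim]
      by (subst ereal_le_divide_pos) (auto simp: mult.commute)
  qed
qed

section \<open>Runs of UCB-f under concentrated rewards\<close>

text \<open>A deterministic abstraction of one trajectory: \<open>N i t\<close> is the count after
  \<open>t\<close> rounds, and \<open>f (Suc t)\<close> the bonus in the round that follows. Of the
  selection rule only the last pull of each arm survives, and true means replace empirical ones at
  the price of \<open>g\<close> in the bonus.\<close>

definition ucb_run :: "nat \<Rightarrow> nat \<Rightarrow> (nat \<Rightarrow> real) \<Rightarrow> real \<Rightarrow> (nat \<Rightarrow> real) \<Rightarrow> (nat \<Rightarrow> nat \<Rightarrow> nat) \<Rightarrow> bool" where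
  "ucb_run K T f g \<mu> N \<longleftrightarrow>
     (\<forall>t\<le>T. (\<Sum>i<K. N i t) = t) \<and>
     (\<forall>i. \<forall>s t. s \<le> t \<longrightarrow> N i s \<le> N i t) \<and>
     (\<forall>i<K. N i K = 1) \<and>
     (\<forall>i<K. 2 \<le> N i T \<longrightarrow> (\<exists>t. K \<le> t \<and> t < T \<and> Suc (N i t) = N i T \<and>
        (\<forall>j<K. \<mu> j + (f (Suc t) - g) / sqrt (real (N j t)) \<le> \<mu> i + (f (Suc t) + g) / sqrt (real (N i t)))))"

lemma ucb_run_sum: "ucb_run K T f g \<mu> N \<Longrightarrow> t \<le> T \<Longrightarrow> (\<Sum>i<K. N i t) = t"
  by (simp add: ucb_run_def)

lemma ucb_run_mono: "ucb_run K T f g \<mu> N \<Longrightarrow> s \<le> t \<Longrightarrow> N i s \<le> N i t"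
  by (simp add: ucb_run_def)

lemma ucb_run_ge_1: "ucb_run K T f g \<mu> N \<Longrightarrow> i < K \<Longrightarrow> K \<le> t \<Longrightarrow> 1 \<le> N i t"
  using ucb_run_mono[of K T f g \<mu> N K t i] by (simp add: ucb_run_def)

lemma ucb_run_le:
  assumes "ucb_run K T f g \<mu> N" "i < K" "t \<le> T"
  shows "N i t \<le> t"
proof -
  have "N i t \<le> (\<Sum>i<K. N i t)"
    using assms(2) by (intro member_le_sum) auto
  then show ?thesis
    using ucb_run_sum[OF assms(1,3)] by simp
qed

text \<open>The bound \<open>N i T \<le> Suc t\<close> holds because a count never exceeds the time.
  It says that an arm with many pulls is last pulled late, when the bonus already dominates the
  noise.\<close>

lemma ucb_run_last_pull:
  assumes "ucb_run K T f g \<mu> N" "i < K" "2 \<le> N i T"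
  obtains t where "K \<le> t" "t < T" "real (N i t) = real (N i T) - 1" "N i T \<le> Suc t"
    "\<And>j. j < K \<Longrightarrow> \<mu> j + (f (Suc t) - g) / sqrt (real (N j t)) \<le>
      \<mu> i + (f (Suc t) + g) / sqrt (real (N i T) - 1)"
proof -
  from assms obtain t where t: "K \<le> t" "t < T" "Suc (N i t) = N i T"
    "\<And>j. j < K \<Longrightarrow> \<mu> j + (f (Suc t) - g) / sqrt (real (N j t)) \<le> \<mu> i + (f (Suc t) + g) / sqrt (real (N i t))"
    unfolding ucb_run_def by blast
  have eq: "real (N i t) = real (N i T) - 1"
    using t(3) by linarith
  have "N i T \<le> Suc t"
    using ucb_run_le[OF assms(1,2), of t] t by simp
  then show ?thesis
    using that[OF t(1,2) eq] t(4) unfolding eq by blast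
qed

text \<open>At the last pull of \<open>i\<close> the bonus is at least \<open>g\<close>, so the
  lower estimate for the index of \<open>b\<close> is at least \<open>\<mu> b\<close>.\<close>

lemma ucb_run_gap_le:
  assumes run: "ucb_run K T f g \<mu> N" and "i < K" "b < K" "\<mu> i \<le> \<mu> b"
    and f: "\<And>s t. 1 \<le> s \<Longrightarrow> s \<le> t \<Longrightarrow> f s \<le> f t" "\<And>t. t0 \<le> real t \<Longrightarrow> g \<le> f t" and g: "g \<ge> 0"
    and y: "2 \<le> N i T" "t0 + 1 \<le> real (N i T)"
  shows "\<mu> b - \<mu> i \<le> (f T + g) / sqrt (real (N i T) - 1)"
proof -
  obtain t where t: "K \<le> t" "t < T" "N i T \<le> Suc t"
    "\<mu> b + (f (Suc t) - g) / sqrt (real (N b t)) \<le> \<mu> i + (f (Suc t) + g) / sqrt (real (N i T) - 1)"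
    using ucb_run_last_pull[OF run \<open>i < K\<close> y(1)] \<open>b < K\<close> by metis
  have "t0 \<le> real (Suc t)"
    using y(2) t(3) by linarith
  then have "0 \<le> (f (Suc t) - g) / sqrt (real (N b t))"
    using f(2) by simp
  moreover have "(f (Suc t) + g) / sqrt (real (N i T) - 1) \<le> (f T + g) / sqrt (real (N i T) - 1)"
    using f(1)[of "Suc t" T] t(2) y(1) by (intro divide_right_mono) auto
  ultimately show ?thesis
    using t(4) by linarith
qed

lemma ratio_square_le:
  fixes e :: real
  assumes "0 \<le> e" "e \<le> 1 / 8"
  shows "((1 + e) / (1 - e))\<^sup>2 \<le> 1 + 8 * e"
proof -
  have "(1 + 8 * e) * (1 - e)\<^sup>2 - (1 + e)\<^sup>2 = e * (4 - 16 * e + 8 * e\<^sup>2)"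
    by (simp add: power2_eq_square algebra_simps)
  also have "\<dots> \<ge> 0"
    using assms by (intro mult_nonneg_nonneg add_nonneg_nonneg) auto
  finally show ?thesis
    using assms by (simp add: power_divide pos_divide_le_eq)
qed

text \<open>Absorbs into the noise the shift by one between the final count of an arm and its count
  just before its last pull. The core is
  \<open>sqrt n - sqrt (n - 1) \<le> 1 / sqrt n\<close>.\<close>

lemma inverse_sqrt_diff_le:
  fixes n F g :: real
  assumes "n \<ge> 2" "0 \<le> F" "F \<le> g * (n - 1)"
  shows "F / sqrt (n - 1) \<le> F / sqrt n + g / sqrt (n - 1)"
proof -
  have s: "sqrt (n - 1) > 0" "sqrt n > 0" "sqrt (n - 1) \<le> sqrt n" "1 \<le> sqrt n"
    using assms by auto
  have g: "g \<ge> 0"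
  proof (rule ccontr)
    assume "\<not> g \<ge> 0"
    then have "g * (n - 1) < 0"
      using assms(1) by (intro mult_neg_pos) auto
    then show False
      using assms(2,3) by linarith
  qed
  have "(sqrt n - sqrt (n - 1)) * sqrt n \<le> (sqrt n - sqrt (n - 1)) * (sqrt n + sqrt (n - 1))"
    using s by (intro mult_left_mono) auto
  also have "\<dots> = 1"
    using assms by (simp add: algebra_simps power2_eq_square[symmetric])
  finally have "(sqrt n - sqrt (n - 1)) \<le> 1 / sqrt n"
    using s by (simp add: field_simps)
  then have "F * (sqrt n - sqrt (n - 1)) \<le> g * (n - 1) * (1 / sqrt n)"
    using assms s by (intro mult_mono) auto
  also have "\<dots> \<le> g * n * (1 / sqrt n)"
    using g s by (intro mult_right_mono mult_left_mono) auto
  also have "\<dots> = g * (n / sqrt n)"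
    by simp
  also have "n / sqrt n = sqrt n"
    using assms by (simp add: real_div_sqrt)
  finally show ?thesis
    using s by (simp add: field_simps)
qed


text \<open>Here \<open>t0\<close> is the time from which the bonus \<open>f\<close> dominates the noise level \<open>g\<close>, and the growth condition says
  essentially that \<open>f t\<^sup>2 / t\<close> is nonincreasing, up to a correction that absorbs the logarithm in \<open>f\<close>.\<close>

definition noise_const :: "nat \<Rightarrow> real" where
  "noise_const K = (1 + 2 * real K)\<^sup>2 + 4 * (2 * real K) + 1"

text \<open>With \<open>\<kappa> = 2 * K\<close>, these two constants are the \<open>C\<close> and
  \<open>D\<close> of the locale below. They are defined beforehand because the assumption
  \<open>f_large\<close> has to mention the second one.\<close>

definition regime_const :: "nat \<Rightarrow> real" where
  "regime_const K = 15 * (2 * real K) * noise_const K + 4 * (2 * real K) + 1"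

locale ucb_regime =
  fixes K T :: nat and f :: "nat \<Rightarrow> real" and g t0 :: real and \<mu> :: "nat \<Rightarrow> real" and b :: nat
  assumes K: "2 \<le> K" and T: "4 * K \<le> T"
    and b: "b < K" "\<And>i. i < K \<Longrightarrow> \<mu> i \<le> \<mu> b"
    and f_mono: "\<And>s t. 1 \<le> s \<Longrightarrow> s \<le> t \<Longrightarrow> f s \<le> f t"
    and g: "0 < g"
    and f_large: "\<And>t. t0 \<le> real t \<Longrightarrow> 8 * regime_const K * g \<le> f t"
    and t0_nonneg: "0 \<le> t0" and t0_small: "t0 \<le> real T / (2 * real K)"
    and f_growth: "\<And>t. real T / (2 * real K) \<le> real t \<Longrightarrow> t \<le> T \<Longrightarrow>
      (f T / f t)\<^sup>2 \<le> (real T / real t) * (1 + (real T / real t - 1) / (4 * (2 * real K)))"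
    and f_T_small: "f T \<le> g * (real T / (2 * real K) - 1)" "real K * (1 + t0) * f T \<le> real T * g"
begin

definition \<kappa> :: real where "\<kappa> = 2 * real K"

definition C :: real where "C = (1 + \<kappa>)\<^sup>2 + 4 * \<kappa> + 1"

definition D :: real where "D = 15 * \<kappa> * C + 4 * \<kappa> + 1"

lemma regime_const_eq: "regime_const K = D"
  by (simp add: regime_const_def noise_const_def D_def C_def \<kappa>_def)

lemmas f_ge = f_large[unfolded regime_const_eq]
  and t0 = t0_nonneg t0_small[folded \<kappa>_def]
  and growth = f_growth[folded \<kappa>_def]
  and small = f_T_small[folded \<kappa>_def]

lemma kappa: "\<kappa> \<ge> 4"
  using K by (simp add: \<kappa>_def)

lemma C_ge: "C \<ge> 1 + 4 * \<kappa>" "C \<ge> (1 + \<kappa>)\<^sup>2" "C \<ge> 1"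
  using kappa by (simp_all add: C_def)

lemma D_ge: "D \<ge> C" "D \<ge> 1" "D \<ge> 15 * \<kappa> * C + 4 * \<kappa> + 1"
proof -
  have "1 * C \<le> 15 * \<kappa> * C"
    using kappa C_ge by (intro mult_right_mono) auto
  then show "D \<ge> C" "D \<ge> 1" "D \<ge> 15 * \<kappa> * C + 4 * \<kappa> + 1"
    using kappa C_ge(3) unfolding D_def by linarith+
qed

lemma Tpos: "real T > 0"
  using K T by simp

lemma T_div_kappa: "real T / \<kappa> \<ge> 2" "t0 \<le> real T"
proof -
  show "real T / \<kappa> \<ge> 2"
    using K T by (simp add: \<kappa>_def field_simps)
  have "real T / \<kappa> \<le> real T / 1"
    using kappa Tpos by (intro divide_left_mono) auto
  then show "t0 \<le> real T"
    using t0 by simp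
qed

lemma f_ge': "t0 \<le> real t \<Longrightarrow> 8 * D * g \<le> f t \<and> 8 * C * g \<le> f t \<and> 32 * g \<le> f t \<and> 0 < f t"
proof -
  assume "t0 \<le> real t"
  then have 1: "8 * D * g \<le> f t"
    by (rule f_ge)
  have 2: "8 * C * g \<le> 8 * D * g" "8 * 4 * g \<le> 8 * C * g"
    using D_ge C_ge(1) kappa g by (intro mult_right_mono mult_left_mono; simp)+
  then show ?thesis
    using 1 g by (intro conjI) linarith+
qed

lemma inverse_sqrt_le:
  assumes "0 < x" "0 < n" "x \<le> c * n" "1 \<le> c"
  shows "1 / sqrt n \<le> c * (1 / sqrt x)"
proof -
  have "sqrt x \<le> sqrt c * sqrt n"
    using assms by (simp add: real_sqrt_mult[symmetric])
  also have "\<dots> \<le> c * sqrt n"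
    using assms by (intro mult_right_mono) (auto intro: real_le_lsqrt simp: power2_eq_square)
  finally show ?thesis
    using assms by (simp add: field_simps)
qed

section \<open>Estimates for a single run\<close>

context
  fixes N :: "nat \<Rightarrow> nat \<Rightarrow> nat"
  assumes run: "ucb_run K T f g \<mu> N"
begin

lemma N_le_T: "i < K \<Longrightarrow> real (N i T) \<le> real T"
  using ucb_run_le[OF run, of i T] by simp

text \<open>Some arm has at least \<open>T / K\<close> pulls. At its last pull it won against the
  best arm without having a larger mean, so its width was not much smaller. As
  \<open>g \<le> f / 32\<close>, the two counts differ at most by the factor
  \<open>(33 / 31)\<^sup>2\<close>; the factor 2 in \<open>\<kappa>\<close> leaves room for this and
  for the pull that is subtracted.\<close>

lemma best_pulls_ge: "real (N b T) \<ge> real T / \<kappa>"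
proof -
  have "\<exists>i<K. real (N i T) \<ge> real T / real K"
  proof (rule ccontr)
    assume "\<not> ?thesis"
    then have "(\<Sum>i<K. real (N i T)) < (\<Sum>i<K. real T / real K)"
      using b(1) by (intro sum_strict_mono) auto
    moreover have "(\<Sum>i<K. real (N i T)) = real T"
      using ucb_run_sum[OF run, of T] by (metis of_nat_sum order_refl)
    ultimately show False
      using K by simp
  qed
  then obtain i where i: "i < K" "real (N i T) \<ge> real T / real K"
    by blast
  have TK: "real T / real K \<ge> 4"
    using K T by (simp add: field_simps)
  have "2 \<le> N i T"
    using i(2) TK by linarith
  then obtain t where t: "K \<le> t" "t < T" "N i T \<le> Suc t"
    "\<mu> b + (f (Suc t) - g) / sqrt (real (N b t)) \<le> \<mu> i + (f (Suc t) + g) / sqrt (real (N i T) - 1)"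
    using ucb_run_last_pull[OF run i(1)] b(1) by metis
  have "real T / \<kappa> \<le> real T / real K"
    using K by (intro divide_left_mono) (auto simp: \<kappa>_def)
  then have "t0 \<le> real (Suc t)"
    using t0(2) i(2) t(3) by linarith
  then have fg: "32 * g \<le> f (Suc t)" "0 < f (Suc t)"
    using f_ge' by blast+
  have Nb: "1 \<le> N b t" "N b t \<le> N b T"
    using ucb_run_ge_1[OF run b(1) t(1)] ucb_run_mono[OF run, of t T b] t(2) by auto
  have "(f (Suc t) - g) / sqrt (real (N b T)) \<le> (f (Suc t) - g) / sqrt (real (N b t))"
    using fg g Nb by (intro divide_left_mono) (auto intro!: mult_pos_pos)
  then have le: "(f (Suc t) - g) / sqrt (real (N b T)) \<le> (f (Suc t) + g) / sqrt (real (N i T) - 1)"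
    using t(4) b(2)[OF i(1)] by linarith
  define n where "n = real (N b T)"
  define y where "y = real (N i T) - 1"
  have ny: "n > 0" "y \<ge> 3"
    using Nb i(2) TK by (auto simp: n_def y_def)
  have "(f (Suc t) - g) * sqrt y \<le> (f (Suc t) + g) * sqrt n"
    using le ny unfolding n_def[symmetric] y_def[symmetric] by (simp add: field_simps)
  moreover have "31 / 32 * f (Suc t) * sqrt y \<le> (f (Suc t) - g) * sqrt y"
    using fg ny by (intro mult_right_mono) auto
  moreover have "(f (Suc t) + g) * sqrt n \<le> 33 / 32 * f (Suc t) * sqrt n"
    using fg ny by (intro mult_right_mono) auto
  ultimately have "31 / 32 * f (Suc t) * sqrt y \<le> 33 / 32 * f (Suc t) * sqrt n"
    by linarith
  then have "f (Suc t) * (31 / 32 * sqrt y) \<le> f (Suc t) * (33 / 32 * sqrt n)"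
    by (simp add: mult_ac)
  then have "31 * sqrt y \<le> 33 * sqrt n"
    using fg by simp
  then have "(31 * sqrt y)\<^sup>2 \<le> (33 * sqrt n)\<^sup>2"
    using ny by (intro power_mono) auto
  then have "961 * y \<le> 1089 * n"
    using ny by (simp add: power_mult_distrib)
  moreover define a where "a = real T / real K"
  moreover have "y \<ge> a - 1"
    using i(2) by (simp add: y_def a_def)
  moreover have "real T / \<kappa> = a / 2"
    by (simp add: \<kappa>_def a_def)
  moreover have "a \<ge> 4"
    using TK by (simp add: a_def)
  ultimately have "real T / \<kappa> \<le> n"
    by linarith
  then show ?thesis
    by (simp add: n_def)
qed

text \<open>Since the best arm has a constant share of all pulls, its noise is bounded by a multiple
  of the noise of any other arm. All noise terms can therefore be collected at the other
  arm.\<close>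

lemma sqrt_kappa_le:
  assumes "0 < x" "x \<le> real T"
  shows "1 / sqrt (real (N b T)) \<le> \<kappa> * (1 / sqrt x)"
proof (rule inverse_sqrt_le)
  have "\<kappa> * (real T / \<kappa>) \<le> \<kappa> * real (N b T)"
    using best_pulls_ge kappa by (intro mult_left_mono) auto
  then show "x \<le> \<kappa> * real (N b T)"
    using assms(2) kappa by simp
qed (use assms kappa best_pulls_ge T_div_kappa in auto)

lemma sqrt_kappa_minus_1_le:
  assumes "0 < x" "x \<le> real T"
  shows "1 / sqrt (real (N b T) - 1) \<le> 2 * \<kappa> * (1 / sqrt x)"
proof (rule inverse_sqrt_le)
  have n: "2 \<le> real (N b T)"
    using best_pulls_ge T_div_kappa by linarith
  then show "0 < real (N b T) - 1"
    by simp
  have "real T = \<kappa> * (real T / \<kappa>)"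
    using kappa by simp
  also have "\<dots> \<le> \<kappa> * (2 * (real (N b T) - 1))"
    using best_pulls_ge n kappa by (intro mult_left_mono) auto
  finally show "x \<le> 2 * \<kappa> * (real (N b T) - 1)"
    using assms(2) by (simp add: algebra_simps)
qed (use assms kappa in auto)

lemma best_sqrt_minus_1_le:
  assumes "0 \<le> \<phi>" "\<phi> \<le> f T"
  shows "\<phi> * (1 / sqrt (real (N b T) - 1)) \<le> \<phi> * (1 / sqrt (real (N b T))) + g * (1 / sqrt (real (N b T) - 1))"
proof -
  have "g * (real T / \<kappa> - 1) \<le> g * (real (N b T) - 1)"
    using best_pulls_ge g by (intro mult_left_mono) auto
  then have "\<phi> \<le> g * (real (N b T) - 1)"
    using small(1) assms(2) by linarith
  then show ?thesis
    using inverse_sqrt_diff_le[of "real (N b T)" \<phi> g] best_pulls_ge T_div_kappa assms(1) by simp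
qed

lemma growth_le:
  assumes "real T / \<kappa> \<le> real t" "t \<le> T"
  shows "f T \<le> real T / real t * f t" "0 < f t" "f t \<le> f T"
proof -
  have tpos: "real t > 0"
    using assms(1) T_div_kappa by linarith
  show fpos: "0 < f t"
    using assms(1) t0(2) by (intro f_ge'[THEN conjunct2, THEN conjunct2, THEN conjunct2]) linarith
  show "f t \<le> f T"
    using assms tpos by (intro f_mono) auto
  define x where "x = real T / real t"
  have x: "x \<ge> 1"
    using assms(2) tpos by (simp add: x_def)
  have "(x - 1) / (4 * \<kappa>) \<le> (x - 1) / 1"
    using x kappa by (intro divide_left_mono) auto
  then have "x * (1 + (x - 1) / (4 * \<kappa>)) \<le> x * x"
    using x by (intro mult_left_mono) auto
  then have "(f T / f t)\<^sup>2 \<le> x\<^sup>2"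
    using growth[OF assms] by (simp add: x_def power2_eq_square)
  then have "f T / f t \<le> x"
    using x by (auto intro: power2_le_imp_le)
  then show "f T \<le> real T / real t * f t"
    using fpos by (simp add: x_def[symmetric] pos_divide_le_eq)
qed

text \<open>The last pull of \<open>j\<close> gives such a bound with the bonus
  \<open>\<phi>\<close> of that time. If \<open>u \<ge> v\<close>, raising \<open>\<phi>\<close> to
  \<open>f T\<close> only weakens it. If \<open>u < v\<close>, then \<open>j\<close> has more pulls
  than the best arm, so its last pull came after \<open>T / \<kappa>\<close> and
  \<open>f T \<le> \<kappa> * \<phi>\<close>; nonnegativity of the gap bounds
  \<open>\<phi> * (v - u)\<close> by noise, which makes the replacement cheap.\<close>

lemma gap_upper:
  assumes j: "j < K" and y: "2 \<le> N j T" "t0 + 1 \<le> real (N j T)"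
  shows "\<mu> b - \<mu> j \<le> f T * (1 / sqrt (real (N j T) - 1) - 1 / sqrt (real (N b T))) + C * g / sqrt (real (N j T) - 1)"
proof -
  obtain t where t: "K \<le> t" "t < T" "N j T \<le> Suc t"
    "\<mu> b + (f (Suc t) - g) / sqrt (real (N b t)) \<le> \<mu> j + (f (Suc t) + g) / sqrt (real (N j T) - 1)"
    using ucb_run_last_pull[OF run j y(1)] b(1) by metis
  define \<phi> where "\<phi> = f (Suc t)"
  define u where "u = 1 / sqrt (real (N j T) - 1)"
  define v where "v = 1 / sqrt (real (N b T))"
  have "t0 \<le> real (Suc t)"
    using y(2) t(3) by linarith
  then have \<phi>: "32 * g \<le> \<phi>" "0 < \<phi>"
    unfolding \<phi>_def using f_ge' by blast+
  have Nb: "1 \<le> N b t" "N b t \<le> N b T"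
    using ucb_run_ge_1[OF run b(1) t(1)] ucb_run_mono[OF run, of t T b] t(2) by auto
  have "(\<phi> - g) * v \<le> (\<phi> - g) / sqrt (real (N b t))"
    unfolding v_def using \<phi> g Nb by (simp, intro divide_left_mono) (auto intro!: mult_pos_pos)
  then have le: "\<mu> b - \<mu> j \<le> (\<phi> + g) * u - (\<phi> - g) * v"
    using t(4) unfolding \<phi>_def[symmetric] u_def by simp
  have u: "u > 0"
    using y by (simp add: u_def)
  have v: "v \<le> \<kappa> * u"
    unfolding u_def v_def using y N_le_T[OF j] by (intro sqrt_kappa_le) auto
  have gv: "g * v \<le> g * (\<kappa> * u)"
    using v g by (intro mult_left_mono) auto
  have main: "\<mu> b - \<mu> j \<le> \<phi> * (u - v) + (1 + \<kappa>) * g * u"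
    using le gv by (simp add: algebra_simps)
  have \<phi>_le: "\<phi> \<le> f T"
    unfolding \<phi>_def using t(2) by (intro f_mono) auto
  have C: "(1 + \<kappa>) * (1 + \<kappa>) * (g * u) \<le> C * (g * u)"
    using C_ge(2) g u by (intro mult_right_mono) (auto simp: power2_eq_square)
  have "1 * (1 + \<kappa>) * (g * u) \<le> (1 + \<kappa>) * (1 + \<kappa>) * (g * u)"
    using kappa g u by (intro mult_right_mono) auto
  then have C1: "(1 + \<kappa>) * g * u \<le> C * g * u"
    using C by (simp add: mult_ac)
  have "\<mu> b - \<mu> j \<le> f T * (u - v) + C * g * u"
  proof (cases "u \<ge> v")
    case True
    then have "\<phi> * (u - v) \<le> f T * (u - v)"
      using \<phi>_le by (intro mult_right_mono) auto
    then show ?thesis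
      using main C1 by linarith
  next
    case False
    then have "sqrt (real (N b T)) < sqrt (real (N j T) - 1)"
      using y Nb by (auto simp: u_def v_def divide_less_cancel field_simps not_le)
    then have "real (N b T) < real (N j T) - 1"
      by simp
    then have Suc_t: "real T / \<kappa> \<le> real (Suc t)"
      using best_pulls_ge t(3) by linarith
    have "real T / real (Suc t) \<le> real T / (real T / \<kappa>)"
      using Suc_t Tpos T_div_kappa kappa by (intro divide_left_mono) (auto intro!: mult_pos_pos)
    then have "real T / real (Suc t) * \<phi> \<le> \<kappa> * \<phi>"
      using \<phi> Tpos kappa by (intro mult_right_mono) auto
    then have "f T \<le> \<kappa> * \<phi>"
      using growth_le(1)[OF Suc_t] t(2) unfolding \<phi>_def by linarith
    then have "f T * (v - u) \<le> \<kappa> * \<phi> * (v - u)"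
      using False by (intro mult_right_mono) auto
    also have "\<dots> = \<kappa> * (\<phi> * (v - u))"
      by simp
    also have "\<dots> \<le> \<kappa> * ((1 + \<kappa>) * g * u)"
      using main b(2)[OF j] kappa by (intro mult_left_mono) (auto simp: algebra_simps)
    finally have "- (f T * (u - v)) \<le> \<kappa> * ((1 + \<kappa>) * g * u)"
      by (simp add: algebra_simps)
    moreover have "\<phi> * (u - v) \<le> 0"
      using False \<phi> by (intro mult_nonneg_nonpos) auto
    then have "\<mu> b - \<mu> j \<le> (1 + \<kappa>) * g * u"
      using main by linarith
    \<comment> \<open>This sum is the origin of the square in \<open>C\<close>.\<close>
    moreover have "\<kappa> * ((1 + \<kappa>) * g * u) + (1 + \<kappa>) * g * u = (1 + \<kappa>) * (1 + \<kappa>) * (g * u)"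
      by (simp add: algebra_simps)
    moreover have "C * (g * u) = C * g * u"
      by simp
    ultimately show ?thesis
      using C by linarith
  qed
  then show ?thesis
    by (simp add: u_def v_def)
qed

text \<open>The best arm must have been pulled at a time \<open>s0\<close> close to the horizon: as long as it is not pulled, the pull counts
  of the other arms can only grow like \<open>f\<^sup>2\<close>, hence slower than linearly in time by a factor bounded away from 1.\<close>

lemma best_last_pull:
  obtains s0 where "real T / \<kappa> \<le> real s0" "s0 \<le> T" "f T - f s0 \<le> 15 * \<kappa> * (C * g)"
    "\<And>j. j < K \<Longrightarrow> (f s0 - g) / sqrt (real (N j T)) - (f s0 + g) / sqrt (real (N b T) - 1) \<le> \<mu> b - \<mu> j"
proof -
  define n where "n = real (N b T)"
  have n: "n \<ge> real T / \<kappa>" "n \<ge> 2"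
    using best_pulls_ge T_div_kappa by (auto simp: n_def)
  then have "2 \<le> N b T"
    by (simp add: n_def)
  then obtain \<tau> where \<tau>: "K \<le> \<tau>" "\<tau> < T" "real (N b \<tau>) = n - 1" "N b T \<le> Suc \<tau>"
    "\<And>j. j < K \<Longrightarrow> \<mu> j + (f (Suc \<tau>) - g) / sqrt (real (N j \<tau>)) \<le> \<mu> b + (f (Suc \<tau>) + g) / sqrt (n - 1)"
    unfolding n_def using ucb_run_last_pull[OF run b(1)] by metis
  define s0 where "s0 = Suc \<tau>"
  define \<phi> where "\<phi> = f s0"
  define F where "F = f T"
  have s0: "n \<le> real s0" "s0 \<le> T"
    using \<tau>(2,4) by (simp_all add: s0_def n_def)
  then have s0': "real T / \<kappa> \<le> real s0"
    using n by linarith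
  then have "t0 \<le> real s0"
    using t0(2) by linarith
  then have \<phi>: "8 * D * g \<le> \<phi>" "8 * C * g \<le> \<phi>" "32 * g \<le> \<phi>" "0 < \<phi>"
    unfolding \<phi>_def using f_ge' by blast+
  have \<phi>F: "\<phi> \<le> F"
    unfolding \<phi>_def F_def by (rule growth_le[OF s0' s0(2)])
  have Cg: "0 < C * g"
    using C_ge g by simp
  have gap: "(\<phi> - g) / sqrt (real (N j \<tau>)) - (\<phi> + g) / sqrt (n - 1) \<le> \<mu> b - \<mu> j" if "j < K" for j
    using \<tau>(5)[OF that] unfolding s0_def[symmetric] \<phi>_def[symmetric] by linarith
  \<comment> \<open>Up to an additive term, the factor by which the count of an arm can grow after
    \<open>\<tau>\<close>: the gap is bounded below by the last pull of the best arm, in terms of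
    the counts at \<open>\<tau>\<close>, and above by \<open>gap_upper\<close>, in terms of the
    counts at \<open>T\<close>.\<close>
  define R where "R = ((F + C * g) / (\<phi> - C * g))\<^sup>2"
  have \<phi>C: "\<phi> - C * g > 0"
    using \<phi>(2) Cg by linarith
  have R: "R \<ge> 0"
    by (simp add: R_def)
  have pulls_le: "real (N j T) \<le> R * real (N j \<tau>) + (1 + t0)" if j: "j < K" for j
  proof (cases "2 \<le> N j T \<and> t0 + 1 \<le> real (N j T)")
    case False
    have "0 \<le> R * real (N j \<tau>)"
      using R by simp
    moreover have "real (N j T) \<le> 1 + t0"
    proof (cases "2 \<le> N j T")
      case False
      then have "real (N j T) \<le> 1"
        by simp
      then show ?thesis
        using t0 by linarith
    qed (use False in auto)
    ultimately show ?thesis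
      by linarith
  next
    case True
    define u where "u = 1 / sqrt (real (N j T) - 1)"
    define v where "v = 1 / sqrt n"
    define w where "w = 1 / sqrt (n - 1)"
    define z where "z = real (N j \<tau>)"
    have z: "z \<ge> 1" "z \<le> real T"
      using ucb_run_ge_1[OF run j \<tau>(1)] ucb_run_le[OF run j, of \<tau>] \<tau>(2) by (simp_all add: z_def)
    have "(\<phi> - g) / sqrt z - (\<phi> + g) * w \<le> \<mu> b - \<mu> j"
      using gap[OF j] by (simp add: w_def z_def)
    moreover have "\<mu> b - \<mu> j \<le> F * (u - v) + C * g * u"
      using gap_upper[OF j] True by (simp add: F_def u_def v_def n_def)
    moreover have "\<phi> * w \<le> \<phi> * v + g * w"
      using best_sqrt_minus_1_le[of \<phi>] \<phi>(4) \<phi>F by (simp add: v_def w_def n_def F_def)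
    moreover have "\<phi> * v \<le> F * v"
      using \<phi>F n by (intro mult_right_mono) (auto simp: v_def)
    moreover have "w \<le> 2 * \<kappa> * (1 / sqrt z)"
      unfolding w_def n_def using z by (intro sqrt_kappa_minus_1_le) auto
    then have "2 * g * w \<le> 2 * g * (2 * \<kappa> * (1 / sqrt z))"
      using g by (intro mult_left_mono) auto
    moreover have "g * (1 + 4 * \<kappa>) * (1 / sqrt z) \<le> g * C * (1 / sqrt z)"
      using g C_ge(1) z by (intro mult_right_mono mult_left_mono) auto
    ultimately have "(\<phi> - C * g) * (1 / sqrt z) \<le> (F + C * g) * u"
      by (simp add: algebra_simps diff_divide_distrib add_divide_distrib)
    moreover have y: "real (N j T) - 1 > 0"
      using True by auto
    ultimately have "(\<phi> - C * g) * sqrt (real (N j T) - 1) \<le> (F + C * g) * sqrt z"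
      using z by (simp add: u_def field_simps)
    then have "sqrt (real (N j T) - 1) \<le> (F + C * g) / (\<phi> - C * g) * sqrt z"
      using \<phi>C by (simp add: field_simps)
    then have "(sqrt (real (N j T) - 1))\<^sup>2 \<le> ((F + C * g) / (\<phi> - C * g) * sqrt z)\<^sup>2"
      using y by (intro power_mono) auto
    then have "real (N j T) - 1 \<le> R * z"
      unfolding R_def power_mult_distrib using y z by simp
    then show ?thesis
      using t0(1) by (simp add: z_def)
  qed
  \<comment> \<open>\<open>x - 1\<close> measures the age of the last pull of the best arm. The aim
    is to bound it by a multiple of the relative noise \<open>\<epsilon>\<close>.\<close>
  define x where "x = real T / real s0"
  define \<epsilon> where "\<epsilon> = C * g / \<phi>"
  have s0pos: "real s0 > 0"
    using s0' T_div_kappa by linarith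
  have x: "1 \<le> x" "x \<le> \<kappa>" "x * real s0 = real T"
  proof -
    show "1 \<le> x" "x * real s0 = real T"
      using s0(2) s0pos by (simp_all add: x_def)
    have "real T \<le> \<kappa> * real s0"
      using s0' kappa by (simp add: field_simps)
    then show "x \<le> \<kappa>"
      using s0pos by (simp add: x_def pos_divide_le_eq)
  qed
  have \<epsilon>: "0 \<le> \<epsilon>" "\<epsilon> \<le> 1 / 8" "\<epsilon> * \<phi> = C * g"
    using \<phi> Cg by (simp_all add: \<epsilon>_def pos_divide_le_eq)
  have R_le: "R \<le> (1 + 8 * \<epsilon>) * (x * (1 + (x - 1) / (4 * \<kappa>)))"
  proof -
    have "(F + C * g) / (\<phi> - C * g) \<le> (F / \<phi>) * ((1 + \<epsilon>) / (1 - \<epsilon>))"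
    proof -
      have "(F / \<phi>) * ((1 + \<epsilon>) / (1 - \<epsilon>)) = (F * (1 + \<epsilon>)) / (\<phi> * (1 - \<epsilon>))"
        by simp
      also have "\<phi> * (1 - \<epsilon>) = \<phi> - C * g"
        using \<epsilon>(3) by (simp add: algebra_simps)
      finally have eq: "(F / \<phi>) * ((1 + \<epsilon>) / (1 - \<epsilon>)) = (F * (1 + \<epsilon>)) / (\<phi> - C * g)" .
      have "\<epsilon> * \<phi> \<le> \<epsilon> * F"
        using \<phi>F \<epsilon> by (intro mult_left_mono) auto
      then have "F + C * g \<le> F * (1 + \<epsilon>)"
        using \<epsilon>(3) by (simp add: algebra_simps)
      then show ?thesis
        unfolding eq using \<phi>C by (intro divide_right_mono) auto
    qed
    then have "R \<le> ((F / \<phi>) * ((1 + \<epsilon>) / (1 - \<epsilon>)))\<^sup>2"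
      unfolding R_def using \<phi>C Cg \<phi>F \<phi> by (intro power_mono) auto
    also have "\<dots> = ((1 + \<epsilon>) / (1 - \<epsilon>))\<^sup>2 * (F / \<phi>)\<^sup>2"
      unfolding power_mult_distrib by (rule mult.commute)
    also have "\<dots> \<le> (1 + 8 * \<epsilon>) * (x * (1 + (x - 1) / (4 * \<kappa>)))"
      using growth[OF s0' s0(2)] ratio_square_le[OF \<epsilon>(1,2)] \<epsilon>(1)
      unfolding F_def \<phi>_def x_def by (intro mult_mono) auto
    finally show ?thesis .
  qed
  have sum_rest: "(\<Sum>i\<in>{..<K} - {b}. real (N i t)) = real t - real (N b t)" if "t \<le> T" for t
  proof -
    have "(\<Sum>i<K. real (N i t)) = real t"
      using ucb_run_sum[OF run that] by (metis of_nat_sum)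
    then show ?thesis
      using b(1) by (simp add: sum_diff1)
  qed
  have "real T - n = (\<Sum>i\<in>{..<K} - {b}. real (N i T))"
    using sum_rest[of T] by (simp add: n_def)
  also have "\<dots> \<le> (\<Sum>i\<in>{..<K} - {b}. R * real (N i \<tau>) + (1 + t0))"
    using pulls_le by (intro sum_mono) auto
  also have "\<dots> = R * (\<Sum>i\<in>{..<K} - {b}. real (N i \<tau>)) + real (card ({..<K} - {b})) * (1 + t0)"
    by (simp add: sum.distrib sum_distrib_left)
  also have "\<dots> \<le> R * (real s0 - n) + real K * (1 + t0)"
  proof -
    \<comment> \<open>Just before its last pull the best arm has \<open>n - 1\<close> pulls at time
      \<open>s0 - 1\<close>; the two shifts by one cancel.\<close>
    have "(\<Sum>i\<in>{..<K} - {b}. real (N i \<tau>)) = real s0 - n"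
      using sum_rest[of \<tau>] \<tau>(2,3) by (simp add: s0_def)
    then show ?thesis
      using t0(1) b(1) by (simp add: mult_right_mono)
  qed
  finally have le1: "real T - n \<le> R * (real s0 - n) + real K * (1 + t0)" .
  \<comment> \<open>Because \<open>x * s0 = T\<close>, the other arms can grow to about
    \<open>T - x * n\<close>, whereas they must fill \<open>T - n\<close>. The deficit
    \<open>(x - 1) * n\<close> is at least \<open>(x - 1) * T / \<kappa>\<close>, four times the
    correction granted by the growth condition, so three quarters of that amount have to be paid by
    noise.\<close>
  define G where "G = 1 + (x - 1) / (4 * \<kappa>)"
  have G: "1 \<le> G" "G \<le> 5 / 4"
    using x kappa by (auto simp: G_def field_simps)
  have "R * (real s0 - n) \<le> (1 + 8 * \<epsilon>) * (x * G) * (real s0 - n)"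
    using R_le s0(1) by (intro mult_right_mono) (auto simp: G_def)
  also have "\<dots> = (1 + 8 * \<epsilon>) * G * (real T - x * n)"
    using x(3) by (simp add: algebra_simps)
  also have "\<dots> = (real T - x * n) + (x - 1) / (4 * \<kappa>) * (real T - x * n) + 8 * \<epsilon> * G * (real T - x * n)"
  proof -
    have "(1 + 8 * \<epsilon>) * (1 + q) * w = w + q * w + 8 * \<epsilon> * (1 + q) * w" for q w :: real
      by (simp add: algebra_simps)
    then show ?thesis
      unfolding G_def .
  qed
  also have "\<dots> \<le> (real T - x * n) + (x - 1) / (4 * \<kappa>) * real T + 8 * \<epsilon> * (5 / 4) * real T"
  proof -
    have le: "real T - x * n \<le> real T" "0 \<le> real T - x * n"
      using x n mult_left_mono[OF s0(1), of x] by auto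
    have "(x - 1) / (4 * \<kappa>) * (real T - x * n) \<le> (x - 1) / (4 * \<kappa>) * real T"
      using le x kappa by (intro mult_left_mono) auto
    moreover have "8 * \<epsilon> * G * (real T - x * n) \<le> 8 * \<epsilon> * (5 / 4) * real T"
      using le G \<epsilon> by (intro mult_mono) auto
    ultimately show ?thesis
      by linarith
  qed
  finally have "real T - n \<le> real T - x * n + (x - 1) / (4 * \<kappa>) * real T + 10 * (\<epsilon> * real T) + real K * (1 + t0)"
    using le1 by simp
  moreover have "real K * (1 + t0) \<le> \<epsilon> * real T"
  proof -
    have "real K * (1 + t0) * \<phi> \<le> real K * (1 + t0) * F"
      using \<phi>F t0(1) by (intro mult_left_mono) auto
    also have "\<dots> \<le> real T * (1 * g)"
      using small(2) by (simp add: F_def)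
    also have "\<dots> \<le> real T * (C * g)"
      using C_ge(3) g by (intro mult_left_mono mult_right_mono) auto
    finally show ?thesis
      using \<phi>(4) by (simp add: \<epsilon>_def pos_le_divide_eq mult_ac)
  qed
  moreover have "(x - 1) * (real T / \<kappa>) \<le> (x - 1) * n"
    using n x by (intro mult_left_mono) auto
  moreover have "(x - 1) / (4 * \<kappa>) * real T = (x - 1) * (real T / \<kappa>) / 4"
    using kappa by simp
  moreover have "(x - 1) * n = x * n - n"
    by (simp add: algebra_simps)
  moreover have "q * (3 / 4) \<le> 11 * e"
    if "real T - n \<le> real T - w + v + 10 * e + k" "k \<le> e" "q \<le> p" "v = q / 4" "p = w - n" for q e v k p w :: real
    using that by linarith
  ultimately have "(x - 1) * (real T / \<kappa>) * (3 / 4) \<le> 11 * (\<epsilon> * real T)"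
    by blast
  then have "real T * ((x - 1) * 3) \<le> real T * (44 * \<epsilon> * \<kappa>)"
    using kappa by (simp add: field_simps)
  then have "(x - 1) * 3 \<le> 44 * (\<epsilon> * \<kappa>)"
    using Tpos by (simp only: mult_le_cancel_left_pos mult.assoc)
  moreover have "0 \<le> \<epsilon> * \<kappa>"
    using \<epsilon> kappa by simp
  \<comment> \<open>Rounding 44/3 up gives the constant 15 that appears in \<open>D\<close>.\<close>
  moreover have "d \<le> 15 * w" if "d * 3 \<le> 44 * w" "0 \<le> w" for d w :: real
    using that by linarith
  ultimately have "x - 1 \<le> 15 * (\<epsilon> * \<kappa>)"
    by blast
  then have "x - 1 \<le> 15 * \<kappa> * \<epsilon>"
    by (simp add: mult_ac)
  then have "(x - 1) * \<phi> \<le> 15 * \<kappa> * \<epsilon> * \<phi>"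
    using \<phi>(4) by (intro mult_right_mono) auto
  also have "\<dots> = 15 * \<kappa> * (C * g)"
    using \<epsilon>(3) by simp
  finally have recent: "F - \<phi> \<le> 15 * \<kappa> * (C * g)"
    using growth_le(1)[OF s0' s0(2)] unfolding F_def[symmetric] \<phi>_def[symmetric] x_def[symmetric]
    by (simp add: algebra_simps)
  have "(\<phi> - g) / sqrt (real (N j T)) - (\<phi> + g) / sqrt (real (N b T) - 1) \<le> \<mu> b - \<mu> j" if j: "j < K" for j
  proof -
    have "1 \<le> N j \<tau>" "N j \<tau> \<le> N j T"
      using ucb_run_ge_1[OF run j \<tau>(1)] ucb_run_mono[OF run, of \<tau> T j] \<tau>(2) by auto
    then have "(\<phi> - g) / sqrt (real (N j T)) \<le> (\<phi> - g) / sqrt (real (N j \<tau>))"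
      using \<phi> g by (intro divide_left_mono) (auto intro!: mult_pos_pos)
    then show ?thesis
      using gap[OF j] by (simp add: n_def)
  qed
  then show ?thesis
    using recent s0' s0(2) unfolding \<phi>_def F_def by (intro that[of s0])
qed

text \<open>After the last pull of the best arm the other counts only grow, which weakens the
  inequality obtained there in the right direction. The terms of \<open>D\<close> are the cost of
  replacing \<open>f s0\<close> by \<open>f T\<close>, the noise of the best arm together with the
  shift by one in its count, and the noise of \<open>j\<close>.\<close>

lemma gap_lower:
  assumes j: "j < K"
  shows "f T * (1 / sqrt (real (N j T)) - 1 / sqrt (real (N b T))) - D * g / sqrt (real (N j T)) \<le> \<mu> b - \<mu> j"
proof -
  obtain s0 where s0: "real T / \<kappa> \<le> real s0" "s0 \<le> T" "f T - f s0 \<le> 15 * \<kappa> * (C * g)"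
    "(f s0 - g) / sqrt (real (N j T)) - (f s0 + g) / sqrt (real (N b T) - 1) \<le> \<mu> b - \<mu> j"
    using best_last_pull j by metis
  define F where "F = f T"
  define n where "n = real (N b T)"
  define u where "u = 1 / sqrt (real (N j T))"
  define v where "v = 1 / sqrt n"
  define w where "w = 1 / sqrt (n - 1)"
  have n: "n \<ge> real T / \<kappa>" "n \<ge> 2"
    using best_pulls_ge T_div_kappa by (auto simp: n_def)
  have F: "0 < F" "f s0 \<le> F"
    unfolding F_def using growth_le[OF s0(1,2)] by linarith+
  have Nj: "0 < real (N j T)"
    using ucb_run_ge_1[OF run j, of T] T by simp
  have u: "u > 0"
    using Nj by (simp add: u_def)
  have Fw: "F * w \<le> F * v + g * w"
    using best_sqrt_minus_1_le[of F] F by (simp add: v_def w_def n_def F_def)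
  have "w \<le> 2 * \<kappa> * u"
    unfolding w_def u_def n_def using Nj N_le_T[OF j] by (intro sqrt_kappa_minus_1_le) auto
  then have gw: "2 * g * w \<le> 2 * g * (2 * \<kappa> * u)"
    using g by (intro mult_left_mono) auto
  have "(f s0 + g) * w \<le> (F + g) * w"
    using F n by (intro mult_right_mono) (auto simp: w_def)
  moreover have "(F - 15 * \<kappa> * (C * g) - g) * u \<le> (f s0 - g) * u"
    using s0(3) u by (intro mult_right_mono) (auto simp: F_def)
  moreover have "(f s0 - g) * u - (f s0 + g) * w \<le> \<mu> b - \<mu> j"
    using s0(4) by (simp add: u_def w_def n_def)
  moreover have "(F + g) * w \<le> F * v + 2 * g * w"
    using Fw by (simp add: algebra_simps)
  ultimately have "(F - 15 * \<kappa> * (C * g) - g) * u - F * v - 2 * g * (2 * \<kappa> * u) \<le> \<mu> b - \<mu> j"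
    using gw by linarith
  moreover have "(F - 15 * \<kappa> * (C * g) - g) * u - F * v - 2 * g * (2 * \<kappa> * u) = F * (u - v) - D * g * u"
    by (simp add: D_def algebra_simps)
  ultimately show ?thesis
    by (simp add: F_def u_def v_def n_def)
qed

end

section \<open>Comparison of two runs\<close>

definition deviation :: real where
  "deviation = 8 * D * g * real T / f T + 1 + t0"

text \<open>The same unknown gap is bounded below through \<open>N\<close> and above through
  \<open>N'\<close>, and \<open>best\<close> lets the terms of the best arm be dropped. What remains
  compares two square roots; squaring it gives the relative error \<open>8 * D * g / f T\<close>.
  The summand \<open>1 + t0\<close> covers arms pulled too rarely for the bonus to dominate the
  noise, and the shift by one.\<close>

lemma ucb_runs_compare:
  assumes run: "ucb_run K T f g \<mu> N" and run': "ucb_run K T f g \<mu> N'"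
    and best: "N' b T \<le> N b T" and j: "j < K"
  shows "real (N' j T) \<le> real (N j T) + deviation"
proof (cases "2 \<le> N' j T \<and> t0 + 1 \<le> real (N' j T)")
  case False
  have "0 \<le> 8 * D * g * real T / f T"
    using f_ge'[of T] T_div_kappa D_ge g by simp
  moreover have "real (N' j T) \<le> 1 + t0"
  proof (cases "2 \<le> N' j T")
    case False
    then have "real (N' j T) \<le> 1"
      by simp
    then show ?thesis
      using t0 by linarith
  qed (use False in auto)
  ultimately show ?thesis
    by (simp add: deviation_def)
next
  case True
  define F where "F = f T"
  define y where "y = real (N j T)"
  define y' where "y' = real (N' j T) - 1"
  have F: "8 * D * g \<le> F" "0 < F"
    unfolding F_def using f_ge'[of T] T_div_kappa by auto
  have y: "1 \<le> y" "y \<le> real T"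
    using ucb_run_ge_1[OF run j, of T] N_le_T[OF run j] T by (simp_all add: y_def)
  have y': "0 < y'"
    using True by (auto simp: y'_def)
  have Dg: "0 < D * g"
    using D_ge g by simp
  have "1 / sqrt (real (N b T)) \<le> 1 / sqrt (real (N' b T))"
    using best best_pulls_ge[OF run'] T_div_kappa by (intro divide_left_mono) (auto intro!: mult_pos_pos)
  then have "F * (1 / sqrt y - 1 / sqrt (real (N' b T))) \<le> F * (1 / sqrt y - 1 / sqrt (real (N b T)))"
    using F by (intro mult_left_mono) auto
  moreover have "F * (1 / sqrt y - 1 / sqrt (real (N b T))) - D * g / sqrt y \<le> \<mu> b - \<mu> j"
    using gap_lower[OF run j] by (simp add: F_def y_def)
  moreover have "\<mu> b - \<mu> j \<le> F * (1 / sqrt y' - 1 / sqrt (real (N' b T))) + C * g / sqrt y'"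
    using gap_upper[OF run' j] True by (simp add: F_def y'_def)
  moreover have "C * g / sqrt y' \<le> D * g / sqrt y'"
    using D_ge g y' by (intro divide_right_mono mult_right_mono) auto
  ultimately have "F * (1 / sqrt y) - D * g / sqrt y \<le> F * (1 / sqrt y') + D * g / sqrt y'"
    by (simp add: right_diff_distrib)
  then have "(F - D * g) / sqrt y \<le> (F + D * g) / sqrt y'"
    by (simp add: diff_divide_distrib add_divide_distrib)
  then have "(F - D * g) * sqrt y' \<le> (F + D * g) * sqrt y"
    using y y' by (simp add: field_simps)
  moreover define \<epsilon> where "\<epsilon> = D * g / F"
  moreover have \<epsilon>: "0 \<le> \<epsilon>" "\<epsilon> \<le> 1 / 8" "F * \<epsilon> = D * g"
    using F Dg by (simp_all add: \<epsilon>_def pos_divide_le_eq)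
  ultimately have "F * ((1 - \<epsilon>) * sqrt y') \<le> F * ((1 + \<epsilon>) * sqrt y)"
    by (simp add: algebra_simps)
  then have "(1 - \<epsilon>) * sqrt y' \<le> (1 + \<epsilon>) * sqrt y"
    using F by simp
  then have "sqrt y' \<le> (1 + \<epsilon>) / (1 - \<epsilon>) * sqrt y"
    using \<epsilon> by (simp add: field_simps)
  then have "(sqrt y')\<^sup>2 \<le> ((1 + \<epsilon>) / (1 - \<epsilon>) * sqrt y)\<^sup>2"
    using y' by (intro power_mono) auto
  then have "y' \<le> ((1 + \<epsilon>) / (1 - \<epsilon>))\<^sup>2 * y"
    using y y' by (simp only: power_mult_distrib) simp
  also have "\<dots> \<le> (1 + 8 * \<epsilon>) * y"
    using ratio_square_le[OF \<epsilon>(1,2)] y by (intro mult_right_mono) auto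
  also have "\<dots> = y + 8 * \<epsilon> * y"
    by (simp add: algebra_simps)
  also have "\<dots> \<le> y + 8 * \<epsilon> * real T"
    using y \<epsilon> by (intro add_left_mono mult_left_mono) auto
  finally show ?thesis
    using t0(1) by (simp add: deviation_def y_def y'_def \<epsilon>_def F_def)
qed

lemma deviation_nonneg: "deviation \<ge> 0"
  using f_ge'[of T] T_div_kappa D_ge g t0 by (simp add: deviation_def)

lemma ucb_runs_close:
  assumes run: "ucb_run K T f g \<mu> N" and run': "ucb_run K T f g \<mu> N'" and i: "i < K"
  shows "\<bar>real (N i T) - real (N' i T)\<bar> \<le> real K * deviation"
proof -
  have ordered: "\<bar>real (N i T) - real (N' i T)\<bar> \<le> real K * deviation"
    if run: "ucb_run K T f g \<mu> N" and run': "ucb_run K T f g \<mu> N'" and le: "N' b T \<le> N b T" for N N'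
  proof -
    note cmp = ucb_runs_compare[OF run run' le]
    have "(\<Sum>j<K. real (N j T)) = real T" "(\<Sum>j<K. real (N' j T)) = real T"
      using ucb_run_sum[OF run order_refl] ucb_run_sum[OF run' order_refl] by (metis of_nat_sum)+
    then have "(\<Sum>j<K. real (N' j T) - real (N j T)) = 0"
      by (simp add: sum_subtractf)
    then have "real (N i T) - real (N' i T) = (\<Sum>j\<in>{..<K} - {i}. real (N' j T) - real (N j T))"
      using i by (simp add: sum_diff1)
    also have "\<dots> \<le> (\<Sum>j\<in>{..<K} - {i}. deviation)"
      using cmp by (intro sum_mono) (auto simp: algebra_simps)
    also have "\<dots> \<le> real K * deviation"
      using deviation_nonneg i by (simp add: mult_right_mono)
    finally have "real (N i T) - real (N' i T) \<le> real K * deviation" .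
    moreover have "real (N' i T) - real (N i T) \<le> 1 * deviation"
      using cmp[OF i] by simp
    moreover have "1 * deviation \<le> real K * deviation"
      using deviation_nonneg K by (intro mult_right_mono) auto
    ultimately show ?thesis
      by linarith
  qed
  show ?thesis
    using ordered[OF run run'] ordered[OF run' run] by (cases "N' b T \<le> N b T") (auto simp: abs_minus_commute)
qed

end

section \<open>Concentration of the rewards\<close>

text \<open>Uniform in \<open>n\<close>, because the number of pulls of an arm itself depends on the
  rewards. Division by \<open>n\<close> turns the bound into the width \<open>g / sqrt n\<close>
  used in \<open>ucb_run\<close>.\<close>

definition good_table :: "inst \<Rightarrow> nat \<Rightarrow> real \<Rightarrow> (nat \<times> nat \<Rightarrow> real) set" where
  "good_table \<nu> T g = {x. \<forall>i<length \<nu>. \<forall>n\<in>{1..T}.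
     \<bar>(\<Sum>u=1..n. x (i, u)) - real n * mean (\<nu> ! i)\<bar> \<le> g * sqrt (real n)}"

lemma integral_exp_reward_sum_le:
  assumes \<nu>: "bandit_instance \<nu>" and i: "i < length \<nu>" and sg: "sub_gaussian \<sigma> (\<nu> ! i)"
  shows "(\<integral>\<^sup>+x. ennreal (exp (l * ((\<Sum>u=1..n. x (i, u)) - real n * mean (\<nu> ! i)))) \<partial>reward_table \<nu>)
    \<le> ennreal (exp (real n * (l\<^sup>2 * \<sigma>\<^sup>2 / 2)))"
proof -
  define I :: "(nat \<times> nat) set" where "I = {..<length \<nu>} \<times> {1..}"
  define J :: "(nat \<times> nat) set" where "J = {i} \<times> {1..n}"
  have table: "reward_table \<nu> = PiM I (table_law \<nu>)"
    unfolding I_def table_law_def by (rule PiM_reward_table_cong)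
  interpret product_prob_space "table_law \<nu>" I
    unfolding table_law_def by (rule product_prob_space_arms[OF \<nu>])
  define h where "h z = exp (l * (z - mean (\<nu> ! i)))" for z :: real
  have h [measurable]: "h \<in> borel_measurable borel"
    unfolding h_def by measurable
  have law: "table_law \<nu> j = \<nu> ! i" if "j \<in> J" for j
    using that i by (auto simp: table_law_def J_def)
  have "sets (\<nu> ! i) = sets borel"
    using bandit_instance_real_distribution[OF \<nu> i] by (simp add: real_distribution_def real_distribution_axioms_def)
  then have hm: "h \<in> borel_measurable (table_law \<nu> j)" if "j \<in> J" for j
    using law[OF that] h by (simp cong: measurable_cong_sets)
  have prod: "ennreal (exp (l * ((\<Sum>u=1..n. x (i, u)) - real n * mean (\<nu> ! i)))) = (\<Prod>j\<in>J. ennreal (h (x j)))" for x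
  proof -
    have "l * ((\<Sum>u=1..n. x (i, u)) - real n * mean (\<nu> ! i)) = (\<Sum>u=1..n. l * (x (i, u) - mean (\<nu> ! i)))"
      by (simp add: sum_distrib_left[symmetric] sum_subtractf)
    then have "exp (l * ((\<Sum>u=1..n. x (i, u)) - real n * mean (\<nu> ! i))) = (\<Prod>u\<in>{1..n}. h (x (i, u)))"
      by (simp add: h_def exp_sum)
    also have "\<dots> = (\<Prod>j\<in>J. h (x j))"
      unfolding J_def by (rule prod.reindex_bij_witness[of _ snd "\<lambda>u. (i, u)"]) auto
    finally show ?thesis
      by (simp add: prod_ennreal h_def)
  qed
  have "(\<integral>\<^sup>+x. (\<Prod>j\<in>J. ennreal (h (x j))) \<partial>PiM I (table_law \<nu>)) =
      (\<integral>\<^sup>+x. (\<Prod>j\<in>J. ennreal (h (restrict x J j))) \<partial>PiM I (table_law \<nu>))"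
    by (intro nn_integral_cong prod.cong) auto
  also have "\<dots> = (\<integral>\<^sup>+x. (\<Prod>j\<in>J. ennreal (h (x j))) \<partial>distr (PiM I (table_law \<nu>)) (PiM J (table_law \<nu>)) (\<lambda>x. restrict x J))"
  proof (rule nn_integral_distr[where f = "\<lambda>x. \<Prod>j\<in>J. ennreal (h (x j))", symmetric])
    show "(\<lambda>x. restrict x J) \<in> PiM I (table_law \<nu>) \<rightarrow>\<^sub>M PiM J (table_law \<nu>)"
      using i by (intro measurable_restrict_subset) (auto simp: I_def J_def)
    have "(\<lambda>x. \<Prod>j\<in>J. ennreal (h (x j))) \<in> borel_measurable (PiM J (table_law \<nu>))"
    proof (rule borel_measurable_prod_ennreal[of J "\<lambda>j x. ennreal (h (x j))"])
      fix j assume "j \<in> J"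
      then show "(\<lambda>x. ennreal (h (x j))) \<in> borel_measurable (PiM J (table_law \<nu>))"
        using hm by (intro measurable_compose[OF _ measurable_ennreal]
            measurable_compose[OF measurable_component_singleton]) auto
    qed
    then show "(\<lambda>x. \<Prod>j\<in>J. ennreal (h (x j))) \<in>
        borel_measurable (distr (PiM I (table_law \<nu>)) (PiM J (table_law \<nu>)) (\<lambda>x. restrict x J))"
      by simp
  qed
  also have "\<dots> = (\<integral>\<^sup>+x. (\<Prod>j\<in>J. ennreal (h (x j))) \<partial>PiM J (table_law \<nu>))"
    using i by (subst distr_PiM_restrict_finite) (auto simp: I_def J_def)
  also have "\<dots> = (\<Prod>j\<in>J. \<integral>\<^sup>+z. ennreal (h z) \<partial>table_law \<nu> j)"
    using hm by (intro product_nn_integral_prod) (auto simp: J_def)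
  also have "\<dots> \<le> (\<Prod>j\<in>J. ennreal (exp (l\<^sup>2 * \<sigma>\<^sup>2 / 2)))"
  proof (intro prod_mono_ennreal)
    fix j assume j: "j \<in> J"
    have "(\<integral>\<^sup>+z. ennreal (h z) \<partial>(\<nu> ! i)) = ennreal (\<integral>z. h z \<partial>(\<nu> ! i))"
      using sg unfolding sub_gaussian_def h_def by (intro nn_integral_eq_integral) auto
    also have "\<dots> \<le> ennreal (exp (l\<^sup>2 * \<sigma>\<^sup>2 / 2))"
      using sg unfolding sub_gaussian_def h_def by (intro ennreal_leI) auto
    finally show "(\<integral>\<^sup>+z. ennreal (h z) \<partial>table_law \<nu> j) \<le> ennreal (exp (l\<^sup>2 * \<sigma>\<^sup>2 / 2))"
      by (simp add: law[OF j])
  qed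
  also have "\<dots> = ennreal (exp (l\<^sup>2 * \<sigma>\<^sup>2 / 2) ^ n)"
    by (simp add: J_def ennreal_power)
  also have "exp (l\<^sup>2 * \<sigma>\<^sup>2 / 2) ^ n = exp (real n * (l\<^sup>2 * \<sigma>\<^sup>2 / 2))"
    by (rule exp_of_nat_mult[symmetric])
  finally show ?thesis
    unfolding prod table .
qed

lemma reward_sum_measurable:
  assumes \<nu>: "bandit_instance \<nu>" and i: "i < length \<nu>"
  shows "(\<lambda>x. (\<Sum>u=1..n. x (i, u)) - real n * mean (\<nu> ! i)) \<in> borel_measurable (reward_table \<nu>)"
  using measurable_reward_table_component[OF assms] by measurable

text \<open>Chernoff's bound with the optimal \<open>l\<close>. The scaling by \<open>sqrt n\<close>
  makes \<open>n\<close> cancel, so all events of the later union bound get the same estimate;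
  \<open>r\<close> selects the tail.\<close>

lemma reward_sum_tail:
  assumes \<nu>: "bandit_instance \<nu>" and i: "i < length \<nu>" and sg: "sub_gaussian \<sigma> (\<nu> ! i)"
    and n: "n \<ge> 1" and g: "g > 0" and \<sigma>: "\<sigma> > 0" and r: "r = 1 \<or> r = - 1"
  shows "emeasure (reward_table \<nu>)
    {x \<in> space (reward_table \<nu>). r * ((\<Sum>u=1..n. x (i, u)) - real n * mean (\<nu> ! i)) > g * sqrt (real n)}
    \<le> ennreal (exp (- g\<^sup>2 / (2 * \<sigma>\<^sup>2)))"
proof -
  note m [measurable] = reward_sum_measurable[OF \<nu> i, of n]
  define X where "X x = (\<Sum>u=1..n. x (i, u)) - real n * mean (\<nu> ! i)" for x :: "nat \<times> nat \<Rightarrow> real"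
  define l where "l = g / (\<sigma>\<^sup>2 * sqrt (real n))"
  have X [measurable]: "X \<in> borel_measurable (reward_table \<nu>)"
    unfolding X_def by measurable
  have l: "l > 0"
    using g \<sigma> n by (simp add: l_def)
  have r2: "(r * l)\<^sup>2 = l\<^sup>2"
    using r by auto
  define q where "q = \<sigma>\<^sup>2"
  have q: "q > 0"
    using \<sigma> by (simp add: q_def)
  have "l\<^sup>2 = g\<^sup>2 / (q * q * real n)"
    by (simp add: l_def q_def[symmetric] power_divide power_mult_distrib power2_eq_square[of q])
  then have eq: "l * (g * sqrt (real n)) = g\<^sup>2 / \<sigma>\<^sup>2" "real n * (l\<^sup>2 * \<sigma>\<^sup>2 / 2) = g\<^sup>2 / (2 * \<sigma>\<^sup>2)"
    using n q by (simp_all add: l_def q_def[symmetric] power2_eq_square[of g])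
  have "emeasure (reward_table \<nu>) {x \<in> space (reward_table \<nu>). r * X x > g * sqrt (real n)} \<le>
      emeasure (reward_table \<nu>) {x \<in> space (reward_table \<nu>). 1 \<le> ennreal (exp (- (g\<^sup>2 / \<sigma>\<^sup>2))) * ennreal (exp (r * l * X x))}"
  proof (intro emeasure_mono subsetI)
    fix x assume x: "x \<in> {x \<in> space (reward_table \<nu>). r * X x > g * sqrt (real n)}"
    then have "l * (g * sqrt (real n)) \<le> l * (r * X x)"
      using l by (intro mult_left_mono) auto
    then have "1 \<le> exp (- (g\<^sup>2 / \<sigma>\<^sup>2)) * exp (r * l * X x)"
      unfolding eq by (simp add: exp_add[symmetric] mult_ac)
    then have "ennreal 1 \<le> ennreal (exp (- (g\<^sup>2 / \<sigma>\<^sup>2)) * exp (r * l * X x))"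
      by (intro ennreal_leI)
    then show "x \<in> {x \<in> space (reward_table \<nu>). 1 \<le> ennreal (exp (- (g\<^sup>2 / \<sigma>\<^sup>2))) * ennreal (exp (r * l * X x))}"
      using x by (simp add: ennreal_mult)
  qed measurable
  also have "\<dots> \<le> ennreal (exp (- (g\<^sup>2 / \<sigma>\<^sup>2))) * (\<integral>\<^sup>+x. ennreal (exp (r * l * X x)) * indicator (space (reward_table \<nu>)) x \<partial>reward_table \<nu>)"
    by (rule nn_integral_Markov_inequality) measurable
  also have "(\<integral>\<^sup>+x. ennreal (exp (r * l * X x)) * indicator (space (reward_table \<nu>)) x \<partial>reward_table \<nu>) =
      (\<integral>\<^sup>+x. ennreal (exp (r * l * X x)) \<partial>reward_table \<nu>)"
    by (intro nn_integral_cong) auto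
  also have "ennreal (exp (- (g\<^sup>2 / \<sigma>\<^sup>2))) * (\<integral>\<^sup>+x. ennreal (exp (r * l * X x)) \<partial>reward_table \<nu>) \<le>
      ennreal (exp (- (g\<^sup>2 / \<sigma>\<^sup>2))) * ennreal (exp (real n * ((r * l)\<^sup>2 * \<sigma>\<^sup>2 / 2)))"
    unfolding X_def by (intro mult_left_mono integral_exp_reward_sum_le[OF \<nu> i sg]) auto
  also have "\<dots> = ennreal (exp (- g\<^sup>2 / (2 * \<sigma>\<^sup>2)))"
    unfolding r2 eq(2) by (simp add: ennreal_mult[symmetric] exp_add[symmetric])
  finally show ?thesis
    by (simp add: X_def)
qed

lemma good_table_complement:
  assumes \<nu>: "bandit_instance \<nu>" and sg: "\<And>i. i < length \<nu> \<Longrightarrow> sub_gaussian \<sigma> (\<nu> ! i)"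
    and g: "g > 0" and \<sigma>: "\<sigma> > 0"
  shows "space (reward_table \<nu>) - good_table \<nu> T g \<in> sets (reward_table \<nu>)"
    and "measure (reward_table \<nu>) (space (reward_table \<nu>) - good_table \<nu> T g) \<le>
      2 * real (length \<nu>) * real T * exp (- g\<^sup>2 / (2 * \<sigma>\<^sup>2))"
proof -
  interpret prob_space "reward_table \<nu>"
    by (rule prob_space_reward_table[OF \<nu>])
  define A where "A = (\<lambda>(r, i, n). {x \<in> space (reward_table \<nu>). r * ((\<Sum>u=1..n. x (i, u)) - real n * mean (\<nu> ! i)) > g * sqrt (real n)})"
  define Z where "Z = {1, - 1 :: real} \<times> {..<length \<nu>} \<times> {1..T}"
  have fin: "finite Z"
    by (simp add: Z_def)
  have meas: "A z \<in> sets (reward_table \<nu>)" if "z \<in> Z" for z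
  proof -
    obtain r i n where z_eq: "z = (r, i, n)"
      by (cases z)
    have [measurable]: "(\<lambda>x. (\<Sum>u=1..n. x (i, u)) - real n * mean (\<nu> ! i)) \<in> borel_measurable (reward_table \<nu>)"
      using that by (intro reward_sum_measurable[OF \<nu>]) (auto simp: Z_def z_eq)
    show ?thesis
      unfolding A_def z_eq prod.case by measurable
  qed
  have eq: "space (reward_table \<nu>) - good_table \<nu> T g = (\<Union>z\<in>Z. A z)"
  proof (intro set_eqI iffI)
    fix x assume x: "x \<in> space (reward_table \<nu>) - good_table \<nu> T g"
    then obtain i n where i: "i < length \<nu>" "n \<in> {1..T}"
      "\<not> \<bar>(\<Sum>u=1..n. x (i, u)) - real n * mean (\<nu> ! i)\<bar> \<le> g * sqrt (real n)"
      by (auto simp: good_table_def)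
    then have "x \<in> A (1, i, n) \<or> x \<in> A (- 1, i, n)"
      using x by (auto simp: A_def abs_le_iff not_le)
    then show "x \<in> (\<Union>z\<in>Z. A z)"
      using i(1,2) by (force simp: Z_def)
  next
    fix x assume "x \<in> (\<Union>z\<in>Z. A z)"
    then obtain r i n where z: "(r, i, n) \<in> Z" "x \<in> A (r, i, n)"
      by auto
    then have "x \<in> space (reward_table \<nu>)" "r * ((\<Sum>u=1..n. x (i, u)) - real n * mean (\<nu> ! i)) > g * sqrt (real n)"
      by (simp_all add: A_def)
    moreover from z(1) have "r * ((\<Sum>u=1..n. x (i, u)) - real n * mean (\<nu> ! i)) \<le> \<bar>(\<Sum>u=1..n. x (i, u)) - real n * mean (\<nu> ! i)\<bar>"
      by (auto simp: Z_def)
    ultimately have large: "\<not> \<bar>(\<Sum>u=1..n. x (i, u)) - real n * mean (\<nu> ! i)\<bar> \<le> g * sqrt (real n)"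
      by linarith
    show "x \<in> space (reward_table \<nu>) - good_table \<nu> T g"
    proof -
      have "i < length \<nu>" "n \<in> {1..T}"
        using z(1) by (auto simp: Z_def)
      with large \<open>x \<in> space (reward_table \<nu>)\<close> show ?thesis
        unfolding good_table_def by blast
    qed
  qed
  show "space (reward_table \<nu>) - good_table \<nu> T g \<in> sets (reward_table \<nu>)"
    unfolding eq using fin meas by (intro sets.finite_UN) auto
  have "measure (reward_table \<nu>) (space (reward_table \<nu>) - good_table \<nu> T g) \<le> (\<Sum>z\<in>Z. measure (reward_table \<nu>) (A z))"
    unfolding eq using fin meas by (intro finite_measure_subadditive_finite) auto
  also have "\<dots> \<le> (\<Sum>z\<in>Z. exp (- g\<^sup>2 / (2 * \<sigma>\<^sup>2)))"
  proof (rule sum_mono)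
    fix z assume z: "z \<in> Z"
    obtain r i n where z_eq: "z = (r, i, n)"
      by (cases z)
    have "emeasure (reward_table \<nu>) (A z) \<le> ennreal (exp (- g\<^sup>2 / (2 * \<sigma>\<^sup>2)))"
      using z unfolding z_eq A_def prod.case
      by (intro reward_sum_tail[OF \<nu> _ sg _ g \<sigma>]) (auto simp: Z_def)
    then show "measure (reward_table \<nu>) (A z) \<le> exp (- g\<^sup>2 / (2 * \<sigma>\<^sup>2))"
      by (simp add: emeasure_eq_measure)
  qed
  also have "\<dots> = 2 * real (length \<nu>) * real T * exp (- g\<^sup>2 / (2 * \<sigma>\<^sup>2))"
    by (simp add: Z_def card_cartesian_product)
  finally show "measure (reward_table \<nu>) (space (reward_table \<nu>) - good_table \<nu> T g) \<le>
      2 * real (length \<nu>) * real T * exp (- g\<^sup>2 / (2 * \<sigma>\<^sup>2))" .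
qed

subsection \<open>Histories of UCB-f\<close>

lemma sum_rewards_table_history:
  "sum_list (map snd (filter (\<lambda>(a, r). a = i) (table_history x as))) = (\<Sum>u=1..count_list as i. x (i, u))"
proof (induction as rule: rev_induct)
  case (snoc a as)
  then show ?case
    by (auto simp: add.commute)
qed simp

lemma ucb_index_bounds:
  assumes x: "x \<in> good_table \<nu> T g" and i: "i < length \<nu>"
    and n: "1 \<le> count_list as i" "length as \<le> T"
  shows "ucb_index f (table_history x as) i \<le>
      mean (\<nu> ! i) + (f (Suc (length as)) + g) / sqrt (real (count_list as i))"
    and "mean (\<nu> ! i) + (f (Suc (length as)) - g) / sqrt (real (count_list as i)) \<le>
      ucb_index f (table_history x as) i"
proof -
  define n where "n = count_list as i"
  define S where "S = (\<Sum>u=1..n. x (i, u))"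
  have n: "1 \<le> n" "n \<le> T"
    using assms(3,4) count_le_length[of as i] by (auto simp: n_def)
  have "\<bar>S - real n * mean (\<nu> ! i)\<bar> \<le> g * sqrt (real n)"
    using x i n by (auto simp: good_table_def S_def)
  then have "\<bar>S - real n * mean (\<nu> ! i)\<bar> / real n \<le> g * sqrt (real n) / real n"
    by (intro divide_right_mono) auto
  moreover have "\<bar>S - real n * mean (\<nu> ! i)\<bar> / real n = \<bar>S / real n - mean (\<nu> ! i)\<bar>"
  proof -
    have "S / real n - mean (\<nu> ! i) = (S - real n * mean (\<nu> ! i)) / real n"
      using n by (simp add: diff_divide_distrib)
    then show ?thesis
      by simp
  qed
  moreover have "g * sqrt (real n) / real n = g / sqrt (real n)"
    using n real_div_sqrt[of "real n"] by (simp add: field_simps)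
  ultimately have "\<bar>S / real n - mean (\<nu> ! i)\<bar> \<le> g / sqrt (real n)"
    by simp
  moreover have "ucb_index f (table_history x as) i = S / real n + f (Suc (length as)) / sqrt (real n)"
    by (simp add: ucb_index_def emp_mean_def sum_rewards_table_history S_def n_def)
  ultimately show "ucb_index f (table_history x as) i \<le>
      mean (\<nu> ! i) + (f (Suc (length as)) + g) / sqrt (real (count_list as i))"
    "mean (\<nu> ! i) + (f (Suc (length as)) - g) / sqrt (real (count_list as i)) \<le>
      ucb_index f (table_history x as) i"
    unfolding n_def[symmetric] add_divide_distrib diff_divide_distrib by linarith+
qed

lemma count_list_take_Suc:
  "t < length as \<Longrightarrow> count_list (take (Suc t) as) i = count_list (take t as) i + (if as ! t = i then 1 else 0)"
  by (simp add: take_Suc_conv_app_nth)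

text \<open>The bridge from probability to the deterministic analysis: it covers every trajectory of
  positive probability on a good table, whatever the order of the initial pulls and the breaking of
  ties.\<close>

lemma ucb_run_arms:
  assumes dec: "decision_rules alg" and ucb: "is_ucb f alg" and \<nu>: "bandit_instance \<nu>"
    and K: "K = length \<nu>" "K \<le> T"
    and x: "x \<in> good_table \<nu> T g"
    and as: "as \<in> set_pmf (arms_given (alg T K) x T)"
  shows "ucb_run K T f g (\<lambda>i. mean (\<nu> ! i)) (\<lambda>i t. count_list (take t as) i)"
proof -
  define N where "N i t = count_list (take t as) i" for i t
  have K1: "1 \<le> K"
    using \<nu> K by (cases \<nu>) (auto simp: bandit_instance_def)
  have len: "length as = T" "set as \<subseteq> {..<K}"
    using set_pmf_arms_given[OF dec K1 order_refl, of T x] as by (auto simp: arm_seqs_def)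
  have set_take: "set (take t as) \<subseteq> {..<K}" for t
    using len(2) set_take_subset[of t as] by blast
  have sum: "(\<Sum>i<K. N i t) = t" if "t \<le> T" for t
    using sum_count_set[OF set_take, of t] that len(1) by (simp add: N_def)
  have mono: "N i s \<le> N i t" if "s \<le> t" for i s t
  proof -
    have "take t as = take s as @ take (t - s) (drop s as)"
      using that take_add[of s "t - s" as] by simp
    then show ?thesis
      by (simp add: N_def)
  qed
  have arm: "as ! t \<in> set_pmf (alg T K (table_history x (take t as)))" if "t < T" for t
    using set_pmf_arms_given_take[OF as that] .
  note rule = ucb[unfolded is_ucb_def, rule_format, OF K1, of "table_history x (take t as)" T for t]
  have pull: "N i (Suc t) = N i t + (if as ! t = i then 1 else 0)" if "t < T" for i t
    unfolding N_def using that len(1) by (intro count_list_take_Suc) auto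
  have init: "as ! t < K \<and> N (as ! t) t = 0" if "t < K" for t
  proof -
    have "set_pmf (alg T K (table_history x (take t as))) \<subseteq> {i. i < K \<and> pulls i (table_history x (take t as)) = 0}"
      using rule[of t, THEN conjunct1] set_take[of t] that K(2) len(1) by simp
    then show ?thesis
      using arm[of t] that K(2) by (auto simp: N_def)
  qed
  have le1: "N i t \<le> 1" if "t \<le> K" for i t
    using that
  proof (induction t)
    case (Suc t)
    have "N i (Suc t) = N i t + (if as ! t = i then 1 else 0)"
      using Suc.prems K(2) by (intro pull) auto
    then show ?case
      using Suc init[of t] by (auto split: if_splits)
  qed (simp add: N_def)
  have at_K: "N i K = 1" if "i < K" for i
  proof (rule ccontr)
    assume "N i K \<noteq> 1"
    then have "N i K < 1"
      using le1[of K i] by linarith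
    then have "(\<Sum>i<K. N i K) < (\<Sum>i<K. 1)"
      using that le1[of K] by (intro sum_strict_mono_ex1) auto
    then show False
      using sum[of K] K(2) by simp
  qed
  have last: "\<exists>t. K \<le> t \<and> t < T \<and> Suc (N i t) = N i T \<and>
      (\<forall>j<K. mean (\<nu> ! j) + (f (Suc t) - g) / sqrt (real (N j t)) \<le> mean (\<nu> ! i) + (f (Suc t) + g) / sqrt (real (N i t)))"
    if i: "i < K" and N2: "2 \<le> N i T" for i
  proof -
    \<comment> \<open>The least time with the final count comes right after the last pull, hence the
      subtraction of one. It exceeds \<open>K\<close>, where all counts are 1, so the index rule
      governs that round.\<close>
    define t where "t = (LEAST t. N i t = N i T) - 1"
    have least: "N i (LEAST t. N i t = N i T) = N i T"
      by (rule LeastI[of "\<lambda>t. N i t = N i T" T]) simp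
    have pos: "(LEAST t. N i t = N i T) > K"
    proof (rule ccontr)
      assume "\<not> ?thesis"
      then have "N i T \<le> N i K"
        using mono[of "LEAST t. N i t = N i T" K i] least by simp
      then show False
        using at_K[OF i] N2 by simp
    qed
    have le: "(LEAST t. N i t = N i T) \<le> T"
      by (rule Least_le) simp
    have t: "Suc t = (LEAST t. N i t = N i T)" "K \<le> t" "t < T"
      using pos le by (auto simp: t_def)
    have "N i t \<noteq> N i T"
      using not_less_Least[of t "\<lambda>t. N i t = N i T"] t(1) by simp
    then have last: "as ! t = i" "Suc (N i t) = N i T"
      using pull[OF t(3), of i] least unfolding t(1)[symmetric] by (auto split: if_splits)
    have ge1: "1 \<le> N j t" if "j < K" for j
      using mono[OF t(2), of j] at_K[OF that] by simp
    have "set_pmf (alg T K (table_history x (take t as))) \<subseteq>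
        {a. is_arg_max (ucb_index f (table_history x (take t as))) (\<lambda>a. a < K) a}"
      using rule[of t, THEN conjunct2] set_take[of t] t K(2) len(1) ge1 by (simp add: N_def)
    then have is_max: "is_arg_max (ucb_index f (table_history x (take t as))) (\<lambda>a. a < K) i"
      using arm[OF t(3)] last(1) by auto
    have max: "ucb_index f (table_history x (take t as)) j \<le> ucb_index f (table_history x (take t as)) i" if "j < K" for j
    proof -
      have "\<not> ucb_index f (table_history x (take t as)) i < ucb_index f (table_history x (take t as)) j"
        using is_max that by (auto simp: is_arg_max_def)
      then show ?thesis
        by linarith
    qed
    have lt: "length (take t as) = t"
      using len(1) t(3) by simp
    have "mean (\<nu> ! j) + (f (Suc t) - g) / sqrt (real (N j t)) \<le> mean (\<nu> ! i) + (f (Suc t) + g) / sqrt (real (N i t))"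
      if j: "j < K" for j
    proof -
      have "mean (\<nu> ! j) + (f (Suc t) - g) / sqrt (real (N j t)) \<le> ucb_index f (table_history x (take t as)) j"
        using ucb_index_bounds(2)[OF x, of j "take t as" f] j K(1) ge1[OF j] t(3) lt by (simp add: N_def)
      also have "\<dots> \<le> ucb_index f (table_history x (take t as)) i"
        by (rule max[OF j])
      also have "\<dots> \<le> mean (\<nu> ! i) + (f (Suc t) + g) / sqrt (real (N i t))"
        using ucb_index_bounds(1)[OF x, of i "take t as" f] i K(1) ge1[OF i] t(3) lt by (simp add: N_def)
      finally show ?thesis .
    qed
    then show ?thesis
      using t(2,3) last(2) by blast
  qed
  show ?thesis
    unfolding ucb_run_def N_def[symmetric] using sum mono at_K last by blast
qed

section \<open>Regret and variability of UCB-f\<close>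

text \<open>The split is over tables only; on a good table the bound holds for every outcome of the
  algorithm's own randomness.\<close>

lemma integral_arms_law_le:
  assumes dec: "decision_rules alg" and \<nu>: "bandit_instance \<nu>"
    and bad: "space (reward_table \<nu>) - G \<in> sets (reward_table \<nu>)"
    and good: "\<And>x as. x \<in> G \<Longrightarrow> as \<in> set_pmf (arms_given (alg T (length \<nu>)) x T) \<Longrightarrow> \<phi> as \<le> A"
    and all: "\<And>as. as \<in> arm_seqs (length \<nu>) T \<Longrightarrow> \<phi> as \<le> B"
    and nonneg: "0 \<le> A" "0 \<le> B"
  shows "(\<integral>as. \<phi> as \<partial>arms_law alg T \<nu>) \<le> A + B * measure (reward_table \<nu>) (space (reward_table \<nu>) - G)"
proof -
  interpret prob_space "reward_table \<nu>"
    by (rule prob_space_reward_table[OF \<nu>])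
  let ?p = "\<lambda>x. arms_given (alg T (length \<nu>)) x T"
  have supp: "set_pmf (?p x) \<subseteq> arm_seqs (length \<nu>) T" for x
    by (rule set_pmf_arms[OF dec \<nu>])
  have int: "integrable (measure_pmf (?p x)) \<phi>" for x
    using finite_subset[OF supp] by (intro integrable_measure_pmf_finite) auto
  have "(\<integral>as. \<phi> as \<partial>arms_law alg T \<nu>) = (\<integral>x. cond_exp_arms alg T (length \<nu>) \<phi> x \<partial>reward_table \<nu>)"
    by (rule integral_arms_law[OF dec \<nu>])
  also have "\<dots> \<le> (\<integral>x. A + B * indicator (space (reward_table \<nu>) - G) x \<partial>reward_table \<nu>)"
  proof (rule integral_mono)
    show "integrable (reward_table \<nu>) (cond_exp_arms alg T (length \<nu>) \<phi>)"
      by (rule integrable_cond_exp_arms[OF dec \<nu>])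
    show "integrable (reward_table \<nu>) (\<lambda>x. A + B * indicator (space (reward_table \<nu>) - G) x)"
      using bad by (intro Bochner_Integration.integrable_add integrable_mult_right integrable_real_indicator) (auto simp: emeasure_eq_measure)
    fix x assume x: "x \<in> space (reward_table \<nu>)"
    show "cond_exp_arms alg T (length \<nu>) \<phi> x \<le> A + B * indicator (space (reward_table \<nu>) - G) x"
    proof (cases "x \<in> G")
      case True
      have "(\<integral>as. \<phi> as \<partial>measure_pmf (?p x)) \<le> A"
        using good[OF True] int by (intro measure_pmf.integral_le_const) (auto simp: AE_measure_pmf_iff)
      then show ?thesis
        using True by (simp add: cond_exp_arms_eq_integral[OF dec \<nu>])
    next
      case False
      have "(\<integral>as. \<phi> as \<partial>measure_pmf (?p x)) \<le> B"
        using all supp[of x] int by (intro measure_pmf.integral_le_const) (auto simp: AE_measure_pmf_iff)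
      then show ?thesis
        using False x nonneg by (simp add: cond_exp_arms_eq_integral[OF dec \<nu>])
    qed
  qed
  also have "\<dots> = A + B * measure (reward_table \<nu>) (space (reward_table \<nu>) - G)"
    using bad by (subst Bochner_Integration.integral_add) (auto simp: emeasure_eq_measure prob_space)
  finally show ?thesis .
qed

lemma best_arm:
  assumes "\<nu> \<noteq> []"
  obtains b where "b < length \<nu>" "\<And>i. i < length \<nu> \<Longrightarrow> mean (\<nu> ! i) \<le> mean (\<nu> ! b)"
    "\<And>i. gap \<nu> i = mean (\<nu> ! b) - mean (\<nu> ! i)"
proof -
  let ?S = "(\<lambda>j. mean (\<nu> ! j)) ` {..<length \<nu>}"
  have S: "finite ?S" "?S \<noteq> {}"
    using assms by auto
  have "Max ?S \<in> ?S"
    by (rule Max_in[OF S])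
  then obtain b where b: "b < length \<nu>" "Max ?S = mean (\<nu> ! b)"
    by (elim imageE) auto
  show ?thesis
  proof (rule that[OF b(1)])
    show "mean (\<nu> ! i) \<le> mean (\<nu> ! b)" if "i < length \<nu>" for i
      using Max_ge[OF S(1), of "mean (\<nu> ! i)"] that unfolding b(2) by simp
    show "gap \<nu> i = mean (\<nu> ! b) - mean (\<nu> ! i)" for i
      by (simp add: gap_def b(2))
  qed
qed

lemma sg_classD:
  assumes "\<nu> \<in> sg_class M \<sigma> Kbar"
  shows "bandit_instance \<nu>" "2 \<le> length \<nu>" "length \<nu> \<le> Kbar" "\<nu> \<noteq> []"
    "\<And>i. i < length \<nu> \<Longrightarrow> - M \<le> mean (\<nu> ! i) \<and> mean (\<nu> ! i) \<le> M \<and> sub_gaussian \<sigma> (\<nu> ! i)"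
  using assms by (auto simp: sg_class_def)

lemma regret_eq_integral:
  assumes "decision_rules alg" "bandit_instance \<nu>"
  shows "regret alg T \<nu> = (\<integral>as. (\<Sum>i<length \<nu>. gap \<nu> i * real (count_list as i)) \<partial>arms_law alg T \<nu>)"
  unfolding regret_def exp_pulls_def
  by (subst Bochner_Integration.integral_sum) (auto intro: integrable_arms_law[OF assms])

text \<open>Multiplying \<open>ucb_run_gap_le\<close> by the count removes the gap and leaves
  \<open>(f T + g) * sqrt T\<close> per arm. Arms with at most \<open>t0 + 2\<close> pulls pay at
  most \<open>2 * M\<close> for each, and the last summand charges the full regret on bad
  tables.\<close>

lemma regret_ucb_le:
  assumes dec: "decision_rules alg" and ucb: "is_ucb f alg" and \<nu>: "\<nu> \<in> sg_class M \<sigma> Kbar"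
    and T: "Kbar \<le> T" and M: "M > 0" and \<sigma>: "\<sigma> > 0" and g: "g > 0" and t0: "t0 \<ge> 0"
    and f: "\<And>s t. 1 \<le> s \<Longrightarrow> s \<le> t \<Longrightarrow> f s \<le> f t" "\<And>t. t0 \<le> real t \<Longrightarrow> g \<le> f t" "f T \<ge> 0"
  shows "regret alg T \<nu> \<le> real Kbar * (2 * M * (t0 + 2) + (f T + g) * sqrt (real T)) +
    2 * M * real T * (2 * real Kbar * real T * exp (- g\<^sup>2 / (2 * \<sigma>\<^sup>2)))"
proof -
  note \<nu>' = sg_classD[OF \<nu>]
  define K where "K = length \<nu>"
  have K: "K \<le> T" "K \<le> Kbar"
    using \<nu>' T by (auto simp: K_def)
  obtain b where b: "b < K" "\<And>i. i < K \<Longrightarrow> mean (\<nu> ! i) \<le> mean (\<nu> ! b)"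
    "\<And>i. gap \<nu> i = mean (\<nu> ! b) - mean (\<nu> ! i)"
    unfolding K_def using best_arm[OF \<nu>'(4)] by metis
  have gap: "0 \<le> gap \<nu> i" "gap \<nu> i \<le> 2 * M" if "i < K" for i
    using b(2)[OF that] b(3)[of i] \<nu>'(5)[of i] \<nu>'(5)[of b] that b(1) by (auto simp: K_def)
  define A where "A = 2 * M * (t0 + 2) + (f T + g) * sqrt (real T)"
  have A: "A \<ge> 0"
    using M t0 f(3) g by (auto simp: A_def)
  have good: "(\<Sum>i<length \<nu>. gap \<nu> i * real (count_list as i)) \<le> real Kbar * A"
    if x: "x \<in> good_table \<nu> T g" and as: "as \<in> set_pmf (arms_given (alg T (length \<nu>)) x T)" for x as
  proof -
    have run: "ucb_run K T f g (\<lambda>i. mean (\<nu> ! i)) (\<lambda>i t. count_list (take t as) i)"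
      using as K(1) by (intro ucb_run_arms[OF dec ucb \<nu>'(1) _ _ x]) (auto simp: K_def)
    have take: "take T as = as"
      using set_pmf_arms_given_length[OF as] by simp
    have "gap \<nu> i * real (count_list as i) \<le> A" if i: "i < K" for i
    proof (cases "2 \<le> count_list as i \<and> t0 + 1 \<le> real (count_list as i)")
      case True
      define y where "y = real (count_list as i)"
      have y: "2 \<le> y"
        using True by (simp add: y_def)
      have "mean (\<nu> ! b) - mean (\<nu> ! i) \<le> (f T + g) / sqrt (y - 1)"
        using ucb_run_gap_le[OF run i b(1) b(2)[OF i] f(1,2)] True g unfolding take y_def by auto
      then have "gap \<nu> i * (y - 1) \<le> (f T + g) / sqrt (y - 1) * (y - 1)"
        using y b(3)[of i] by (intro mult_right_mono) auto
      also have "\<dots> = (f T + g) * sqrt (y - 1)"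
        using y real_div_sqrt[of "y - 1"] by (simp add: field_simps)
      also have "\<dots> \<le> (f T + g) * sqrt (real T)"
        using f(3) g ucb_run_le[OF run i order_refl] unfolding take
        by (intro mult_left_mono) (auto simp: y_def)
      finally have "gap \<nu> i * y \<le> gap \<nu> i + (f T + g) * sqrt (real T)"
        by (simp add: algebra_simps)
      moreover have "gap \<nu> i \<le> 2 * M * (t0 + 2)"
      proof -
        have "2 * M * 1 \<le> 2 * M * (t0 + 2)"
          using M t0 by (intro mult_left_mono) auto
        then show ?thesis
          using gap(2)[OF i] by simp
      qed
      ultimately show ?thesis
        by (simp add: A_def y_def)
    next
      case False
      have "real (count_list as i) \<le> t0 + 2"
      proof (cases "2 \<le> count_list as i")
        case False
        then have "real (count_list as i) \<le> 1"
          by simp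
        then show ?thesis
          using t0 by linarith
      qed (use False in auto)
      then have "gap \<nu> i * real (count_list as i) \<le> 2 * M * (t0 + 2)"
        using gap[OF i] M by (intro mult_mono) auto
      moreover have "0 \<le> (f T + g) * sqrt (real T)"
        using f(3) g by simp
      ultimately show ?thesis
        by (simp add: A_def)
    qed
    then have "(\<Sum>i<K. gap \<nu> i * real (count_list as i)) \<le> (\<Sum>i<K. A)"
      by (intro sum_mono) auto
    also have "\<dots> \<le> real Kbar * A"
      using K A by (simp add: mult_right_mono)
    finally show ?thesis
      by (simp add: K_def)
  qed
  have all: "(\<Sum>i<length \<nu>. gap \<nu> i * real (count_list as i)) \<le> 2 * M * real T" if "as \<in> arm_seqs (length \<nu>) T" for as
  proof -
    have "(\<Sum>i<length \<nu>. gap \<nu> i * real (count_list as i)) \<le> (\<Sum>i<length \<nu>. 2 * M * real (count_list as i))"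
      using gap by (intro sum_mono mult_right_mono) (auto simp: K_def)
    also have "\<dots> = 2 * M * real (\<Sum>i<length \<nu>. count_list as i)"
      by (simp add: sum_distrib_left)
    also have "(\<Sum>i<length \<nu>. count_list as i) = T"
      using sum_count_set[of as "{..<length \<nu>}"] that by (simp add: arm_seqs_def)
    finally show ?thesis .
  qed
  have "regret alg T \<nu> \<le> real Kbar * A + 2 * M * real T *
      measure (reward_table \<nu>) (space (reward_table \<nu>) - good_table \<nu> T g)"
    unfolding regret_eq_integral[OF dec \<nu>'(1)]
    using good_table_complement(1)[OF \<nu>'(1) _ g \<sigma>] \<nu>'(5) A M
    by (intro integral_arms_law_le[OF dec \<nu>'(1) _ good all]) auto
  also have "\<dots> \<le> real Kbar * A + 2 * M * real T * (2 * real Kbar * real T * exp (- g\<^sup>2 / (2 * \<sigma>\<^sup>2)))"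
  proof (intro add_left_mono mult_left_mono)
    have "measure (reward_table \<nu>) (space (reward_table \<nu>) - good_table \<nu> T g) \<le>
        2 * real (length \<nu>) * real T * exp (- g\<^sup>2 / (2 * \<sigma>\<^sup>2))"
      using good_table_complement(2)[OF \<nu>'(1) _ g \<sigma>] \<nu>'(5) by blast
    also have "\<dots> \<le> 2 * real Kbar * real T * exp (- g\<^sup>2 / (2 * \<sigma>\<^sup>2))"
      using \<nu>'(3) by (intro mult_right_mono) auto
    finally show "measure (reward_table \<nu>) (space (reward_table \<nu>) - good_table \<nu> T g) \<le>
        2 * real Kbar * real T * exp (- g\<^sup>2 / (2 * \<sigma>\<^sup>2))" .
  qed (use M in auto)
  finally show ?thesis
    by (simp add: A_def)
qed

text \<open>The centre is the count in one fixed good trajectory instead of the mean, so that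
  closeness of pairs of runs can be used directly. The assumption \<open>small\<close> guarantees
  that a good table exists.\<close>

lemma var_pulls_ucb_le:
  assumes dec: "decision_rules alg" and ucb: "is_ucb f alg" and \<nu>: "\<nu> \<in> sg_class M \<sigma> Kbar"
    and T: "length \<nu> \<le> T" and \<sigma>: "\<sigma> > 0" and g: "g > 0" and i: "i < length \<nu>"
    and small: "2 * real Kbar * real T * exp (- g\<^sup>2 / (2 * \<sigma>\<^sup>2)) < 1" and \<delta>: "\<delta> \<ge> 0"
    and close: "\<And>N N'. ucb_run (length \<nu>) T f g (\<lambda>i. mean (\<nu> ! i)) N \<Longrightarrow> ucb_run (length \<nu>) T f g (\<lambda>i. mean (\<nu> ! i)) N' \<Longrightarrow>
      \<bar>real (N i T) - real (N' i T)\<bar> \<le> \<delta>"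
  shows "var_pulls alg T \<nu> i \<le> \<delta>\<^sup>2 + (real T)\<^sup>2 * (2 * real Kbar * real T * exp (- g\<^sup>2 / (2 * \<sigma>\<^sup>2)))"
proof -
  note \<nu>' = sg_classD[OF \<nu>]
  interpret prob_space "reward_table \<nu>"
    by (rule prob_space_reward_table[OF \<nu>'(1)])
  define \<beta> where "\<beta> = 2 * real Kbar * real T * exp (- g\<^sup>2 / (2 * \<sigma>\<^sup>2))"
  define G where "G = good_table \<nu> T g"
  have bad: "space (reward_table \<nu>) - G \<in> sets (reward_table \<nu>)"
    unfolding G_def using good_table_complement(1)[OF \<nu>'(1) _ g \<sigma>] \<nu>'(5) by blast
  have "measure (reward_table \<nu>) (space (reward_table \<nu>) - G) \<le> 2 * real (length \<nu>) * real T * exp (- g\<^sup>2 / (2 * \<sigma>\<^sup>2))"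
    unfolding G_def using good_table_complement(2)[OF \<nu>'(1) _ g \<sigma>] \<nu>'(5) by blast
  also have "\<dots> \<le> \<beta>"
    unfolding \<beta>_def using \<nu>'(3) by (intro mult_right_mono) auto
  finally have \<beta>: "measure (reward_table \<nu>) (space (reward_table \<nu>) - G) \<le> \<beta>" .
  have run: "ucb_run (length \<nu>) T f g (\<lambda>i. mean (\<nu> ! i)) (\<lambda>i t. count_list (take t as) i)"
    if "x \<in> G" "as \<in> set_pmf (arms_given (alg T (length \<nu>)) x T)" for x as
    using that T by (intro ucb_run_arms[OF dec ucb \<nu>'(1)]) (auto simp: G_def)
  have "G \<noteq> {}"
  proof
    assume "G = {}"
    then have "1 \<le> \<beta>"
      using \<beta> prob_space by simp
    then show False
      using small by (simp add: \<beta>_def)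
  qed
  then obtain x0 where x0: "x0 \<in> G"
    by blast
  obtain as0 where as0: "as0 \<in> set_pmf (arms_given (alg T (length \<nu>)) x0 T)"
    using set_pmf_not_empty[of "arms_given (alg T (length \<nu>)) x0 T"] by blast
  define n where "n = real (count_list as0 i)"
  have take: "take T as = as" if "as \<in> set_pmf (arms_given (alg T (length \<nu>)) x T)" for x as
    using set_pmf_arms_given_length[OF that] by simp
  have "var_pulls alg T \<nu> i \<le> (\<integral>as. (real (count_list as i) - n)\<^sup>2 \<partial>arms_law alg T \<nu>)"
    by (rule var_pulls_le[OF dec \<nu>'(1)])
  also have "\<dots> \<le> \<delta>\<^sup>2 + (real T)\<^sup>2 * measure (reward_table \<nu>) (space (reward_table \<nu>) - G)"
  proof (rule integral_arms_law_le[OF dec \<nu>'(1) bad])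
    fix x as assume "x \<in> G" and as: "as \<in> set_pmf (arms_given (alg T (length \<nu>)) x T)"
    then have "\<bar>real (count_list as i) - n\<bar> \<le> \<delta>"
      using close[OF run[of x as] run[OF x0 as0]] take[OF as] take[OF as0] by (simp add: n_def)
    then show "(real (count_list as i) - n)\<^sup>2 \<le> \<delta>\<^sup>2"
      using \<delta> by (intro abs_le_square_iff[THEN iffD1]) auto
  next
    fix as assume "as \<in> arm_seqs (length \<nu>) T"
    then have "real (count_list as i) \<le> real T"
      using count_le_length[of as i] by (simp add: arm_seqs_def)
    moreover have "n \<le> real T"
      using count_le_length[of as0 i] set_pmf_arms_given_length[OF as0] by (simp add: n_def)
    moreover have "0 \<le> n"
      by (simp add: n_def)
    ultimately show "(real (count_list as i) - n)\<^sup>2 \<le> (real T)\<^sup>2"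
      by (intro abs_le_square_iff[THEN iffD1]) (simp add: abs_le_iff)
  qed auto
  also have "\<dots> \<le> \<delta>\<^sup>2 + (real T)\<^sup>2 * \<beta>"
    using \<beta> by (intro add_left_mono mult_left_mono) auto
  finally show ?thesis
    by (simp add: \<beta>_def)
qed

lemma alloc_variability_le:
  assumes "\<nu> \<noteq> []" "V \<ge> 0" "\<And>i. i < length \<nu> \<Longrightarrow> var_pulls alg T \<nu> i \<le> V\<^sup>2"
  shows "alloc_variability alg T \<nu> \<le> V"
proof -
  have "sqrt (var_pulls alg T \<nu> i) \<le> V" if "i < length \<nu>" for i
    using assms(2) assms(3)[OF that] by (intro real_le_lsqrt) auto
  then show ?thesis
    unfolding alloc_variability_def using assms(1) by (intro Max.boundedI) auto
qed

lemma alloc_variability_nonneg: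
  assumes "\<nu> \<noteq> []"
  shows "0 \<le> alloc_variability alg T \<nu>"
proof -
  have "0 \<le> sqrt (var_pulls alg T \<nu> 0)"
    by (simp add: var_pulls_nonneg)
  also have "\<dots> \<le> alloc_variability alg T \<nu>"
    unfolding alloc_variability_def using assms by (intro Max_ge) auto
  finally show ?thesis .
qed

subsection \<open>The exploration function of the theorem\<close>

definition bonus_exponent :: "real \<Rightarrow> real" where
  "bonus_exponent \<rho> = max ((2 * \<rho> - 1) / (2 + 2 * \<rho>)) 0"

definition bonus :: "real \<Rightarrow> nat \<Rightarrow> real" where
  "bonus \<rho> t = real t powr bonus_exponent \<rho> * ln (real t)"

text \<open>The 6 makes the tail of one event \<open>1 / T ^ 3\<close>. After the union bound, bad
  tables have probability of order \<open>1 / T ^ 2\<close>, which compensates the factor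
  \<open>T ^ 2\<close> in the variance.\<close>

definition noise_level :: "real \<Rightarrow> nat \<Rightarrow> real" where
  "noise_level \<sigma> T = \<sigma> * sqrt (6 * ln (real T))"

lemma bonus_exponent_bounds:
  assumes "0 \<le> \<rho>" "\<rho> \<le> 2"
  shows "0 \<le> bonus_exponent \<rho>" "bonus_exponent \<rho> \<le> 1 / 2"
proof -
  have "(2 * \<rho> - 1) / (2 + 2 * \<rho>) \<le> 1 / 2"
    using assms by (simp add: field_simps)
  then show "bonus_exponent \<rho> \<le> 1 / 2"
    unfolding bonus_exponent_def by (rule max.boundedI) simp
  show "0 \<le> bonus_exponent \<rho>"
    by (simp add: bonus_exponent_def)
qed

lemma bonus_mono:
  assumes "1 \<le> s" "s \<le> t"
  shows "bonus \<rho> s \<le> bonus \<rho> t"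
  unfolding bonus_def using assms
  by (intro mult_mono powr_mono2) (auto simp: bonus_exponent_def)

lemma bonus_nonneg: "bonus \<rho> t \<ge> 0"
  by (cases "t = 0") (auto simp: bonus_def)

lemma ln_le_bonus:
  assumes "1 \<le> t"
  shows "ln (real t) \<le> bonus \<rho> t"
proof -
  have "1 \<le> real t powr bonus_exponent \<rho>"
    using assms by (intro ge_one_powr_ge_zero) (auto simp: bonus_exponent_def)
  then have "1 * ln (real t) \<le> bonus \<rho> t"
    unfolding bonus_def using assms by (intro mult_right_mono) auto
  then show ?thesis
    by simp
qed

lemma bonus_le:
  assumes "0 \<le> \<rho>" "\<rho> \<le> 2" "1 \<le> T"
  shows "bonus \<rho> T \<le> sqrt (real T) * ln (real T)"
proof -
  have "real T powr bonus_exponent \<rho> \<le> real T powr (1 / 2)"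
    using bonus_exponent_bounds[OF assms(1,2)] assms(3) by (intro powr_mono) auto
  then show ?thesis
    unfolding bonus_def using assms(3) by (intro mult_right_mono) (auto simp: powr_half_sqrt)
qed

text \<open>The power contributes at most \<open>x\<close>, since its exponent is at most 1/2; this
  is where \<open>\<rho> \<le> 2\<close> enters. The logarithms contribute at most
  \<open>(1 + d)\<^sup>2\<close>, and \<open>L \<ge> 16 * \<kappa>\<close> fits this into the
  permitted correction.\<close>

lemma bonus_growth:
  assumes \<rho>: "0 \<le> \<rho>" "\<rho> \<le> 2" and \<kappa>: "\<kappa> \<ge> 1" and T: "ln (real T / \<kappa>) \<ge> 16 * \<kappa>" "T \<ge> 1"
    and t: "real T / \<kappa> \<le> real t" "t \<le> T"
  shows "(bonus \<rho> T / bonus \<rho> t)\<^sup>2 \<le> (real T / real t) * (1 + (real T / real t - 1) / (4 * \<kappa>))"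
proof -
  define e where "e = bonus_exponent \<rho>"
  define x where "x = real T / real t"
  define L where "L = ln (real t)"
  have Tk: "real T / \<kappa> > 0"
    using T \<kappa> by simp
  have tpos: "real t > 0"
    using Tk t(1) by linarith
  have x: "1 \<le> x" "x \<le> \<kappa>"
    using t tpos \<kappa> by (auto simp: x_def field_simps)
  have "ln (real T / \<kappa>) \<le> L"
    unfolding L_def using Tk t(1) by simp
  then have L: "L \<ge> 16 * \<kappa>" "L > 0"
    using T(1) \<kappa> by linarith+
  have "ln (real T) = L + ln x"
    using T(2) tpos by (simp add: L_def x_def ln_div)
  also have "\<dots> \<le> L + (x - 1)"
    using ln_le_minus_one[of x] x by simp
  finally have lnT: "ln (real T) \<le> L + (x - 1)" .
  define d where "d = (x - 1) / L"
  have d: "0 \<le> d" "d \<le> 1 / 16"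
  proof -
    have "x - 1 \<le> 1 / 16 * L"
      using x L(1) by simp
    then show "d \<le> 1 / 16"
      using L(2) by (simp add: d_def pos_divide_le_eq)
  qed (use x L in \<open>simp add: d_def\<close>)
  have "ln (real T) / L \<le> 1 + d"
    using lnT L(2) by (simp add: d_def field_simps)
  then have "(ln (real T) / L)\<^sup>2 \<le> (1 + d)\<^sup>2"
    using T(2) L(2) by (intro power_mono) auto
  also have "\<dots> = 1 + d * (2 + d)"
    by (simp add: power2_eq_square algebra_simps)
  also have "\<dots> \<le> 1 + d * 4"
    using d by (intro add_left_mono mult_left_mono) auto
  also have "d * 4 \<le> (x - 1) / (4 * \<kappa>)"
  proof -
    have "d \<le> (x - 1) / (16 * \<kappa>)"
      unfolding d_def using L \<kappa> x by (intro divide_left_mono) auto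
    then show ?thesis
      by simp
  qed
  finally have logs: "(ln (real T) / L)\<^sup>2 \<le> 1 + (x - 1) / (4 * \<kappa>)"
    by simp
  have "(real T powr e / real t powr e)\<^sup>2 = x powr (2 * e)"
  proof -
    have "real T powr e / real t powr e = x powr e"
      using T(2) tpos by (simp add: x_def powr_divide)
    then show ?thesis
      by (simp add: power2_eq_square powr_add[symmetric])
  qed
  also have "\<dots> \<le> x powr 1"
    using bonus_exponent_bounds[OF \<rho>] x by (intro powr_mono) (auto simp: e_def)
  finally have powers: "(real T powr e / real t powr e)\<^sup>2 \<le> x"
    using x by simp
  have "(bonus \<rho> T / bonus \<rho> t)\<^sup>2 = (real T powr e / real t powr e)\<^sup>2 * (ln (real T) / L)\<^sup>2"
  proof -
    have "bonus \<rho> T / bonus \<rho> t = (real T powr e / real t powr e) * (ln (real T) / L)"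
      by (simp add: bonus_def e_def L_def)
    then show ?thesis
      by (simp only: power_mult_distrib)
  qed
  also have "\<dots> \<le> x * (1 + (x - 1) / (4 * \<kappa>))"
    using powers logs x by (intro mult_mono) auto
  finally show ?thesis
    by (simp add: x_def)
qed

definition rate :: "real \<Rightarrow> nat \<Rightarrow> real" where
  "rate \<rho> T = max (sqrt (real T)) (real T powr (3 * \<rho> / (2 + 2 * \<rho>)))"

lemma rate_eq:
  assumes "0 \<le> \<rho>" "1 \<le> T"
  shows "rate \<rho> T = real T powr (bonus_exponent \<rho> + 1 / 2)"
proof -
  define p q where "p = (2 * \<rho> - 1) / (2 + 2 * \<rho>)" and "q = 3 * \<rho> / (2 + 2 * \<rho>)"
  have "q = p + 1 / 2"
    using assms(1) by (simp add: p_def q_def field_simps)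
  then have "bonus_exponent \<rho> + 1 / 2 = max (1 / 2) q"
    unfolding bonus_exponent_def p_def[symmetric] by (simp add: max_def)
  moreover have "real T powr max (1 / 2) q = max (real T powr (1 / 2)) (real T powr q)"
  proof (cases "1 / 2 \<le> q")
    case True
    then have "real T powr (1 / 2) \<le> real T powr q"
      using assms(2) by (intro powr_mono) auto
    then show ?thesis
      using True by simp
  next
    case False
    then have "real T powr q \<le> real T powr (1 / 2)"
      using assms(2) by (intro powr_mono) auto
    then show ?thesis
      using False by simp
  qed
  ultimately show ?thesis
    by (simp add: rate_def q_def powr_half_sqrt)
qed

lemma exp_noise_level:
  assumes "\<sigma> > 0" "T \<ge> 1"
  shows "exp (- (noise_level \<sigma> T)\<^sup>2 / (2 * \<sigma>\<^sup>2)) = 1 / real T ^ 3"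
proof -
  have "- (noise_level \<sigma> T)\<^sup>2 / (2 * \<sigma>\<^sup>2) = - (real 3 * ln (real T))"
    using assms by (simp add: noise_level_def power_mult_distrib)
  then have "exp (- (noise_level \<sigma> T)\<^sup>2 / (2 * \<sigma>\<^sup>2)) = inverse (exp (real 3 * ln (real T)))"
    by (simp add: exp_minus)
  also have "exp (real 3 * ln (real T)) = real T ^ 3"
    using assms(2) by (subst exp_of_nat_mult) simp
  finally show ?thesis
    by (simp only: inverse_eq_divide)
qed

lemma regime_const_ge_1: "regime_const K \<ge> 1"
  by (simp add: regime_const_def noise_const_def)

text \<open>Conditions on the horizon under which \<open>T\<^sup>1\<^sup>/\<^sup>4\<close> can serve as \<open>t0\<close> in the analysis above.\<close>

definition large_horizon :: "real \<Rightarrow> nat \<Rightarrow> nat \<Rightarrow> bool" where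
  "large_horizon \<sigma> K T \<longleftrightarrow>
     exp 1 \<le> real T \<and> 4 * K \<le> T \<and>
     8 * regime_const K * noise_level \<sigma> T \<le> ln (real T) / 4 \<and>
     real T powr (1 / 4) \<le> real T / (2 * real K) \<and>
     ln (real T / (2 * real K)) \<ge> 16 * (2 * real K) \<and>
     sqrt (real T) * ln (real T) \<le> noise_level \<sigma> T * (real T / (2 * real K) - 1) \<and>
     real K * (1 + real T powr (1 / 4)) * (sqrt (real T) * ln (real T)) \<le> real T * noise_level \<sigma> T"

lemma eventually_large_horizon:
  assumes "\<sigma> > 0" "K \<ge> 1"
  shows "eventually (large_horizon \<sigma> K) sequentially"
proof -
  define D k where "D = regime_const K" and "k = real K"
  have pos: "D > 0" "k > 0"
    using regime_const_ge_1[of K] assms(2) by (auto simp: D_def k_def)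
  have "eventually (\<lambda>x::real. exp 1 \<le> x) at_top" "eventually (\<lambda>x::real. 4 * k \<le> x) at_top"
    by (rule eventually_ge_at_top)+
  moreover have "eventually (\<lambda>x::real. 8 * D * (\<sigma> * sqrt (6 * ln x)) \<le> ln x / 4) at_top"
    using pos assms(1) by real_asymp
  moreover have "eventually (\<lambda>x::real. x powr (1 / 4) \<le> x / (2 * k)) at_top"
    using pos by real_asymp
  moreover have "eventually (\<lambda>x::real. ln (x / (2 * k)) \<ge> 16 * (2 * k)) at_top"
    using pos by real_asymp
  moreover have "eventually (\<lambda>x::real. sqrt x * ln x \<le> \<sigma> * sqrt (6 * ln x) * (x / (2 * k) - 1)) at_top"
    using pos assms(1) by real_asymp
  moreover have "eventually (\<lambda>x::real. k * (1 + x powr (1 / 4)) * (sqrt x * ln x) \<le> x * (\<sigma> * sqrt (6 * ln x))) at_top"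
    using pos assms(1) by real_asymp
  ultimately have "eventually (\<lambda>x::real. exp 1 \<le> x \<and> 4 * k \<le> x \<and>
     8 * D * (\<sigma> * sqrt (6 * ln x)) \<le> ln x / 4 \<and>
     x powr (1 / 4) \<le> x / (2 * k) \<and>
     ln (x / (2 * k)) \<ge> 16 * (2 * k) \<and>
     sqrt x * ln x \<le> \<sigma> * sqrt (6 * ln x) * (x / (2 * k) - 1) \<and>
     k * (1 + x powr (1 / 4)) * (sqrt x * ln x) \<le> x * (\<sigma> * sqrt (6 * ln x))) at_top"
    by eventually_elim blast
  from eventually_compose_filterlim[OF this filterlim_real_sequentially]
  show ?thesis
  proof eventually_elim
    case (elim T)
    then have "4 * K \<le> T"
      unfolding k_def by linarith
    with elim show ?case
      unfolding large_horizon_def noise_level_def D_def k_def by blast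
  qed
qed

text \<open>From time \<open>T powr (1 / 4)\<close> on, the logarithm in the bonus is at least
  \<open>ln T / 4\<close>, which beats noise of order \<open>sqrt (ln T)\<close> even when the power
  in the bonus is trivial.\<close>

lemma large_horizon_bonus:
  assumes "large_horizon \<sigma> K T" "\<sigma> > 0" "real T powr (1 / 4) \<le> real t"
  shows "8 * regime_const K * noise_level \<sigma> T \<le> bonus \<rho> t"
proof -
  have T: "exp 1 \<le> real T" "8 * regime_const K * noise_level \<sigma> T \<le> ln (real T) / 4"
    using assms(1) by (auto simp: large_horizon_def)
  have T1: "1 \<le> real T"
    using T(1) exp_ge_add_one_self[of 1] by linarith
  have "1 \<le> real T powr (1 / 4)"
    using T1 by (intro ge_one_powr_ge_zero) auto
  then have t: "1 \<le> t"
    using assms(3) by linarith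
  have "ln (real T) / 4 = ln (real T powr (1 / 4))"
    using T1 by (simp add: ln_powr)
  also have "\<dots> \<le> ln (real t)"
    using assms(3) T1 t by (subst ln_le_cancel_iff) auto
  also have "\<dots> \<le> bonus \<rho> t"
    by (rule ln_le_bonus[OF t])
  finally show ?thesis
    using T(2) by linarith
qed

lemma large_horizon_basic:
  assumes "large_horizon \<sigma> K T" "\<sigma> > 0"
  shows "1 \<le> ln (real T)" "1 \<le> T" "0 < noise_level \<sigma> T" "noise_level \<sigma> T \<le> 3 * \<sigma> * ln (real T)"
proof -
  have T: "exp 1 \<le> real T"
    using assms(1) by (simp add: large_horizon_def)
  then have T1: "1 < real T"
    using exp_ge_add_one_self[of 1] by linarith
  then show "1 \<le> T"
    by simp
  show ln1: "1 \<le> ln (real T)"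
    using T T1 by (simp add: ln_ge_iff)
  then show "0 < noise_level \<sigma> T"
    using assms(2) by (simp add: noise_level_def)
  have "sqrt (6 * ln (real T)) \<le> sqrt (9 * ln (real T))"
    using ln1 by (intro real_sqrt_le_mono) auto
  also have "\<dots> = 3 * sqrt (ln (real T))"
    by (simp add: real_sqrt_mult)
  finally have "sqrt (6 * ln (real T)) \<le> 3 * sqrt (ln (real T))" .
  then have le: "noise_level \<sigma> T \<le> 3 * \<sigma> * sqrt (ln (real T))"
    using mult_left_mono[of "sqrt (6 * ln (real T))" "3 * sqrt (ln (real T))" \<sigma>] assms(2)
    by (simp add: noise_level_def mult_ac)
  have "sqrt (ln (real T)) \<le> ln (real T)"
    using ln1 by (intro real_le_lsqrt) (auto simp: power2_eq_square)
  then have "3 * \<sigma> * sqrt (ln (real T)) \<le> 3 * \<sigma> * ln (real T)"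
    using assms(2) by (intro mult_left_mono) auto
  then show "noise_level \<sigma> T \<le> 3 * \<sigma> * ln (real T)"
    using le by linarith
qed

section \<open>Bounds for the chosen bonus\<close>

lemma regret_bonus_le:
  assumes dec: "decision_rules alg" and ucb: "is_ucb (bonus \<rho>) alg" and \<nu>: "\<nu> \<in> sg_class M \<sigma> Kbar"
    and \<rho>: "0 \<le> \<rho>" "\<rho> \<le> 2" and M: "M > 0" and \<sigma>: "\<sigma> > 0"
    and T: "large_horizon \<sigma> Kbar T"
  shows "regret alg T \<nu> \<le> real Kbar * (10 * M + 1 + 3 * \<sigma>) * rate \<rho> T * ln (real T)"
proof -
  note basic = large_horizon_basic[OF T \<sigma>]
  define g where "g = noise_level \<sigma> T"
  define t0 where "t0 = real T powr (1 / 4)"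
  have T1: "1 \<le> real T"
    using basic(2) by simp
  have fg: "g \<le> bonus \<rho> t" if "t0 \<le> real t" for t
  proof -
    have "1 * g \<le> 8 * regime_const Kbar * g"
      using regime_const_ge_1[of Kbar] basic(3) unfolding g_def by (intro mult_right_mono) auto
    then show ?thesis
      using large_horizon_bonus[OF T \<sigma>, of t \<rho>] that by (simp add: t0_def g_def)
  qed
  have "4 * Kbar \<le> T"
    using T by (simp add: large_horizon_def)
  then have KT: "Kbar \<le> T"
    by simp
  have le: "regret alg T \<nu> \<le> real Kbar * (2 * M * (t0 + 2) + (bonus \<rho> T + g) * sqrt (real T)) +
      2 * M * real T * (2 * real Kbar * real T * exp (- g\<^sup>2 / (2 * \<sigma>\<^sup>2)))"
    using basic(3) by (intro regret_ucb_le[OF dec ucb \<nu> KT M \<sigma> _ _ bonus_mono fg bonus_nonneg]) (auto simp: g_def t0_def)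
  define r where "r = rate \<rho> T * ln (real T)"
  have rate1: "1 \<le> rate \<rho> T" "sqrt (real T) \<le> rate \<rho> T"
    using T1 by (auto simp: rate_def le_max_iff_disj)
  have "rate \<rho> T * 1 \<le> r"
    unfolding r_def using basic(1) rate1 by (intro mult_left_mono) auto
  then have r: "1 \<le> r" "sqrt (real T) \<le> r"
    using rate1 by linarith+
  have "t0 \<le> real T powr (1 / 2)"
    unfolding t0_def using T1 by (intro powr_mono) auto
  then have t0: "t0 \<le> r"
    using r(2) by (simp add: powr_half_sqrt)
  have bonus: "bonus \<rho> T * sqrt (real T) = r"
  proof -
    have "real T powr (1 / 2) = sqrt (real T)"
      using T1 by (simp add: powr_half_sqrt)
    then show ?thesis
      unfolding r_def rate_eq[OF \<rho>(1) basic(2)] bonus_def powr_add by simp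
  qed
  have noise: "g * sqrt (real T) \<le> 3 * \<sigma> * r"
  proof -
    have "g * sqrt (real T) \<le> (3 * \<sigma> * ln (real T)) * rate \<rho> T"
      unfolding g_def using basic(1,3,4) rate1 \<sigma> by (intro mult_mono) auto
    then show ?thesis
      by (simp add: r_def mult_ac)
  qed
  have "2 * M * (t0 + 2) \<le> 2 * M * (3 * r)"
    using t0 r(1) M by (intro mult_left_mono) auto
  then have "2 * M * (t0 + 2) + (bonus \<rho> T + g) * sqrt (real T) \<le> (6 * M + 1 + 3 * \<sigma>) * r"
    using bonus noise by (simp add: algebra_simps)
  then have main: "real Kbar * (2 * M * (t0 + 2) + (bonus \<rho> T + g) * sqrt (real T)) \<le> real Kbar * ((6 * M + 1 + 3 * \<sigma>) * r)"
    by (intro mult_left_mono) auto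
  have "2 * M * real T * (2 * real Kbar * real T * exp (- g\<^sup>2 / (2 * \<sigma>\<^sup>2))) = 4 * M * real Kbar / real T"
    unfolding g_def exp_noise_level[OF \<sigma> basic(2)] using T1 by (simp add: power3_eq_cube)
  also have "\<dots> \<le> 4 * M * real Kbar / 1"
    using T1 M by (intro divide_left_mono) auto
  also have "\<dots> \<le> 4 * M * real Kbar * r"
    using r(1) M mult_left_mono[of 1 r "4 * M * real Kbar"] by simp
  finally have "regret alg T \<nu> \<le> real Kbar * ((6 * M + 1 + 3 * \<sigma>) * r) + 4 * M * real Kbar * r"
    using le main by linarith
  also have "\<dots> = real Kbar * (10 * M + 1 + 3 * \<sigma>) * r"
    by (simp add: algebra_simps)
  finally show ?thesis
    by (simp add: r_def mult.assoc)
qed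

lemma ucb_regime_bonus:
  assumes T: "large_horizon \<sigma> K T" and K: "2 \<le> K" and \<rho>: "0 \<le> \<rho>" "\<rho> \<le> 2" and \<sigma>: "\<sigma> > 0"
    and b: "b < K" "\<And>i. i < K \<Longrightarrow> \<mu> i \<le> \<mu> b"
  shows "ucb_regime K T (bonus \<rho>) (noise_level \<sigma> T) (real T powr (1 / 4)) \<mu> b"
proof -
  note basic = large_horizon_basic[OF T \<sigma>]
  have large: "4 * K \<le> T" "real T powr (1 / 4) \<le> real T / (2 * real K)"
     "ln (real T / (2 * real K)) \<ge> 16 * (2 * real K)"
     "sqrt (real T) * ln (real T) \<le> noise_level \<sigma> T * (real T / (2 * real K) - 1)"
     "real K * (1 + real T powr (1 / 4)) * (sqrt (real T) * ln (real T)) \<le> real T * noise_level \<sigma> T"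
    using T by (auto simp: large_horizon_def)
  have bonus_le: "bonus \<rho> T \<le> sqrt (real T) * ln (real T)"
    by (rule bonus_le[OF \<rho> basic(2)])
  have "real K * (1 + real T powr (1 / 4)) * bonus \<rho> T \<le>
      real K * (1 + real T powr (1 / 4)) * (sqrt (real T) * ln (real T))"
    using bonus_le by (intro mult_left_mono) auto
  then have small: "real K * (1 + real T powr (1 / 4)) * bonus \<rho> T \<le> real T * noise_level \<sigma> T"
    using large(5) by linarith
  show ?thesis
  proof
    show "8 * regime_const K * noise_level \<sigma> T \<le> bonus \<rho> t" if "real T powr (1 / 4) \<le> real t" for t
      by (rule large_horizon_bonus[OF T \<sigma> that])
    show "(bonus \<rho> T / bonus \<rho> t)\<^sup>2 \<le> real T / real t * (1 + (real T / real t - 1) / (4 * (2 * real K)))"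
      if "real T / (2 * real K) \<le> real t" "t \<le> T" for t
      using bonus_growth[OF \<rho> _ large(3) basic(2) that] K by simp
    show "bonus \<rho> T \<le> noise_level \<sigma> T * (real T / (2 * real K) - 1)"
      using bonus_le large(4) by linarith
  qed (use K b large small basic in \<open>auto intro: bonus_mono\<close>)
qed

definition var_const :: "real \<Rightarrow> nat \<Rightarrow> real" where
  "var_const \<sigma> K = real K * (24 * \<sigma> * regime_const K + 2)"

text \<open>The main term of \<open>deviation\<close> is a multiple of
  \<open>g * T / bonus \<rho> T\<close>. Bounding \<open>g\<close> by a multiple of
  \<open>ln T\<close> cancels the logarithm of the bonus and leaves \<open>T powr (1 - e)\<close>;
  bad tables add only \<open>2 * Kbar\<close> to the variance.\<close>

lemma var_pulls_bonus_le:
  assumes dec: "decision_rules alg" and ucb: "is_ucb (bonus \<rho>) alg" and \<nu>: "\<nu> \<in> sg_class M \<sigma> Kbar"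
    and \<rho>: "1 / 2 \<le> \<rho>" "\<rho> \<le> 2" and \<sigma>: "\<sigma> > 0" and i: "i < length \<nu>"
    and T: "large_horizon \<sigma> (length \<nu>) T" and TK: "2 * Kbar < T"
  shows "var_pulls alg T \<nu> i \<le> ((var_const \<sigma> (length \<nu>) + 2 * real Kbar) * real T powr (1 - bonus_exponent \<rho>))\<^sup>2"
proof -
  note \<nu>' = sg_classD[OF \<nu>]
  note basic = large_horizon_basic[OF T \<sigma>]
  define K where "K = length \<nu>"
  define g where "g = noise_level \<sigma> T"
  have \<rho>0: "0 \<le> \<rho>"
    using \<rho> by simp
  have T1: "1 \<le> real T"
    using basic(2) by simp
  have K: "2 \<le> K" "K \<le> Kbar"
    using \<nu>' by (auto simp: K_def)
  have "4 * K \<le> T"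
    using T by (simp add: large_horizon_def K_def)
  then have KT: "length \<nu> \<le> T"
    by (simp add: K_def)
  obtain b where b: "b < K" "\<And>i. i < K \<Longrightarrow> mean (\<nu> ! i) \<le> mean (\<nu> ! b)"
    unfolding K_def using best_arm[OF \<nu>'(4)] by metis
  interpret ucb_regime K T "bonus \<rho>" g "real T powr (1 / 4)" "\<lambda>i. mean (\<nu> ! i)" b
    unfolding g_def using T K(1) \<rho>0 \<rho>(2) \<sigma> b unfolding K_def by (rule ucb_regime_bonus)
  define e where "e = bonus_exponent \<rho>"
  define w where "w = real T powr (1 - e)"
  have e: "0 \<le> e" "e \<le> 1 / 2"
    using bonus_exponent_bounds[OF \<rho>0 \<rho>(2)] by (simp_all add: e_def)
  have w1: "1 \<le> w"
    unfolding w_def using T1 e by (intro ge_one_powr_ge_zero) auto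
  have t0w: "real T powr (1 / 4) \<le> w"
    unfolding w_def using T1 e by (intro powr_mono) auto
  have "g * real T / bonus \<rho> T \<le> 3 * \<sigma> * w"
  proof -
    have "g * real T / bonus \<rho> T \<le> (3 * \<sigma> * ln (real T)) * real T / bonus \<rho> T"
      using basic(4) bonus_nonneg T1 unfolding g_def by (intro divide_right_mono mult_right_mono) auto
    moreover have "T \<noteq> 1"
      using basic(1) by auto
    then have "(3 * \<sigma> * ln (real T)) * real T / bonus \<rho> T = 3 * \<sigma> * w"
      using basic(1) T1 by (simp add: bonus_def w_def e_def powr_diff)
    ultimately show ?thesis
      by simp
  qed
  then have "8 * regime_const K * (g * real T / bonus \<rho> T) \<le> 8 * regime_const K * (3 * \<sigma> * w)"
    using regime_const_ge_1[of K] by (intro mult_left_mono) auto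
  then have dev: "deviation \<le> (24 * \<sigma> * regime_const K + 2) * w"
    using t0w w1 by (simp add: deviation_def regime_const_eq[symmetric] algebra_simps)
  define \<delta> where "\<delta> = var_const \<sigma> K * w"
  have \<delta>: "real K * deviation \<le> \<delta>"
    using mult_left_mono[OF dev, of "real K"] by (simp add: \<delta>_def var_const_def mult.assoc)
  have \<delta>0: "0 \<le> \<delta>"
    using \<delta> deviation_nonneg by (meson mult_nonneg_nonneg of_nat_0_le_iff order_trans)
  have prob: "2 * real Kbar * real T * exp (- g\<^sup>2 / (2 * \<sigma>\<^sup>2)) = 2 * real Kbar / (real T)\<^sup>2"
    unfolding g_def exp_noise_level[OF \<sigma> basic(2)] using T1 by (simp add: power3_eq_cube power2_eq_square)
  have "var_pulls alg T \<nu> i \<le> \<delta>\<^sup>2 + (real T)\<^sup>2 * (2 * real Kbar * real T * exp (- g\<^sup>2 / (2 * \<sigma>\<^sup>2)))"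
  proof (rule var_pulls_ucb_le[OF dec ucb \<nu> KT \<sigma> _ i _ \<delta>0])
    show "g > 0"
      using basic(3) by (simp add: g_def)
    have "real T * 1 \<le> (real T)\<^sup>2"
      unfolding power2_eq_square using T1 by (intro mult_left_mono) auto
    moreover have "2 * real Kbar < real T"
      using TK by linarith
    ultimately have "2 * real Kbar < (real T)\<^sup>2"
      by linarith
    then show "2 * real Kbar * real T * exp (- g\<^sup>2 / (2 * \<sigma>\<^sup>2)) < 1"
      unfolding prob using T1 by simp
    fix N N' assume "ucb_run (length \<nu>) T (bonus \<rho>) g (\<lambda>i. mean (\<nu> ! i)) N"
      "ucb_run (length \<nu>) T (bonus \<rho>) g (\<lambda>i. mean (\<nu> ! i)) N'"
    then have "\<bar>real (N i T) - real (N' i T)\<bar> \<le> real K * deviation"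
      using i unfolding K_def[symmetric] by (rule ucb_runs_close)
    then show "\<bar>real (N i T) - real (N' i T)\<bar> \<le> \<delta>"
      using \<delta> by linarith
  qed
  also have "\<dots> = \<delta>\<^sup>2 + 2 * real Kbar"
    unfolding prob using T1 by simp
  also have "\<dots> \<le> (\<delta> + 2 * real Kbar * w)\<^sup>2"
  proof -
    have "1 \<le> 2 * real Kbar * w"
    proof -
      have "1 * 1 \<le> 2 * real Kbar * w"
      proof (intro mult_mono)
        show "1 \<le> 2 * real Kbar"
          using \<nu>'(2,3) by linarith
      qed (use w1 in auto)
      then show ?thesis
        by simp
    qed
    then have "2 * real Kbar * w * 1 \<le> (2 * real Kbar * w) * (2 * real Kbar * w)"
      using w1 by (intro mult_left_mono) auto
    moreover have "2 * real Kbar * 1 \<le> 2 * real Kbar * w"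
      using w1 by (intro mult_left_mono) auto
    moreover have "0 \<le> 2 * \<delta> * (2 * real Kbar * w)"
      using \<delta>0 w1 by simp
    moreover have "(\<delta> + 2 * real Kbar * w)\<^sup>2 = \<delta>\<^sup>2 + (2 * real Kbar * w) * (2 * real Kbar * w) + 2 * \<delta> * (2 * real Kbar * w)"
      by (simp add: power2_eq_square algebra_simps)
    ultimately show ?thesis
      by linarith
  qed
  also have "\<delta> + 2 * real Kbar * w = (var_const \<sigma> K + 2 * real Kbar) * w"
    by (simp add: \<delta>_def algebra_simps)
  finally show ?thesis
    by (simp add: w_def e_def K_def)
qed

text \<open>Summing over the possible numbers of arms gives one constant for the whole
  class.\<close>

definition var_bound :: "real \<Rightarrow> nat \<Rightarrow> real" where
  "var_bound \<sigma> Kbar = (\<Sum>K\<le>Kbar. var_const \<sigma> K) + 2 * real Kbar"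

lemma var_const_nonneg: "\<sigma> > 0 \<Longrightarrow> 0 \<le> var_const \<sigma> K"
  using regime_const_ge_1[of K] by (simp add: var_const_def)

text \<open>For \<open>\<rho> < 1 / 2\<close> the trivial bound \<open>T / 2\<close> is enough, as
  its power stays below \<open>sqrt T\<close>. Otherwise
  \<open>(1 - bonus_exponent \<rho>) * \<rho>\<close> is exactly the exponent of the rate.\<close>

lemma rpow_alloc_variability_le:
  assumes dec: "decision_rules alg" and ucb: "is_ucb (bonus \<rho>) alg" and \<nu>: "\<nu> \<in> sg_class M \<sigma> Kbar"
    and \<rho>: "0 \<le> \<rho>" "\<rho> \<le> 2" and \<sigma>: "\<sigma> > 0"
    and T: "large_horizon \<sigma> (length \<nu>) T" and TK: "2 * Kbar < T"
  shows "rpow (alloc_variability alg T \<nu>) \<rho> \<le> (1 + var_bound \<sigma> Kbar powr \<rho>) * rate \<rho> T"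
proof -
  note \<nu>' = sg_classD[OF \<nu>]
  have T1: "1 \<le> real T"
    using large_horizon_basic(2)[OF T \<sigma>] by simp
  have rate: "1 \<le> rate \<rho> T" "sqrt (real T) \<le> rate \<rho> T" "real T powr (3 * \<rho> / (2 + 2 * \<rho>)) \<le> rate \<rho> T"
    using T1 by (auto simp: rate_def le_max_iff_disj)
  have S0: "0 \<le> alloc_variability alg T \<nu>"
    by (rule alloc_variability_nonneg[OF \<nu>'(4)])
  show ?thesis
  proof (cases "\<rho> < 1 / 2")
    case True
    have "rpow (alloc_variability alg T \<nu>) \<rho> \<le> rate \<rho> T"
    proof (cases "\<rho> = 0")
      case False
      have "alloc_variability alg T \<nu> \<le> real T / 2"
        using var_pulls_le_square[OF dec \<nu>'(1)] by (intro alloc_variability_le[OF \<nu>'(4)]) auto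
      then have "alloc_variability alg T \<nu> powr \<rho> \<le> real T powr \<rho>"
        using S0 \<rho> by (intro powr_mono2) auto
      also have "\<dots> \<le> real T powr (1 / 2)"
        using True T1 by (intro powr_mono) auto
      also have "\<dots> = sqrt (real T)"
        using T1 by (simp add: powr_half_sqrt)
      finally show ?thesis
        using rate(2) False by (simp add: rpow_def)
    qed (use rate in \<open>simp add: rpow_def\<close>)
    also have "1 * rate \<rho> T \<le> (1 + var_bound \<sigma> Kbar powr \<rho>) * rate \<rho> T"
      using rate(1) by (intro mult_right_mono) auto
    finally show ?thesis
      by simp
  next
    case False
    define w where "w = real T powr (1 - bonus_exponent \<rho>)"
    have "var_const \<sigma> (length \<nu>) \<le> (\<Sum>K\<le>Kbar. var_const \<sigma> K)"
      using \<nu>'(3) var_const_nonneg[OF \<sigma>] by (intro member_le_sum) auto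
    then have B: "var_const \<sigma> (length \<nu>) + 2 * real Kbar \<le> var_bound \<sigma> Kbar"
      by (simp add: var_bound_def)
    have B0: "0 \<le> var_const \<sigma> (length \<nu>) + 2 * real Kbar"
      using var_const_nonneg[OF \<sigma>] by simp
    have w: "0 \<le> w"
      by (simp add: w_def)
    have "alloc_variability alg T \<nu> \<le> (var_const \<sigma> (length \<nu>) + 2 * real Kbar) * w"
      using var_pulls_bonus_le[OF dec ucb \<nu> _ \<rho>(2) \<sigma> _ T TK] False B0 w unfolding w_def
      by (intro alloc_variability_le[OF \<nu>'(4)]) auto
    also have "\<dots> \<le> var_bound \<sigma> Kbar * w"
      using B w by (intro mult_right_mono) auto
    finally have "alloc_variability alg T \<nu> powr \<rho> \<le> (var_bound \<sigma> Kbar * w) powr \<rho>"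
      using S0 \<rho> by (intro powr_mono2) auto
    also have "\<dots> = var_bound \<sigma> Kbar powr \<rho> * w powr \<rho>"
      using B B0 w by (intro powr_mult)
    also have "w powr \<rho> = real T powr (3 * \<rho> / (2 + 2 * \<rho>))"
    proof -
      have "bonus_exponent \<rho> = (2 * \<rho> - 1) / (2 + 2 * \<rho>)"
        using False by (simp add: bonus_exponent_def)
      moreover have "(1 - (2 * \<rho> - 1) / (2 + 2 * \<rho>)) * \<rho> = 3 * \<rho> / (2 + 2 * \<rho>)"
        using \<rho> by (simp add: field_simps)
      ultimately have "(1 - bonus_exponent \<rho>) * \<rho> = 3 * \<rho> / (2 + 2 * \<rho>)"
        by simp
      then show ?thesis
        by (simp add: w_def powr_powr)
    qed
    also have "var_bound \<sigma> Kbar powr \<rho> * real T powr (3 * \<rho> / (2 + 2 * \<rho>)) \<le> (1 + var_bound \<sigma> Kbar powr \<rho>) * rate \<rho> T"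
      using rate(3) by (intro mult_mono) auto
    finally show ?thesis
      using False by (simp add: rpow_def)
  qed
qed

definition upper_const :: "real \<Rightarrow> real \<Rightarrow> nat \<Rightarrow> real \<Rightarrow> real" where
  "upper_const M \<sigma> Kbar \<rho> = real Kbar * (10 * M + 1 + 3 * \<sigma>) + (1 + var_bound \<sigma> Kbar powr \<rho>)"

lemma worst_case_bonus_le:
  assumes dec: "decision_rules alg" and ucb: "is_ucb (bonus \<rho>) alg"
    and \<rho>: "0 \<le> \<rho>" "\<rho> \<le> 2" and M: "M > 0" and \<sigma>: "\<sigma> > 0" and Kbar: "Kbar \<ge> 2"
    and T: "\<And>K. 2 \<le> K \<Longrightarrow> K \<le> Kbar \<Longrightarrow> large_horizon \<sigma> K T" and TK: "2 * Kbar < T"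
  shows "worst_case (sg_class M \<sigma> Kbar) \<rho> alg T \<le> ereal (upper_const M \<sigma> Kbar \<rho> * (rate \<rho> T * ln (real T)))"
  unfolding worst_case_def
proof (rule SUP_least)
  fix \<nu> assume \<nu>: "\<nu> \<in> sg_class M \<sigma> Kbar"
  have TK': "large_horizon \<sigma> Kbar T" "large_horizon \<sigma> (length \<nu>) T"
    using T Kbar sg_classD(2,3)[OF \<nu>] by auto
  have ln1: "1 \<le> ln (real T)"
    by (rule large_horizon_basic(1)[OF TK'(1) \<sigma>])
  have "rpow (alloc_variability alg T \<nu>) \<rho> \<le> (1 + var_bound \<sigma> Kbar powr \<rho>) * rate \<rho> T"
    by (rule rpow_alloc_variability_le[OF dec ucb \<nu> \<rho> \<sigma> TK'(2) TK])
  also have "\<dots> \<le> (1 + var_bound \<sigma> Kbar powr \<rho>) * rate \<rho> T * ln (real T)"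
  proof -
    have "0 \<le> (1 + var_bound \<sigma> Kbar powr \<rho>) * rate \<rho> T"
      by (intro mult_nonneg_nonneg) (auto simp: rate_def le_max_iff_disj)
    then show ?thesis
      using mult_left_mono[OF ln1] by fastforce
  qed
  finally have "regret alg T \<nu> + rpow (alloc_variability alg T \<nu>) \<rho> \<le>
      upper_const M \<sigma> Kbar \<rho> * (rate \<rho> T * ln (real T))"
    using regret_bonus_le[OF dec ucb \<nu> \<rho> M \<sigma> TK'(1)] by (simp add: upper_const_def algebra_simps)
  then show "ereal (regret alg T \<nu> + rpow (alloc_variability alg T \<nu>) \<rho>) \<le>
      ereal (upper_const M \<sigma> Kbar \<rho> * (rate \<rho> T * ln (real T)))"
    by simp
qed

lemma lower_rate_eq_rate:
  assumes "0 \<le> \<rho>" "\<rho> \<le> 2" "1 \<le> T"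
  shows "lower_rate \<rho> T = rate \<rho> T"
proof -
  have "3 * \<rho> / (2 + 2 * \<rho>) \<le> 1"
    using assms by (simp add: field_simps)
  then have "real T powr (3 * \<rho> / (2 + 2 * \<rho>)) \<le> real T powr 1"
    using assms(3) by (intro powr_mono) auto
  then show ?thesis
    by (simp add: lower_rate_def rate_def)
qed

text \<open>The upper bound also makes the supremum finite, so that it is eventually the real number
  \<open>u T\<close>. One logarithm suffices: it occurs in the upper bound, and dividing the lower
  bound by \<open>ln T \<ge> 1\<close> only weakens it.\<close>

lemma worst_case_bonus_soft_theta:
  assumes alg: "admissible alg" and ucb: "is_ucb (bonus \<rho>) alg"
    and \<rho>: "0 \<le> \<rho>" "\<rho> \<le> 2" and M: "M > 0" and \<sigma>: "\<sigma> > 0" and Kbar: "Kbar \<ge> 2"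
  shows "worst_case (sg_class M \<sigma> Kbar) \<rho> alg \<in> soft_theta (rate \<rho>)"
proof -
  have dec: "decision_rules alg"
    using alg by (simp add: admissible_def)
  define w where "w = worst_case (sg_class M \<sigma> Kbar) \<rho> alg"
  define u where "u T = real_of_ereal (w T)" for T
  have "eventually (\<lambda>T. \<forall>K\<in>{2..Kbar}. large_horizon \<sigma> K T) sequentially"
    using eventually_large_horizon[OF \<sigma>] by (intro eventually_ball_finite) auto
  then have ev: "eventually (\<lambda>T. w T = ereal (u T) \<and> u T \<le> upper_const M \<sigma> Kbar \<rho> * (rate \<rho> T * ln (real T)) \<and>
      lower_const M \<sigma> \<rho> * rate \<rho> T \<le> u T \<and> 1 \<le> ln (real T) \<and> 0 < rate \<rho> T) sequentially"
    using eventually_gt_at_top[of "2 * Kbar"]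
  proof eventually_elim
    case (elim T)
    have T: "large_horizon \<sigma> Kbar T"
      using elim Kbar by auto
    have le: "w T \<le> ereal (upper_const M \<sigma> Kbar \<rho> * (rate \<rho> T * ln (real T)))"
      unfolding w_def using elim by (intro worst_case_bonus_le[OF dec ucb \<rho> M \<sigma> Kbar]) auto
    have rate: "lower_rate \<rho> T = rate \<rho> T"
      using elim by (intro lower_rate_eq_rate[OF \<rho>]) auto
    have "ereal (lower_const M \<sigma> \<rho> * lower_rate \<rho> T) \<le> w T"
      unfolding w_def using elim Kbar by (intro worst_case_ge_lower_rate[OF alg M \<sigma> Kbar \<rho>(1)]) auto
    then have ge: "ereal (lower_const M \<sigma> \<rho> * rate \<rho> T) \<le> w T"
      by (simp add: rate)
    have eq: "w T = ereal (u T)"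
      using le ge by (cases "w T") (auto simp: u_def)
    moreover have "0 < rate \<rho> T"
      using lower_rate_pos[of T \<rho>] elim rate by simp
    ultimately show ?case
      using le ge large_horizon_basic(1)[OF T \<sigma>] by simp
  qed
  have lower_pos: "lower_const M \<sigma> \<rho> > 0"
    using M \<sigma> by (simp add: lower_const_def)
  have "u \<in> O(\<lambda>T. rate \<rho> T * ln (real T) ^ 1)"
  proof (rule bigoI)
    show "eventually (\<lambda>T. norm (u T) \<le> upper_const M \<sigma> Kbar \<rho> * norm (rate \<rho> T * ln (real T) ^ 1)) sequentially"
      using ev
    proof eventually_elim
      case (elim T)
      then have "0 \<le> lower_const M \<sigma> \<rho> * rate \<rho> T"
        using lower_pos by simp
      then show ?case
        using elim by simp
    qed
  qed
  moreover have "u \<in> \<Omega>(\<lambda>T. rate \<rho> T / ln (real T) ^ 1)"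
  proof (rule landau_omega.bigI[OF lower_pos])
    show "eventually (\<lambda>T. norm (u T) \<ge> lower_const M \<sigma> \<rho> * norm (rate \<rho> T / ln (real T) ^ 1)) sequentially"
      using ev
    proof eventually_elim
      case (elim T)
      have "rate \<rho> T / ln (real T) \<le> rate \<rho> T / 1"
        using elim by (intro divide_left_mono) auto
      then have "lower_const M \<sigma> \<rho> * (rate \<rho> T / ln (real T)) \<le> lower_const M \<sigma> \<rho> * rate \<rho> T"
        using lower_pos by (intro mult_left_mono) auto
      also have "\<dots> \<le> \<bar>u T\<bar>"
        using elim by linarith
      finally show ?case
        using elim by simp
    qed
  qed
  moreover have "eventually (\<lambda>T. w T = ereal (u T)) sequentially"
    using ev by eventually_elim simp
  ultimately show ?thesis
    unfolding soft_theta_def w_def[symmetric] by blast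
qed

theorem corollary5:
  fixes M \<sigma> \<rho> :: real and Kbar :: nat
  assumes "M > 0" and "\<sigma> > 0" and "Kbar \<ge> 2" and "\<rho> \<ge> 0"
  shows "(\<exists>c6::real. c6 > 0 \<and>
           (\<forall>alg. admissible alg \<longrightarrow>
              liminf (\<lambda>T. worst_case (sg_class M \<sigma> Kbar) \<rho> alg T /
                ereal (max (sqrt (real T))
                        (min (real T powr (3 * \<rho> / (2 + 2 * \<rho>))) (real T))))
              > ereal c6)) \<and>
         (\<rho> \<le> 2 \<longrightarrow>
           (\<forall>alg. admissible alg \<and>
                  is_ucb (\<lambda>t. real t powr (max ((2 * \<rho> - 1) / (2 + 2 * \<rho>)) 0) * ln (real t)) alg \<longrightarrow>
              worst_case (sg_class M \<sigma> Kbar) \<rho> alg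
                \<in> soft_theta (\<lambda>T. max (sqrt (real T)) (real T powr (3 * \<rho> / (2 + 2 * \<rho>))))))"
proof (intro conjI impI allI)
  have pos: "lower_const M \<sigma> \<rho> > 0"
    using assms by (simp add: lower_const_def)
  \<comment> \<open>Halving the constant turns the bound on the limit inferior into a strict
    one.\<close>
  have "ereal (lower_const M \<sigma> \<rho> / 2) < liminf (\<lambda>T. worst_case (sg_class M \<sigma> Kbar) \<rho> alg T / ereal (lower_rate \<rho> T))"
    if "admissible alg" for alg
  proof -
    have "ereal (lower_const M \<sigma> \<rho> / 2) < ereal (lower_const M \<sigma> \<rho>)"
      using pos by simp
    also have "\<dots> \<le> liminf (\<lambda>T. worst_case (sg_class M \<sigma> Kbar) \<rho> alg T / ereal (lower_rate \<rho> T))"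
      by (rule liminf_worst_case_ge[OF that assms])
    finally show ?thesis .
  qed
  then show "\<exists>c6::real. c6 > 0 \<and>
           (\<forall>alg. admissible alg \<longrightarrow>
              liminf (\<lambda>T. worst_case (sg_class M \<sigma> Kbar) \<rho> alg T /
                ereal (max (sqrt (real T))
                        (min (real T powr (3 * \<rho> / (2 + 2 * \<rho>))) (real T))))
              > ereal c6)"
    using pos unfolding lower_rate_def by (intro exI[of _ "lower_const M \<sigma> \<rho> / 2"]) simp
next
  fix alg
  assume "\<rho> \<le> 2" and alg: "admissible alg \<and>
    is_ucb (\<lambda>t. real t powr (max ((2 * \<rho> - 1) / (2 + 2 * \<rho>)) 0) * ln (real t)) alg"
  then have "is_ucb (bonus \<rho>) alg"
    unfolding bonus_def[abs_def] bonus_exponent_def by blast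
  then show "worst_case (sg_class M \<sigma> Kbar) \<rho> alg
      \<in> soft_theta (\<lambda>T. max (sqrt (real T)) (real T powr (3 * \<rho> / (2 + 2 * \<rho>))))"
    using worst_case_bonus_soft_theta[of alg \<rho> M \<sigma> Kbar] alg assms \<open>\<rho> \<le> 2\<close>
    unfolding rate_def[abs_def] by blast
qed

end
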